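(* Let $d\in\mathbb{N}$, let $0<\gamma,\eta\leq1$, and let $F,S\subseteq\mathbb{R}^d$ be Lebesgue measurable sets of finite and positive Lebesgue measure such that $F$ has finite $\gamma$-perimeter, $\operatorname{Per}_\gamma(F)<\infty$, and $S$ has finite $\eta$-perimeter, $\operatorname{Per}_\eta(S)<\infty$. Then there is a constant $C(F,S)$, determined by $d,\gamma,\eta,|F|,|S|,\operatorname{Per}_\gamma(F),\operatorname{Per}_\eta(S)$ only, such that for all $R\geq2$ and all $\varepsilon\in(0,1)$, \[ \big|N_\varepsilon(R)-(2\pi)^{-d}|F||S|R^d\big|\leq\frac{C(F,S)}{\varepsilon(1-\varepsilon)} \begin{cases} R^{d-\gamma}\log(R) & \text{if }\gamma=\eta,\\ R^{d-\eta} & \text{if }\gamma>\eta,\\ R^{d-\gamma} & \text{if }\eta>\gamma. \end{cases} \]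
   Context: $|U|$ denotes the Lebesgue measure of a measurable set $U\subseteq\mathbb{R}^d$, $\mathbf{1}_U$ its indicator function, and $RU:=\{Rx:x\in U\}$ for $R>0$. $\log$ is the logarithm to base 2. The Fourier transform on $L^2(\mathbb{R}^d)$ is normalized to be unitary: $\mathcal{F}f(\xi)=(2\pi)^{-d/2}\int_{\mathbb{R}^d}f(x)e^{ix\cdot\xi}\,dx$ and $\mathcal{F}^{-1}g(x)=(2\pi)^{-d/2}\int_{\mathbb{R}^d}g(\xi)e^{-ix\cdot\xi}\,d\xi$. For measurable $F,S\subseteq\mathbb{R}^d$, define on $L^2(\mathbb{R}^d)$ the orthogonal projections $P_Ff:=\mathbf{1}_F f$ and $B_S:=\mathcal{F}^{-1}P_S\mathcal{F}$. For fixed $F,S$ of finite measure and $R>0$, put $T_R:=P_{RF}B_SP_{RF}$. This is a compact self-adjoint operator, with eigenvalues (counted with multiplicity) ordered as $1\geq\lambda_1(T_R)\geq\lambda_2(T_R)\geq\cdots\geq0$. For $\varepsilon\in(0,1)$, $N_\varepsilon(R):=\#\{k:\lambda_k(T_R)>\varepsilon\}$. For $0<\gamma\leq1$ and $U\subseteq\mathbb{R}^d$ measurable of finite and positive measure, the $\gamma$-perimeter of $U$ is \[ \operatorname{Per}_\gamma(U):=\sup_{h\in\mathbb{R}^d\setminus\{0\}}\frac{|U\triangle(U-h)|}{|h|^\gamma}, \] where $U-h=\{x-h:x\in U\}$, $\triangle$ is the symmetric difference and $|h|$ is the Euclidean norm. $U$ has finite $\gamma$-perimeter if $\operatorname{Per}_\gamma(U)<\infty$.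 *)

theory Defs
  imports "HOL-Analysis.Analysis"
begin

text \<open>
  Elements of \<open>L\<^sup>2\<close> are represented by functions; identification up to null sets is made
  explicit by \<open>AE x in lebesgue\<close> wherever equality in \<open>L\<^sup>2\<close> is meant.
\<close>

definition L2 :: "('a::euclidean_space \<Rightarrow> complex) set" where
  "L2 = {f \<in> borel_measurable lebesgue. integrable lebesgue (\<lambda>x. (cmod (f x))\<^sup>2)}"

definition L2_tendsto ::
    "(nat \<Rightarrow> 'a::euclidean_space \<Rightarrow> complex) \<Rightarrow> ('a \<Rightarrow> complex) \<Rightarrow> bool" where
  "L2_tendsto u f \<longleftrightarrow>
     (\<lambda>n. \<integral>\<^sup>+x. ennreal ((cmod (u n x - f x))\<^sup>2) \<partial>lebesgue) \<longlonglongrightarrow> 0"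

definition fourier_integral ::
    "('a::euclidean_space \<Rightarrow> complex) \<Rightarrow> 'a \<Rightarrow> complex" where
  "fourier_integral f \<xi> = complex_of_real ((2 * pi) powr (- real DIM('a) / 2)) *
     (LINT x|lebesgue. f x * exp (\<i> * complex_of_real (x \<bullet> \<xi>)))"

definition inv_fourier_integral ::
    "('a::euclidean_space \<Rightarrow> complex) \<Rightarrow> 'a \<Rightarrow> complex" where
  "inv_fourier_integral g x = complex_of_real ((2 * pi) powr (- real DIM('a) / 2)) *
     (LINT \<xi>|lebesgue. g \<xi> * exp (- \<i> * complex_of_real (x \<bullet> \<xi>)))"

text \<open>
  The integrals above converge absolutely only for integrable functions. On \<open>L\<^sup>2\<close> the transforms
  are, as usual, the extension by continuity from \<open>L\<^sup>1 \<inter> L\<^sup>2\<close>. By Plancherel's theorem the function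
  chosen below exists for every \<open>f\<close> in \<open>L\<^sup>2\<close> and is unique up to a null set.
\<close>

definition L2_extension ::
    "(('a::euclidean_space \<Rightarrow> complex) \<Rightarrow> 'a \<Rightarrow> complex) \<Rightarrow> ('a \<Rightarrow> complex) \<Rightarrow> 'a \<Rightarrow> complex" where
  "L2_extension A f = (SOME g. g \<in> L2 \<and>
     (\<exists>u. (\<forall>n. u n \<in> L2 \<and> integrable lebesgue (u n)) \<and>
          L2_tendsto u f \<and> L2_tendsto (\<lambda>n. A (u n)) g))"

definition fourier :: "('a::euclidean_space \<Rightarrow> complex) \<Rightarrow> 'a \<Rightarrow> complex" where
  "fourier = L2_extension fourier_integral"

definition inv_fourier :: "('a::euclidean_space \<Rightarrow> complex) \<Rightarrow> 'a \<Rightarrow> complex" where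
  "inv_fourier = L2_extension inv_fourier_integral"

definition space_proj ::
    "'a::euclidean_space set \<Rightarrow> ('a \<Rightarrow> complex) \<Rightarrow> 'a \<Rightarrow> complex" where
  "space_proj F f = (\<lambda>x. indicator F x * f x)"

definition freq_proj ::
    "'a::euclidean_space set \<Rightarrow> ('a \<Rightarrow> complex) \<Rightarrow> 'a \<Rightarrow> complex" where
  "freq_proj S f = inv_fourier (space_proj S (fourier f))"

definition limiting_op ::
    "'a::euclidean_space set \<Rightarrow> 'a set \<Rightarrow> real \<Rightarrow> ('a \<Rightarrow> complex) \<Rightarrow> 'a \<Rightarrow> complex" where
  "limiting_op F S R f =
     (let RF = (\<lambda>x. R *\<^sub>R x) ` F in space_proj RF (freq_proj S (space_proj RF f)))"

definition eigenspace ::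
    "(('a::euclidean_space \<Rightarrow> complex) \<Rightarrow> 'a \<Rightarrow> complex) \<Rightarrow> real \<Rightarrow> ('a \<Rightarrow> complex) set" where
  "eigenspace T \<mu> = {f \<in> L2. AE x in lebesgue. T f x = complex_of_real \<mu> * f x}"

text \<open>
  \<open>V\<close> has complex dimension \<open>n\<close> modulo almost everywhere equality, i.e. a basis of \<open>n\<close> elements.
\<close>

definition has_dim :: "('a::euclidean_space \<Rightarrow> complex) set \<Rightarrow> nat \<Rightarrow> bool" where
  "has_dim V n \<longleftrightarrow> (\<exists>b :: nat \<Rightarrow> 'a \<Rightarrow> complex.
     (\<forall>i<n. b i \<in> V) \<and>
     (\<forall>c :: nat \<Rightarrow> complex.
        (AE x in lebesgue. (\<Sum>i<n. c i * b i x) = 0) \<longrightarrow> (\<forall>i<n. c i = 0)) \<and>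
     (\<forall>f\<in>V. \<exists>c :: nat \<Rightarrow> complex. AE x in lebesgue. f x = (\<Sum>i<n. c i * b i x)))"

text \<open>
  The eigenvalues of a compact positive operator, in decreasing order and repeated according to
  multiplicity, starting at index \<open>0\<close>. If there are only finitely many positive eigenvalues, the
  sequence continues with zeros (the kernel is then infinite dimensional); otherwise all its
  members are positive. For such an operator exactly one sequence has these properties.
\<close>

definition ordered_eigenvalues ::
    "(('a::euclidean_space \<Rightarrow> complex) \<Rightarrow> 'a \<Rightarrow> complex) \<Rightarrow> (nat \<Rightarrow> real) \<Rightarrow> bool" where
  "ordered_eigenvalues T ev \<longleftrightarrow> decseq ev \<and> (\<forall>k. 0 \<le> ev k) \<and> ev \<longlonglongrightarrow> 0 \<and>
     (\<forall>\<mu>>0. has_dim (eigenspace T \<mu>) (card {k. ev k = \<mu>}))"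

definition eigenvalue_seq ::
    "(('a::euclidean_space \<Rightarrow> complex) \<Rightarrow> 'a \<Rightarrow> complex) \<Rightarrow> nat \<Rightarrow> real" where
  "eigenvalue_seq T = (SOME ev. ordered_eigenvalues T ev)"

definition eigenvalue_count ::
    "'a::euclidean_space set \<Rightarrow> 'a set \<Rightarrow> real \<Rightarrow> real \<Rightarrow> nat" where
  "eigenvalue_count F S \<epsilon> R = card {k. eigenvalue_seq (limiting_op F S R) k > \<epsilon>}"

definition Per :: "real \<Rightarrow> 'a::euclidean_space set \<Rightarrow> ennreal" where
  "Per \<gamma> U = (SUP h\<in>UNIV - {0}.
     emeasure lebesgue (sym_diff U ((\<lambda>x. x - h) ` U)) / ennreal (norm h powr \<gamma>))"

end

theory Submission
  imports Defs "HOL-Complex_Analysis.Great_Picard" "HOL-Probability.Characteristic_Functions"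
begin

text \<open>
  Write \<open>E = R F\<close>, \<open>c = (2\<pi>)\<^sup>-\<^sup>d\<^sup>/\<^sup>2\<close> and let \<open>\<kappa>\<close> be the inverse transform of the indicator function of \<open>S\<close>.
  The operator is \<open>T = A\<^sup>*A\<close>, where \<open>A f\<close> is the Fourier transform of \<open>f\<close> cut off to \<open>E\<close>, restricted to
  \<open>S\<close>. Both are Hilbert--Schmidt: \<open>A\<close> has a kernel of modulus \<open>c\<close> on \<open>S \<times> E\<close>, and \<open>T\<close> has the kernel
  \<open>c \<kappa> (x - y)\<close> on \<open>E \<times> E\<close>. Hence the eigenvalues satisfy \<open>\<Sum>\<lambda> = \<parallel>A\<parallel>\<^sup>2 = c\<^sup>2 \<bar>E\<bar> \<bar>S\<bar> = H\<close>, which is the main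
  term, and \<open>\<Sum>\<lambda>\<^sup>2 = \<parallel>T\<parallel>\<^sup>2\<close> in Hilbert--Schmidt norms. Since \<open>0 \<le> \<lambda> \<le> 1\<close>, the number \<open>\<bar>1 - \<lambda>\<bar>\<close> for \<open>\<lambda> > \<epsilon>\<close>
  and \<open>\<lambda>\<close> for \<open>\<lambda> \<le> \<epsilon>\<close> is at most \<open>\<lambda> (1 - \<lambda>) / (\<epsilon> (1 - \<epsilon>))\<close>, so the count differs from \<open>\<Sum>\<lambda>\<close> by at most
  \<open>\<Sum>(\<lambda> - \<lambda>\<^sup>2) / (\<epsilon> (1 - \<epsilon>))\<close>. Everything thus comes down to the trace of \<open>T - T\<^sup>2\<close>.

  By Plancherel's identity \<open>\<parallel>\<kappa>\<parallel>\<^sup>2 = \<bar>S\<bar>\<close>, this trace is the integral of \<open>c\<^sup>2 \<bar>\<kappa> z\<bar>\<^sup>2 (\<bar>E\<bar> - \<bar>E \<inter> (E + z)\<bar>)\<close>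
  (\<open>trace_deficit_le\<close>). The deficit of overlap is controlled by the perimeter of \<open>F\<close>: it is at most a
  constant times \<open>R\<^sup>d min 1 ((\<bar>z\<bar> / R)\<^sup>\<gamma>)\<close> (\<open>overlap_deficit_scaled\<close>). The decay of \<open>\<kappa>\<close> is controlled by
  the perimeter of \<open>S\<close>: translating \<open>S\<close> by \<open>h\<close> multiplies \<open>\<kappa>\<close> by a character, so the integral of
  \<open>\<bar>\<kappa> z\<bar>\<^sup>2 \<bar>1 - exp (i h \<bullet> z)\<bar>\<^sup>2\<close> is at most a constant times \<open>\<bar>h\<bar>\<^sup>\<eta>\<close> (\<open>nsq_modulation_le\<close>), and taking
  \<open>\<bar>h\<bar> = 2\<^sup>-\<^sup>j\<close> bounds the mass of \<open>\<bar>\<kappa>\<bar>\<^sup>2\<close> at distance about \<open>2\<^sup>j\<close>. The resulting sum of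
  \<open>min 1 ((2\<^sup>j / R)\<^sup>\<gamma>) 2\<^sup>-\<^sup>j\<^sup>\<eta>\<close> over \<open>j\<close> has the three rates of the theorem (\<open>dyadic_sum_le\<close>).

  The spectral theorem enters in a finite form. For each \<open>\<delta> > 0\<close> an orthonormal family of eigenvectors
  with eigenvalues above \<open>\<delta>\<close> has at most \<open>H / \<delta>\<close> members, and on the complement of a largest one the
  quadratic form of \<open>T\<close> is at most \<open>\<delta> \<parallel>f\<parallel>\<^sup>2\<close>, because otherwise compactness would yield a further
  eigenvector (\<open>ex_maximal_eigenfamily\<close>). Such a family determines all eigenspaces for eigenvalues above
  \<open>\<delta>\<close>, which gives existence of the ordered eigenvalues and identifies the count, and its eigenvalues
  satisfy \<open>\<Sum>\<lambda> \<le> H\<close> and \<open>\<parallel>T\<parallel>\<^sup>2 \<le> \<Sum>\<lambda>\<^sup>2 + \<delta> H\<close>; then \<open>\<delta>\<close> tends to zero.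

  Plancherel's theorem is derived with Gaussian convergence factors. On integrable functions in \<open>L\<^sup>2\<close>
  only the inequality \<open>\<parallel>fourier f\<parallel> \<le> \<parallel>f\<parallel>\<close> is shown, which makes the extension to \<open>L\<^sup>2\<close> unambiguous and gives
  \<open>\<lambda> \<le> 1\<close>; equality is shown for indicator functions of sets of finite perimeter, where it follows from
  the continuity of the overlaps.
\<close>

section \<open>The Hilbert space of square integrable functions\<close>

definition ip :: "('a::euclidean_space \<Rightarrow> complex) \<Rightarrow> ('a \<Rightarrow> complex) \<Rightarrow> complex" where
  "ip f g = (LINT x|lebesgue. f x * cnj (g x))"

definition nsq :: "('a::euclidean_space \<Rightarrow> complex) \<Rightarrow> real" where
  "nsq f = (LINT x|lebesgue. (cmod (f x))\<^sup>2)"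

lemma L2_measurable: "f \<in> L2 \<Longrightarrow> f \<in> borel_measurable lebesgue"
  and L2_integrable_sq: "f \<in> L2 \<Longrightarrow> integrable lebesgue (\<lambda>x. (cmod (f x))\<^sup>2)"
  by (auto simp: L2_def)

lemma L2I: "f \<in> borel_measurable lebesgue \<Longrightarrow> integrable lebesgue (\<lambda>x. (cmod (f x))\<^sup>2) \<Longrightarrow> f \<in> L2"
  by (auto simp: L2_def)

lemma mult_le_half_squares: "(a::real) * b \<le> (a\<^sup>2 + b\<^sup>2) / 2"
  using sum_squares_bound[of a b] by simp

lemma L2_mult_integrable:
  assumes "f \<in> L2" "g \<in> L2"
  shows "integrable lebesgue (\<lambda>x. f x * g x)"
proof (rule Bochner_Integration.integrable_bound)
  show "integrable lebesgue (\<lambda>x. ((cmod (f x))\<^sup>2 + (cmod (g x))\<^sup>2) / 2)"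
    using assms by (auto simp: L2_def)
  show "(\<lambda>x. f x * g x) \<in> borel_measurable lebesgue"
    using assms by (auto simp: L2_def)
  show "AE x in lebesgue. norm (f x * g x) \<le> norm (((cmod (f x))\<^sup>2 + (cmod (g x))\<^sup>2) / 2)"
    using mult_le_half_squares by (auto simp: norm_mult)
qed

lemma L2_cnj: "f \<in> L2 \<Longrightarrow> (\<lambda>x. cnj (f x)) \<in> L2"
  using borel_measurable_continuous_onI[OF continuous_on_cnj[OF continuous_on_id], THEN measurable_compose[rotated], of f lebesgue]
  by (auto simp: L2_def)

lemma ip_integrable:
  "f \<in> L2 \<Longrightarrow> g \<in> L2 \<Longrightarrow> integrable lebesgue (\<lambda>x. f x * cnj (g x))"
  using L2_mult_integrable[OF _ L2_cnj] .

lemma L2_scale: "f \<in> L2 \<Longrightarrow> (\<lambda>x. c * f x) \<in> L2"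
  by (auto simp: L2_def norm_mult power_mult_distrib)

lemma L2_zero: "(\<lambda>x. 0) \<in> L2"
  by (auto simp: L2_def)

lemma cmod_add_sq_le: "(cmod (a + b))\<^sup>2 \<le> 2 * (cmod a)\<^sup>2 + 2 * (cmod b)\<^sup>2"
proof -
  have "(cmod (a + b))\<^sup>2 \<le> (cmod a + cmod b)\<^sup>2"
    by (intro power_mono norm_triangle_ineq) auto
  then show ?thesis
    using sum_squares_bound[of "cmod a" "cmod b"] by (simp add: power2_sum)
qed

lemma L2_add:
  assumes "f \<in> L2" "g \<in> L2"
  shows "(\<lambda>x. f x + g x) \<in> L2"
proof (rule L2I)
  show "integrable lebesgue (\<lambda>x. (cmod (f x + g x))\<^sup>2)"
  proof (rule Bochner_Integration.integrable_bound)
    show "integrable lebesgue (\<lambda>x. 2 * (cmod (f x))\<^sup>2 + 2 * (cmod (g x))\<^sup>2)"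
      using assms by (auto simp: L2_def)
  qed (use assms cmod_add_sq_le in \<open>auto simp: L2_def\<close>)
qed (use assms in \<open>auto simp: L2_def\<close>)

lemma L2_diff: "f \<in> L2 \<Longrightarrow> g \<in> L2 \<Longrightarrow> (\<lambda>x. f x - g x) \<in> L2"
  using L2_add[OF _ L2_scale[of g "-1"]] by simp

lemma L2_sum: "(\<And>i. i \<in> I \<Longrightarrow> f i \<in> L2) \<Longrightarrow> (\<lambda>x. \<Sum>i\<in>I. f i x) \<in> L2"
proof (induction I rule: infinite_finite_induct)
  case (insert i I)
  then show ?case using L2_add[of "f i" "\<lambda>x. \<Sum>i\<in>I. f i x"] by simp
qed (auto simp: L2_zero)

lemma L2_dominated:
  assumes "g \<in> borel_measurable lebesgue" "f \<in> L2" "\<And>x. cmod (g x) \<le> cmod (f x)"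
  shows "g \<in> L2"
proof (rule L2I)
  show "integrable lebesgue (\<lambda>x. (cmod (g x))\<^sup>2)"
    by (rule Bochner_Integration.integrable_bound[OF L2_integrable_sq[OF assms(2)]])
       (use assms in \<open>auto simp: power_mono\<close>)
qed fact

lemma L2_indicator_mult:
  "U \<in> sets lebesgue \<Longrightarrow> f \<in> L2 \<Longrightarrow> (\<lambda>x. indicator U x * f x) \<in> L2"
  by (rule L2_dominated[of _ f]) (auto simp: L2_def indicator_def)

lemma L2_bounded_on_finite:
  fixes f :: "'a::euclidean_space \<Rightarrow> complex"
  assumes "U \<in> lmeasurable" "f \<in> borel_measurable lebesgue" "\<And>x. cmod (f x) \<le> B"
  shows "(\<lambda>x. indicator U x * f x) \<in> L2" "integrable lebesgue (\<lambda>x. indicator U x * f x)"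
proof -
  have U: "U \<in> sets lebesgue" "emeasure lebesgue U < \<infinity>"
    using assms(1) by (auto simp: fmeasurable_def)
  have *: "integrable lebesgue (\<lambda>x. indicator U x * b :: real)" for b
    using U by (intro integrable_mult_left integrable_real_indicator)
  have B: "0 \<le> B" using assms(3)[of undefined] norm_ge_zero order_trans by blast
  have m: "(\<lambda>x. indicator U x * f x) \<in> borel_measurable lebesgue"
    using U assms by auto
  show "(\<lambda>x. indicator U x * f x) \<in> L2"
  proof (rule L2I[OF m], rule Bochner_Integration.integrable_bound[OF *[of "B\<^sup>2"]])
    show "AE x in lebesgue. norm ((cmod (indicator U x * f x))\<^sup>2) \<le> norm (indicator U x * B\<^sup>2)"
      using assms(3) by (auto simp: indicator_def power_mono)
  qed (use m in measurable)
  show "integrable lebesgue (\<lambda>x. indicator U x * f x)"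
  proof (rule Bochner_Integration.integrable_bound[OF *[of "B"] m])
    show "AE x in lebesgue. norm (indicator U x * f x) \<le> norm (indicator U x * B)"
      using assms(3) B by (auto simp: indicator_def)
  qed
qed

lemma L2_integrable_on_finite:
  fixes f :: "'a::euclidean_space \<Rightarrow> complex"
  assumes "U \<in> lmeasurable" "f \<in> L2"
  shows "integrable lebesgue (\<lambda>x. indicator U x * f x)"
  using L2_mult_integrable[OF L2_bounded_on_finite(1)[OF assms(1), of "\<lambda>_. 1" 1] assms(2)] by simp

lemma ip_add_left: "f \<in> L2 \<Longrightarrow> g \<in> L2 \<Longrightarrow> h \<in> L2 \<Longrightarrow> ip (\<lambda>x. f x + g x) h = ip f h + ip g h"
  unfolding ip_def by (simp add: distrib_right ip_integrable)

lemma ip_diff_left: "f \<in> L2 \<Longrightarrow> g \<in> L2 \<Longrightarrow> h \<in> L2 \<Longrightarrow> ip (\<lambda>x. f x - g x) h = ip f h - ip g h"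
  unfolding ip_def by (simp add: left_diff_distrib ip_integrable)

lemma ip_scale_left: "ip (\<lambda>x. c * f x) h = c * ip f h"
  unfolding ip_def by (simp add: mult.assoc)

lemma ip_commute: "ip g f = cnj (ip f g)"
  unfolding ip_def by (simp add: mult.commute flip: Bochner_Integration.integral_cnj)

lemma ip_diff_right: "f \<in> L2 \<Longrightarrow> g \<in> L2 \<Longrightarrow> h \<in> L2 \<Longrightarrow> ip h (\<lambda>x. f x - g x) = ip h f - ip h g"
  by (subst (1 2 3) ip_commute) (simp add: ip_diff_left)

lemma ip_scale_right: "ip h (\<lambda>x. c * f x) = cnj c * ip h f"
  by (subst (1 2) ip_commute) (simp add: ip_scale_left)

lemma ip_sum_left:
  "(\<And>i. i \<in> I \<Longrightarrow> f i \<in> L2) \<Longrightarrow> h \<in> L2 \<Longrightarrow> ip (\<lambda>x. \<Sum>i\<in>I. f i x) h = (\<Sum>i\<in>I. ip (f i) h)"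
proof (induction I rule: infinite_finite_induct)
  case (insert i I)
  then show ?case
    using ip_add_left[of "f i" "\<lambda>x. \<Sum>i\<in>I. f i x" h] L2_sum[of I f] by simp
qed (auto simp: ip_def)

lemma ip_cong_AE:
  assumes "AE x in lebesgue. f x = f' x" "AE x in lebesgue. g x = g' x"
    and "f \<in> L2" "f' \<in> L2" "g \<in> L2" "g' \<in> L2"
  shows "ip f g = ip f' g'"
  unfolding ip_def
  by (rule integral_cong_AE) (use assms in \<open>auto intro!: borel_measurable_integrable ip_integrable\<close>)

lemma nsq_cong_AE:
  assumes "AE x in lebesgue. f x = g x" "f \<in> L2" "g \<in> L2"
  shows "nsq f = nsq g"
  unfolding nsq_def
  by (rule integral_cong_AE) (use assms in \<open>auto simp: L2_def\<close>)

lemma nsq_nonneg [simp]: "0 \<le> nsq f"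
  unfolding nsq_def by simp

lemma ip_self: "ip f f = complex_of_real (nsq f)"
  unfolding ip_def nsq_def integral_complex_of_real[symmetric]
  by (intro Bochner_Integration.integral_cong) (auto simp: complex_norm_square simp del: of_real_power)

lemma nsq_scale: "nsq (\<lambda>x. c * f x) = (cmod c)\<^sup>2 * nsq f"
  unfolding nsq_def by (simp add: norm_mult power_mult_distrib)

lemma nsq_minus_commute: "nsq (\<lambda>x. f x - g x) = nsq (\<lambda>x. g x - f x)"
  unfolding nsq_def by (simp add: norm_minus_commute)

lemma nsq_diff:
  assumes "f \<in> L2" "g \<in> L2"
  shows "nsq (\<lambda>x. f x - g x) = nsq f - 2 * Re (ip f g) + nsq g"
proof -
  have "complex_of_real (nsq (\<lambda>x. f x - g x)) = ip f f - ip f g - (ip g f - ip g g)"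
    using assms L2_diff[OF assms] by (simp add: ip_self[symmetric] ip_diff_left ip_diff_right)
  also have "\<dots> = complex_of_real (nsq f + nsq g) - (ip f g + cnj (ip f g))"
    by (simp add: ip_self ip_commute[of g f])
  finally have "complex_of_real (nsq (\<lambda>x. f x - g x)) = complex_of_real (nsq f - 2 * Re (ip f g) + nsq g)"
    by (simp add: complex_add_cnj)
  then show ?thesis by (simp only: of_real_eq_iff)
qed

lemma nsq_add_le:
  assumes "f \<in> L2" "g \<in> L2"
  shows "nsq (\<lambda>x. f x + g x) \<le> 2 * nsq f + 2 * nsq g"
proof -
  have "nsq (\<lambda>x. f x + g x) \<le> (LINT x|lebesgue. 2 * (cmod (f x))\<^sup>2 + 2 * (cmod (g x))\<^sup>2)"
    unfolding nsq_def using L2_add[OF assms] assms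
    by (intro integral_mono cmod_add_sq_le) (auto simp: L2_def)
  also have "\<dots> = 2 * nsq f + 2 * nsq g"
    using assms by (simp add: nsq_def L2_integrable_sq)
  finally show ?thesis .
qed

lemma nsq_eq_0_iff:
  assumes "f \<in> L2"
  shows "nsq f = 0 \<longleftrightarrow> (AE x in lebesgue. f x = 0)"
  unfolding nsq_def
  by (subst integral_nonneg_eq_0_iff_AE) (use assms in \<open>auto simp: L2_integrable_sq\<close>)

text \<open>Expand \<open>\<parallel>\<langle>g, g\<rangle> f - \<langle>f, g\<rangle> g\<parallel>\<^sup>2 \<ge> 0\<close>. Here \<open>\<parallel>g\<parallel> = 0\<close> only makes \<open>g\<close> vanish almost everywhere.\<close>

lemma ip_Cauchy_Schwarz:
  assumes "f \<in> L2" "g \<in> L2"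
  shows "(cmod (ip f g))\<^sup>2 \<le> nsq f * nsq g"
proof (cases "nsq g = 0")
  case True
  then have "AE x in lebesgue. g x = 0" using assms nsq_eq_0_iff by blast
  then have "ip f g = ip f (\<lambda>x. 0)"
    using assms by (intro ip_cong_AE) (auto simp: L2_zero)
  then show ?thesis by (simp add: ip_def)
next
  case False
  have "0 \<le> nsq (\<lambda>x. of_real (nsq g) * f x - ip f g * g x)" by simp
  also have "\<dots> = (nsq g)\<^sup>2 * nsq f - 2 * Re (of_real (nsq g) * (cnj (ip f g) * ip f g)) + (cmod (ip f g))\<^sup>2 * nsq g"
    by (subst nsq_diff) (auto simp: L2_scale assms ip_scale_left ip_scale_right nsq_scale)
  also have "cnj (ip f g) * ip f g = of_real ((cmod (ip f g))\<^sup>2)"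
    by (metis complex_norm_square mult.commute)
  finally have "0 \<le> nsq g * (nsq g * nsq f - (cmod (ip f g))\<^sup>2)"
    by (simp add: algebra_simps power2_eq_square)
  moreover have "nsq g > 0" using False nsq_nonneg[of g] by linarith
  ultimately show ?thesis by (simp add: zero_le_mult_iff mult.commute)
qed

lemma L2_tendsto_iff:
  assumes "\<And>n. u n \<in> L2" "f \<in> L2"
  shows "L2_tendsto u f \<longleftrightarrow> (\<lambda>n. nsq (\<lambda>x. u n x - f x)) \<longlonglongrightarrow> 0"
proof -
  have "(\<integral>\<^sup>+x. ennreal ((cmod (u n x - f x))\<^sup>2) \<partial>lebesgue) = ennreal (nsq (\<lambda>x. u n x - f x))" for n
    unfolding nsq_def
    by (rule nn_integral_eq_integral) (use L2_diff[OF assms(1) assms(2), of n] in \<open>auto simp: L2_def\<close>)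
  then show ?thesis unfolding L2_tendsto_def
    by (simp add: tendsto_ennreal_iff[of _ _ 0, simplified])
qed

section \<open>Finite orthonormal families\<close>

definition orthonormal :: "nat \<Rightarrow> (nat \<Rightarrow> 'a::euclidean_space \<Rightarrow> complex) \<Rightarrow> bool" where
  "orthonormal n b \<longleftrightarrow> (\<forall>i<n. b i \<in> L2) \<and> (\<forall>i<n. \<forall>j<n. ip (b i) (b j) = (if i = j then 1 else 0))"

definition residual :: "nat \<Rightarrow> (nat \<Rightarrow> 'a::euclidean_space \<Rightarrow> complex) \<Rightarrow> ('a \<Rightarrow> complex) \<Rightarrow> 'a \<Rightarrow> complex" where
  "residual n b f = (\<lambda>x. f x - (\<Sum>i<n. ip f (b i) * b i x))"

lemma residual_L2: "orthonormal n b \<Longrightarrow> f \<in> L2 \<Longrightarrow> residual n b f \<in> L2"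
  unfolding residual_def orthonormal_def by (intro L2_diff L2_sum L2_scale) auto

lemma orthonormal_sum_ip:
  assumes "orthonormal n b" "j < n"
  shows "ip (\<lambda>x. \<Sum>i<n. c i * b i x) (b j) = c j"
proof -
  have "ip (\<lambda>x. \<Sum>i<n. c i * b i x) (b j) = (\<Sum>i<n. c i * ip (b i) (b j))"
    using assms by (subst ip_sum_left) (auto simp: orthonormal_def L2_scale ip_scale_left)
  also have "\<dots> = (\<Sum>i<n. if i = j then c i else 0)"
    using assms by (intro sum.cong) (auto simp: orthonormal_def)
  finally show ?thesis using assms by simp
qed

lemma residual_orthogonal:
  assumes "orthonormal n b" "f \<in> L2" "j < n"
  shows "ip (residual n b f) (b j) = 0"
proof -
  have "ip (residual n b f) (b j) = ip f (b j) - ip (\<lambda>x. \<Sum>i<n. ip f (b i) * b i x) (b j)"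
    unfolding residual_def using assms
    by (intro ip_diff_left L2_sum L2_scale) (auto simp: orthonormal_def)
  then show ?thesis
    using orthonormal_sum_ip[OF assms(1,3), of "\<lambda>i. ip f (b i)"] by simp
qed

text \<open>The residual is orthogonal to \<open>f - residual n b f\<close>. The second equation expresses its norm through
  a single inner product with \<open>f\<close>; for a section of an integral kernel this is a value of the operator.\<close>

lemma nsq_residual:
  assumes "orthonormal n b" "f \<in> L2"
  shows "nsq (residual n b f) = nsq f - (\<Sum>i<n. (cmod (ip f (b i)))\<^sup>2)"
    and "ip (residual n b f) f = of_real (nsq (residual n b f))"
proof -
  let ?r = "residual n b f" and ?s = "\<lambda>x. \<Sum>i<n. ip f (b i) * b i x"
  have b: "\<And>i. i < n \<Longrightarrow> b i \<in> L2" using assms by (auto simp: orthonormal_def)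
  have s: "?s \<in> L2" using b by (intro L2_sum L2_scale) auto
  have r: "?r \<in> L2" using residual_L2 assms by blast
  have "ip ?s ?r = (\<Sum>i<n. ip f (b i) * ip (b i) ?r)"
    using b r by (subst ip_sum_left) (auto simp: L2_scale ip_scale_left)
  also have "\<dots> = 0"
    by (rule sum.neutral) (use residual_orthogonal[OF assms] ip_commute in \<open>metis complex_cnj_zero lessThan_iff mult_zero_right\<close>)
  finally have sr: "ip ?s ?r = 0" .
  have "ip f ?r = ip (\<lambda>x. ?r x + ?s x) ?r" by (simp add: residual_def)
  also have "\<dots> = ip ?r ?r + ip ?s ?r" using r s by (intro ip_add_left)
  finally have fr: "ip f ?r = of_real (nsq ?r)" using sr by (simp add: ip_self)
  then show rf: "ip ?r f = of_real (nsq ?r)" by (subst ip_commute) simp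
  have "ip ?r f = ip f f - ip ?s f"
    unfolding residual_def by (rule ip_diff_left) (use assms s in auto)
  also have "ip ?s f = (\<Sum>i<n. ip f (b i) * ip (b i) f)"
    using b assms by (subst ip_sum_left) (auto simp: L2_scale ip_scale_left)
  also have "\<dots> = (\<Sum>i<n. of_real ((cmod (ip f (b i)))\<^sup>2))"
    by (intro sum.cong refl, subst (2) ip_commute) (simp add: complex_norm_square del: of_real_power)
  finally have "complex_of_real (nsq ?r) = of_real (nsq f - (\<Sum>i<n. (cmod (ip f (b i)))\<^sup>2))"
    unfolding rf by (simp add: ip_self)
  then show "nsq ?r = nsq f - (\<Sum>i<n. (cmod (ip f (b i)))\<^sup>2)"
    by (simp only: of_real_eq_iff)
qed

lemma Bessel_inequality:
  "orthonormal n b \<Longrightarrow> f \<in> L2 \<Longrightarrow> (\<Sum>i<n. (cmod (ip f (b i)))\<^sup>2) \<le> nsq f"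
  using nsq_residual(1)[of n b f] nsq_nonneg[of "residual n b f"] by linarith

section \<open>Borel representatives\<close>

text \<open>A product of Lebesgue measures is not complete, so Fubini's theorem is applied to Borel
  representatives.\<close>

lemma ex_borel_representative:
  fixes f :: "'a::euclidean_space \<Rightarrow> complex"
  assumes "f \<in> borel_measurable lebesgue"
  obtains g where "g \<in> borel_measurable borel" "AE x in lborel. f x = g x"
proof -
  have "\<exists>g\<in>borel_measurable lborel. AE x in lborel. Re (f x) = g x"
    by (rule completion_ex_borel_measurable_real) (use assms in auto)
  moreover have "\<exists>g\<in>borel_measurable lborel. AE x in lborel. Im (f x) = g x"
    by (rule completion_ex_borel_measurable_real) (use assms in auto)
  ultimately obtain g h where gh: "g \<in> borel_measurable borel" "h \<in> borel_measurable borel"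
    "AE x in lborel. Re (f x) = g x" "AE x in lborel. Im (f x) = h x" by auto
  show thesis
  proof (rule that)
    show "(\<lambda>x. of_real (g x) + \<i> * of_real (h x)) \<in> borel_measurable borel"
      using gh by auto
    show "AE x in lborel. f x = of_real (g x) + \<i> * of_real (h x)"
      using gh(3,4) by eventually_elim (auto simp: complex_eq_iff)
  qed
qed

lemma integral_lebesgue_borel_representative:
  fixes f g :: "'a::euclidean_space \<Rightarrow> 'b::{banach, second_countable_topology}"
  assumes "f \<in> borel_measurable lebesgue" "g \<in> borel_measurable borel" "AE x in lborel. f x = g x"
  shows "integral\<^sup>L lebesgue f = integral\<^sup>L lborel g"
    and "integrable lebesgue f \<longleftrightarrow> integrable lborel g"
proof -
  have g: "g \<in> borel_measurable lebesgue" using assms(2) by (simp add: measurable_completion)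
  have ae: "AE x in lebesgue. f x = g x" using assms(3) AE_completion by blast
  have "integral\<^sup>L lebesgue f = integral\<^sup>L lebesgue g"
    by (rule integral_cong_AE) (use assms g ae in auto)
  then show "integral\<^sup>L lebesgue f = integral\<^sup>L lborel g"
    using assms(2) by (simp add: integral_completion)
  have "integrable lebesgue f \<longleftrightarrow> integrable lebesgue g"
    by (rule integrable_cong_AE) (use assms g ae in auto)
  then show "integrable lebesgue f \<longleftrightarrow> integrable lborel g"
    using assms(2) by (simp add: integrable_completion)
qed

section \<open>Gaussians\<close>

lemma lborel_integral_Basis_prod:
  fixes f :: "'a::euclidean_space \<Rightarrow> real \<Rightarrow> complex"
  assumes "\<And>b. b \<in> Basis \<Longrightarrow> integrable lborel (f b)"
  shows "(LINT x|lborel. (\<Prod>b\<in>Basis. f b (x \<bullet> b))) = (\<Prod>b\<in>Basis. integral\<^sup>L lborel (f b))"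
proof -
  interpret product_sigma_finite "\<lambda>_::'a. lborel :: real measure" ..
  have [measurable]: "\<And>b. b \<in> Basis \<Longrightarrow> f b \<in> borel_measurable borel"
    using assms borel_measurable_integrable by force
  have "(LINT x|lborel. (\<Prod>b\<in>Basis. f b (x \<bullet> b))) =
      (LINT g|(\<Pi>\<^sub>M b\<in>(Basis::'a set). lborel). (\<Prod>b\<in>Basis. f b ((\<Sum>i\<in>Basis. g i *\<^sub>R i) \<bullet> b)))"
    by (subst lborel_eq, subst integral_distr) auto
  also have "\<dots> = (LINT g|(\<Pi>\<^sub>M b\<in>(Basis::'a set). lborel). (\<Prod>b\<in>Basis. f b (g b)))"
    by (intro Bochner_Integration.integral_cong refl prod.cong) (simp add: inner_sum_left_Basis)
  also have "\<dots> = (\<Prod>b\<in>Basis. integral\<^sup>L lborel (f b))"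
    by (rule product_integral_prod) (use assms in auto)
  finally show ?thesis .
qed

text \<open>The centred Gaussian density with independent coordinates of variance \<open>s\<close>.\<close>

definition gauss :: "real \<Rightarrow> 'a::euclidean_space \<Rightarrow> real" where
  "gauss s z = (\<Prod>b\<in>Basis. normal_density 0 (sqrt s) (z \<bullet> b))"

lemma gauss_nonneg [simp]: "0 \<le> gauss s z"
  unfolding gauss_def by (intro prod_nonneg) auto

lemma gauss_measurable [measurable]: "gauss s \<in> borel_measurable borel"
  unfolding gauss_def by measurable

lemma nn_integral_gauss:
  assumes "0 < s"
  shows "(\<integral>\<^sup>+z. ennreal (gauss s z) \<partial>(lborel :: 'a::euclidean_space measure)) = 1"
proof -
  have "(\<integral>\<^sup>+z. ennreal (gauss s z) \<partial>(lborel :: 'a measure)) =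
      (\<integral>\<^sup>+z. (\<Prod>b\<in>Basis. ennreal (normal_density 0 (sqrt s) (z \<bullet> b))) \<partial>(lborel :: 'a measure))"
    unfolding gauss_def by (simp add: prod_ennreal)
  also have "\<dots> = (\<Prod>b\<in>(Basis::'a set). \<integral>\<^sup>+u. ennreal (normal_density 0 (sqrt s) u) \<partial>lborel)"
    by (rule nn_integral_lborel_prod) auto
  also have "(\<integral>\<^sup>+u. ennreal (normal_density 0 (sqrt s) u) \<partial>lborel) = 1"
    using assms by (subst nn_integral_eq_integral) (auto simp: integrable_normal_density integral_normal_density)
  finally show ?thesis by simp
qed

lemma integrable_gauss: "0 < s \<Longrightarrow> integrable lborel (gauss s :: 'a::euclidean_space \<Rightarrow> real)"
  by (rule integrableI_nonneg) (auto simp: nn_integral_gauss)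

lemma integral_normal_density_cis:
  assumes "0 < s"
  shows "(LINT u|lborel. cis (t * u) * complex_of_real (normal_density 0 (sqrt s) u)) = of_real (exp (- s * t\<^sup>2 / 2))"
proof -
  have "(LINT u|lborel. cis (t * u) * complex_of_real (normal_density 0 (sqrt s) u)) =
     \<bar>sqrt s\<bar> *\<^sub>R (LINT u|lborel. cis (t * (0 + sqrt s * u)) * complex_of_real (normal_density 0 (sqrt s) (0 + sqrt s * u)))"
    by (rule lborel_integral_real_affine) (use assms in auto)
  also have "\<dots> = (LINT u|lborel. std_normal_density u *\<^sub>R cis (t * sqrt s * u))"
    unfolding integral_scaleR_right[symmetric]
    by (intro Bochner_Integration.integral_cong refl)
       (use assms in \<open>auto simp: normal_density_def scaleR_conv_of_real power_mult_distrib real_sqrt_mult field_simps\<close>)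
  also have "\<dots> = char std_normal_distribution (t * sqrt s)"
    unfolding char_def
    by (subst integral_density) (auto simp: cis_conv_exp)
  finally show ?thesis
    using assms by (simp add: char_std_normal_distribution power_mult_distrib mult.commute)
qed

lemma inner_prod_cis: "cis (x \<bullet> y) = (\<Prod>b\<in>Basis. cis ((y \<bullet> b) * (x \<bullet> b)))"
  for x y :: "'a::euclidean_space"
proof -
  have *: "(\<Prod>b\<in>I. cis (f b)) = cis (\<Sum>b\<in>I. f b)" if "finite I" for I and f :: "'a \<Rightarrow> real"
    using that by induction (auto simp: cis_mult)
  show ?thesis by (subst *) (auto simp: euclidean_inner[of x y] mult.commute)
qed

lemma sum_Basis_quadratic:
  "(\<Sum>b\<in>Basis. - s * (z \<bullet> b)\<^sup>2 / 2) = - s * (norm z)\<^sup>2 / 2" for z :: "'a::euclidean_space"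
proof -
  have "(norm z)\<^sup>2 = (\<Sum>b\<in>Basis. (z \<bullet> b)\<^sup>2)"
    unfolding power2_norm_eq_inner by (subst euclidean_inner) (simp add: power2_eq_square)
  then show ?thesis by (simp add: sum_distrib_left sum_divide_distrib sum_negf)
qed

lemma integral_gauss_cis:
  fixes \<xi> :: "'a::euclidean_space"
  assumes "0 < s"
  shows "(LINT z|lborel. cis (z \<bullet> \<xi>) * complex_of_real (gauss s z)) = of_real (exp (- s * (norm \<xi>)\<^sup>2 / 2))"
proof -
  have "(LINT z|lborel. cis (z \<bullet> \<xi>) * complex_of_real (gauss s z)) =
    (LINT z|lborel. (\<Prod>b\<in>Basis. cis ((\<xi> \<bullet> b) * (z \<bullet> b)) * complex_of_real (normal_density 0 (sqrt s) (z \<bullet> b))))"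
    by (simp add: inner_prod_cis gauss_def prod.distrib)
  also have "\<dots> = (\<Prod>b\<in>Basis. LINT u|lborel. cis ((\<xi> \<bullet> b) * u) * complex_of_real (normal_density 0 (sqrt s) u))"
  proof (rule lborel_integral_Basis_prod)
    fix b :: 'a
    have "integrable lborel (\<lambda>u. complex_of_real (normal_density 0 (sqrt s) u))"
      using assms by (simp add: integrable_normal_density)
    then show "integrable lborel (\<lambda>u. cis ((\<xi> \<bullet> b) * u) * complex_of_real (normal_density 0 (sqrt s) u))"
      by (rule Bochner_Integration.integrable_bound) (auto simp: norm_mult cis_conv_exp)
  qed
  also have "\<dots> = of_real (exp (\<Sum>b\<in>Basis. - s * (\<xi> \<bullet> b)\<^sup>2 / 2))"
    by (simp add: integral_normal_density_cis[OF assms] exp_sum flip: of_real_prod)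
  also have "(\<Sum>b\<in>Basis. - s * (\<xi> \<bullet> b)\<^sup>2 / 2) = - s * (norm \<xi>)\<^sup>2 / 2"
    by (rule sum_Basis_quadratic)
  finally show ?thesis .
qed

lemma exp_eq_gauss:
  fixes z :: "'a::euclidean_space"
  assumes "0 < s"
  shows "gauss (1/s) z = (s / (2 * pi)) powr (real DIM('a) / 2) * exp (- s * (norm z)\<^sup>2 / 2)"
proof -
  have "gauss (1/s) z = (\<Prod>b\<in>Basis. sqrt (s / (2 * pi)) * exp (- s * (z \<bullet> b)\<^sup>2 / 2))"
    unfolding gauss_def
  proof (rule prod.cong[OF refl])
    fix b :: 'a
    show "normal_density 0 (sqrt (1/s)) (z \<bullet> b) = sqrt (s / (2 * pi)) * exp (- s * (z \<bullet> b)\<^sup>2 / 2)"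
      using assms by (simp add: normal_density_def real_sqrt_divide field_simps)
  qed
  also have "\<dots> = sqrt (s / (2 * pi)) ^ DIM('a) * exp (\<Sum>b\<in>Basis. - s * (z \<bullet> b)\<^sup>2 / 2)"
    by (simp add: prod.distrib exp_sum)
  also have "(\<Sum>b\<in>Basis. - s * (z \<bullet> b)\<^sup>2 / 2) = - s * (norm z)\<^sup>2 / 2"
    by (rule sum_Basis_quadratic)
  also have "sqrt (s / (2 * pi)) ^ DIM('a) = (s / (2 * pi)) powr (real DIM('a) / 2)"
    using assms by (simp add: powr_half_sqrt[symmetric] powr_realpow[symmetric] powr_powr)
  finally show ?thesis .
qed

text \<open>The weight \<open>exp (- s \<bar>\<xi>\<bar>\<^sup>2 / 2)\<close> is a multiple of the density of variance \<open>1 / s\<close>, whose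
  transform has variance \<open>s\<close>.\<close>

lemma integral_exp_cis:
  fixes z :: "'a::euclidean_space"
  assumes "0 < s"
  shows "(LINT \<xi>|lborel. cis (\<xi> \<bullet> z) * complex_of_real (exp (- s * (norm \<xi>)\<^sup>2 / 2)))
     = of_real ((2 * pi) powr (real DIM('a)) * gauss s z)"
proof -
  let ?k = "(s / (2 * pi)) powr (real DIM('a) / 2)"
  have k: "?k > 0" using assms by simp
  have "(LINT \<xi>|lborel. cis (\<xi> \<bullet> z) * complex_of_real (gauss (1/s) \<xi>)) = of_real (exp (- (1/s) * (norm z)\<^sup>2 / 2))"
    by (rule integral_gauss_cis) (use assms in simp)
  moreover have "(LINT \<xi>|lborel. cis (\<xi> \<bullet> z) * complex_of_real (gauss (1/s) \<xi>)) =
     of_real ?k * (LINT \<xi>|lborel. cis (\<xi> \<bullet> z) * complex_of_real (exp (- s * (norm \<xi>)\<^sup>2 / 2)))"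
    unfolding integral_mult_right_zero[symmetric]
    by (intro Bochner_Integration.integral_cong refl) (simp add: exp_eq_gauss[OF assms])
  ultimately have "(LINT \<xi>|lborel. cis (\<xi> \<bullet> z) * complex_of_real (exp (- s * (norm \<xi>)\<^sup>2 / 2))) =
     of_real (exp (- (1/s) * (norm z)\<^sup>2 / 2) / ?k)"
    using k by (simp add: field_simps)
  also have "exp (- (1/s) * (norm z)\<^sup>2 / 2) / ?k = (2 * pi) powr (real DIM('a)) * gauss s z"
  proof -
    have g: "gauss s z = (1 / s / (2 * pi)) powr (real DIM('a) / 2) * exp (- (1/s) * (norm z)\<^sup>2 / 2)"
      using exp_eq_gauss[of "1/s" z] assms by simp
    have "(2 * pi) powr (real DIM('a)) * (1 / s / (2 * pi)) powr (real DIM('a) / 2) * ?k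
       = (2*pi) powr (real DIM('a)) * ((1 / s / (2 * pi)) * (s / (2 * pi))) powr (real DIM('a) / 2)"
      using assms by (simp add: powr_mult[symmetric])
    also have "(1 / s / (2 * pi)) * (s / (2 * pi)) = (2*pi) powr (-2)"
      using assms by (simp add: powr_minus powr_numeral power2_eq_square field_simps)
    also have "(2*pi) powr (real DIM('a)) * ((2*pi) powr (-2)) powr (real DIM('a) / 2) = 1"
      by (simp add: powr_powr powr_add[symmetric])
    finally show ?thesis unfolding g using k by (simp add: field_simps)
  qed
  finally show ?thesis .
qed

lemma integrable_exp_norm:
  assumes "0 < s"
  shows "integrable lborel (\<lambda>\<xi>::'a::euclidean_space. exp (- s * (norm \<xi>)\<^sup>2 / 2))"
proof -
  let ?k = "(s / (2 * pi)) powr (real DIM('a) / 2)"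
  have k: "?k > 0" using assms by simp
  have "integrable lborel (\<lambda>\<xi>::'a. gauss (1/s) \<xi> / ?k)"
    using assms by (intro integrable_divide integrable_gauss) auto
  then show ?thesis using k by (simp add: exp_eq_gauss[OF assms])
qed

section \<open>Affine substitutions\<close>

lemma lebesgue_isometry:
  fixes t :: "'a::euclidean_space"
  assumes "\<bar>c\<bar> = 1"
  shows "lebesgue = distr lebesgue lebesgue (\<lambda>x. t + c *\<^sub>R x)"
    and "(\<lambda>x. t + c *\<^sub>R x) \<in> lebesgue \<rightarrow>\<^sub>M lebesgue"
proof -
  have c: "c \<noteq> 0" using assms by auto
  have *: "t + c *\<^sub>R x = t + (\<Sum>j\<in>Basis. (c * (x \<bullet> j)) *\<^sub>R j)" for x
    unfolding scaleR_scaleR[symmetric] scaleR_sum_right[symmetric] euclidean_representation ..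
  show "lebesgue = distr lebesgue lebesgue (\<lambda>x. t + c *\<^sub>R x)"
    unfolding *
    by (rule trans[OF lebesgue_affine_euclidean[of "\<lambda>_. c" t]]) (use c assms in \<open>simp_all add: density_1\<close>)
  show "(\<lambda>x. t + c *\<^sub>R x) \<in> lebesgue \<rightarrow>\<^sub>M lebesgue"
    unfolding * using lebesgue_affine_measurable[of "\<lambda>_. c" t] c by simp
qed

lemma integral_lebesgue_isometry:
  fixes f :: "'a::euclidean_space \<Rightarrow> 'b::{banach, second_countable_topology}"
  assumes "\<bar>c\<bar> = 1" "f \<in> borel_measurable lebesgue"
  shows "(LINT x|lebesgue. f (t + c *\<^sub>R x)) = (LINT x|lebesgue. f x)"
    and "integrable lebesgue (\<lambda>x. f (t + c *\<^sub>R x)) \<longleftrightarrow> integrable lebesgue f"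
    and "(\<lambda>x. f (t + c *\<^sub>R x)) \<in> borel_measurable lebesgue"
proof -
  note T = lebesgue_isometry[OF assms(1), of t]
  show "(LINT x|lebesgue. f (t + c *\<^sub>R x)) = (LINT x|lebesgue. f x)"
    by (subst (2) T(1)) (rule integral_distr[OF T(2) assms(2), symmetric])
  show "integrable lebesgue (\<lambda>x. f (t + c *\<^sub>R x)) \<longleftrightarrow> integrable lebesgue f"
    by (subst (2) T(1)) (rule integrable_distr_eq[OF T(2) assms(2), symmetric])
  show "(\<lambda>x. f (t + c *\<^sub>R x)) \<in> borel_measurable lebesgue"
    by (rule measurable_compose[OF T(2) assms(2)])
qed

lemma nn_integral_lborel_affine:
  fixes t :: "'a::euclidean_space"
  assumes "c \<noteq> 0" "f \<in> borel_measurable borel"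
  shows "(\<integral>\<^sup>+x. f x \<partial>lborel) = ennreal (\<bar>c\<bar> ^ DIM('a)) * (\<integral>\<^sup>+x. f (t + c *\<^sub>R x) \<partial>lborel)"
proof -
  have m: "(\<lambda>x. f (t + c *\<^sub>R x)) \<in> borel_measurable lborel"
    using assms(2) by measurable
  show ?thesis
    by (subst (1) lborel_affine[OF assms(1), of t])
       (use assms(2) m in \<open>simp add: nn_integral_density nn_integral_distr nn_integral_cmult\<close>)
qed

lemma nn_integral_lborel_reflect:
  fixes x :: "'a::euclidean_space"
  assumes "f \<in> borel_measurable borel"
  shows "(\<integral>\<^sup>+y. f (x - y) \<partial>lborel) = (\<integral>\<^sup>+y. f y \<partial>lborel)"
  using nn_integral_lborel_affine[of "-1" f x] assms by simp

lemma AE_lebesgue_translate: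
  fixes z :: "'a::euclidean_space"
  assumes "AE x in lborel. P x"
  shows "AE x in lborel. P (x - z)"
proof -
  obtain N where N: "{x \<in> space lborel. \<not> P x} \<subseteq> N" "emeasure lborel N = 0" "N \<in> sets lborel"
    using AE_E[OF assms] .
  have "{x. x - z \<in> N} \<in> null_sets lborel"
    by (rule null_sets_translation, rule null_setsI) (use N in auto)
  then show ?thesis by (rule AE_I') (use N in auto)
qed

section \<open>The Fourier integral of integrable functions\<close>

definition fourier_norm :: "nat \<Rightarrow> real" where
  "fourier_norm d = (2 * pi) powr (- real d / 2)"

lemma fourier_norm_pos [simp]: "0 < fourier_norm d"
  and fourier_norm_sq: "(fourier_norm d)\<^sup>2 = (2 * pi) powr (- real d)"
proof -
  show "0 < fourier_norm d" by (simp add: fourier_norm_def)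
  have "(fourier_norm d)\<^sup>2 = fourier_norm d powr 2"
    by (simp add: fourier_norm_def powr_numeral)
  then show "(fourier_norm d)\<^sup>2 = (2 * pi) powr (- real d)"
    by (simp add: fourier_norm_def powr_powr)
qed

lemma fourier_integral_cis:
  "fourier_integral f \<xi> = of_real (fourier_norm DIM('a)) * (LINT x|lebesgue. f x * cis (x \<bullet> \<xi>))"
  for f :: "'a::euclidean_space \<Rightarrow> complex"
  by (simp add: fourier_integral_def fourier_norm_def cis_conv_exp)

lemma inv_fourier_integral_reflect: "inv_fourier_integral f \<xi> = fourier_integral f (- \<xi>)"
  by (simp add: fourier_integral_def inv_fourier_integral_def inner_commute)

lemma cis_inner_measurable [measurable]:
  fixes f g :: "'b \<Rightarrow> 'a::euclidean_space"
  assumes [measurable]: "f \<in> borel_measurable M" "g \<in> borel_measurable M"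
  shows "(\<lambda>x. cis (f x \<bullet> g x)) \<in> borel_measurable M"
proof -
  have "cis \<in> borel_measurable borel"
    by (intro borel_measurable_continuous_onI continuous_intros)
  then show ?thesis by (rule measurable_compose[rotated]) measurable
qed

lemma id_lebesgue_measurable: "(\<lambda>x. x) \<in> borel_measurable lebesgue"
  by (rule measurable_completion) simp

lemma integrable_mult_cis:
  fixes f :: "'a::euclidean_space \<Rightarrow> complex"
  assumes "integrable lebesgue f"
  shows "integrable lebesgue (\<lambda>x. f x * cis (x \<bullet> \<xi>))"
proof (rule Bochner_Integration.integrable_bound[OF assms])
  note id_lebesgue_measurable [measurable]
  have [measurable]: "f \<in> borel_measurable lebesgue" using assms by auto
  show "(\<lambda>x. f x * cis (x \<bullet> \<xi>)) \<in> borel_measurable lebesgue" by measurable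
qed (auto simp: norm_mult)

lemma fourier_integral_bounded:
  fixes f :: "'a::euclidean_space \<Rightarrow> complex"
  assumes "integrable lebesgue f"
  shows "cmod (fourier_integral f \<xi>) \<le> fourier_norm DIM('a) * (LINT x|lebesgue. cmod (f x))"
proof -
  have "cmod (LINT x|lebesgue. f x * cis (x \<bullet> \<xi>)) \<le> (LINT x|lebesgue. cmod (f x * cis (x \<bullet> \<xi>)))"
    by (rule integral_norm_bound)
  then show ?thesis
    by (simp add: fourier_integral_cis norm_mult less_imp_le mult_left_mono)
qed

lemma fourier_integral_diff:
  assumes "integrable lebesgue f" "integrable lebesgue g"
  shows "fourier_integral (\<lambda>x. f x - g x) \<xi> = fourier_integral f \<xi> - fourier_integral g \<xi>"
  using assms by (simp add: fourier_integral_cis left_diff_distrib right_diff_distrib integrable_mult_cis)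

lemma fourier_integral_continuous:
  fixes f :: "'a::euclidean_space \<Rightarrow> complex"
  assumes "integrable lebesgue f"
  shows "continuous_on UNIV (fourier_integral f)"
  unfolding continuous_on_eq_continuous_at[OF open_UNIV]
proof
  fix \<xi>
  note id_lebesgue_measurable [measurable]
  have [measurable]: "f \<in> borel_measurable lebesgue" using assms by auto
  have "(\<lambda>n. fourier_integral f (X n)) \<longlonglongrightarrow> fourier_integral f \<xi>" if "X \<longlonglongrightarrow> \<xi>" for X
    unfolding fourier_integral_cis
  proof (intro tendsto_mult tendsto_const integral_dominated_convergence)
    show "integrable lebesgue (\<lambda>x. norm (f x))" using assms by simp
    show "AE x in lebesgue. (\<lambda>i. f x * cis (x \<bullet> X i)) \<longlonglongrightarrow> f x * cis (x \<bullet> \<xi>)"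
      unfolding cis_conv_exp using that by (intro AE_I2 tendsto_intros)
  qed (auto simp: norm_mult)
  then show "isCont (fourier_integral f) \<xi>"
    by (simp add: continuous_at_sequentially o_def)
qed

lemma fourier_integral_measurable:
  "integrable lebesgue f \<Longrightarrow> fourier_integral f \<in> borel_measurable borel"
  by (intro borel_measurable_continuous_onI fourier_integral_continuous)

lemma fourier_integral_cong_AE:
  assumes "AE x in lebesgue. f x = g x" "f \<in> borel_measurable lebesgue" "g \<in> borel_measurable lebesgue"
  shows "fourier_integral f = fourier_integral g"
proof
  fix \<xi>
  note id_lebesgue_measurable [measurable]
  have [measurable]: "f \<in> borel_measurable lebesgue" "g \<in> borel_measurable lebesgue" by fact+
  show "fourier_integral f \<xi> = fourier_integral g \<xi>"
    unfolding fourier_integral_cis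
    by (intro arg_cong2[where f="(*)"] refl integral_cong_AE) (use assms(1) in auto)
qed

text \<open>All interchanges of complex integrals below are instances of this lemma, with the kernel a
  character. The product of the two functions, times the bound of the kernel, is integrable.\<close>

lemma Fubini_bounded_kernel:
  fixes f :: "'a::euclidean_space \<Rightarrow> complex" and g :: "'b::euclidean_space \<Rightarrow> complex"
  assumes "integrable lebesgue f" "integrable lebesgue g"
    and k: "(\<lambda>(x, y). k x y) \<in> borel_measurable (borel \<Otimes>\<^sub>M borel)" "\<And>x y. cmod (k x y) \<le> B"
  shows "(LINT x|lebesgue. f x * (LINT y|lebesgue. g y * k x y)) =
         (LINT y|lebesgue. g y * (LINT x|lebesgue. f x * k x y))"
proof -
  have fm: "f \<in> borel_measurable lebesgue" and gm: "g \<in> borel_measurable lebesgue"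
    using assms by auto
  obtain f' where f': "f' \<in> borel_measurable borel" "AE x in lborel. f x = f' x"
    using ex_borel_representative[OF fm] by metis
  obtain g' where g': "g' \<in> borel_measurable borel" "AE x in lborel. g x = g' x"
    using ex_borel_representative[OF gm] by metis
  have [measurable]: "f' \<in> borel_measurable borel" "g' \<in> borel_measurable borel"
    "(\<lambda>(x, y). k x y) \<in> borel_measurable (borel \<Otimes>\<^sub>M borel)" using f' g' k by auto
  have kx [measurable]: "k x \<in> borel_measurable borel" for x
    using k(1) by (auto dest: measurable_Pair2)
  have ky [measurable]: "(\<lambda>x. k x y) \<in> borel_measurable borel" for y
    using measurable_Pair1[OF k(1), of y] by auto
  have kx': "k x \<in> borel_measurable lebesgue" for x
    using kx by (simp add: measurable_completion)
  have ky': "(\<lambda>x. k x y) \<in> borel_measurable lebesgue" for y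
    using ky by (simp add: measurable_completion)
  have if': "integrable lborel f'" using integral_lebesgue_borel_representative(2)[OF fm f'] assms by simp
  have ig': "integrable lborel g'" using integral_lebesgue_borel_representative(2)[OF gm g'] assms by simp
  have G: "(LINT y|lebesgue. g y * k x y) = (LINT y|lborel. g' y * k x y)" for x
    by (rule integral_lebesgue_borel_representative(1)) (use gm kx' g' in auto)
  have F: "(LINT x|lebesgue. f x * k x y) = (LINT x|lborel. f' x * k x y)" for y
    by (rule integral_lebesgue_borel_representative(1)) (use fm ky' f' in auto)
  have Gm: "(\<lambda>x. LINT y|lborel. g' y * k x y) \<in> borel_measurable borel"
    by measurable
  have Fm: "(\<lambda>y. LINT x|lborel. f' x * k x y) \<in> borel_measurable borel"
    by measurable
  have Gm': "(\<lambda>x. LINT y|lborel. g' y * k x y) \<in> borel_measurable lebesgue"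
    using Gm by (simp add: measurable_completion)
  have Fm': "(\<lambda>x. LINT y|lborel. f' y * k y x) \<in> borel_measurable lebesgue"
    using Fm by (simp add: measurable_completion)
  have int: "integrable (lborel \<Otimes>\<^sub>M lborel) (\<lambda>(x, y). f' x * g' y * k x y)"
  proof (rule Bochner_Integration.integrable_bound)
    show "integrable (lborel \<Otimes>\<^sub>M lborel) (\<lambda>(x, y). f' x * g' y * of_real B)"
    proof (rule lborel_pair.Fubini_integrable)
      show "integrable lborel (\<lambda>x. LINT y|lborel. norm (case (x, y) of (x, y) \<Rightarrow> f' x * g' y * of_real B))"
        using if' ig' by (simp add: norm_mult mult.assoc)
    qed (use ig' in auto)
    show "AE p in lborel \<Otimes>\<^sub>M lborel. norm (case p of (x, y) \<Rightarrow> f' x * g' y * k x y)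
        \<le> norm (case p of (x, y) \<Rightarrow> f' x * g' y * complex_of_real B)"
    proof (intro AE_I2, clarsimp simp: norm_mult)
      fix x y
      have "cmod (k x y) \<le> \<bar>B\<bar>" using k(2)[of x y] by linarith
      then show "cmod (f' x) * cmod (g' y) * cmod (k x y) \<le> cmod (f' x) * cmod (g' y) * \<bar>B\<bar>"
        by (intro mult_left_mono) auto
    qed
  qed measurable
  have "(LINT x|lebesgue. f x * (LINT y|lebesgue. g y * k x y)) =
     (LINT x|lborel. f' x * (LINT y|lborel. g' y * k x y))"
    unfolding G by (rule integral_lebesgue_borel_representative(1)) (use fm Gm Gm' f' in auto)
  also have "\<dots> = (LINT x|lborel. LINT y|lborel. f' x * g' y * k x y)"
    by (simp add: mult.assoc)
  also have "\<dots> = (LINT y|lborel. LINT x|lborel. f' x * g' y * k x y)"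
    by (rule lborel_pair.Fubini_integral[OF int, symmetric])
  also have "\<dots> = (LINT y|lborel. g' y * (LINT x|lborel. f' x * k x y))"
    unfolding integral_mult_right_zero[symmetric] by (simp add: mult_ac)
  also have "\<dots> = (LINT y|lebesgue. g y * (LINT x|lebesgue. f x * k x y))"
    unfolding F by (rule integral_lebesgue_borel_representative(1)[symmetric]) (use gm Fm Fm' g' in auto)
  finally show ?thesis .
qed

lemma fourier_integral_duality:
  fixes f g :: "'a::euclidean_space \<Rightarrow> complex"
  assumes "integrable lebesgue f" "integrable lebesgue g"
  shows "(LINT x|lebesgue. f x * fourier_integral g x) = (LINT \<xi>|lebesgue. g \<xi> * fourier_integral f \<xi>)"
proof -
  have "(LINT x|lebesgue. f x * (LINT y|lebesgue. g y * cis (y \<bullet> x))) =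
        (LINT y|lebesgue. g y * (LINT x|lebesgue. f x * cis (y \<bullet> x)))"
    by (rule Fubini_bounded_kernel[OF assms, where B=1]) auto
  then have "of_real (fourier_norm DIM('a)) * (LINT x|lebesgue. f x * (LINT y|lebesgue. g y * cis (y \<bullet> x))) =
        of_real (fourier_norm DIM('a)) * (LINT y|lebesgue. g y * (LINT x|lebesgue. f x * cis (x \<bullet> y)))"
    by (simp add: inner_commute)
  then show ?thesis
    unfolding fourier_integral_cis integral_mult_right_zero[symmetric] by (simp add: mult_ac)
qed

section \<open>Plancherel's theorem\<close>

lemma L2_from_nn_integral:
  assumes [measurable]: "f \<in> borel_measurable lebesgue"
    and "(\<integral>\<^sup>+x. ennreal ((cmod (f x))\<^sup>2) \<partial>lebesgue) \<le> ennreal B" "0 \<le> B"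
  shows "f \<in> L2" "nsq f \<le> B"
proof -
  have i: "integrable lebesgue (\<lambda>x. (cmod (f x))\<^sup>2)"
    by (rule integrableI_nonneg) (use assms le_less_trans[OF assms(2) ennreal_less_top] in \<open>auto\<close>)
  then show "f \<in> L2" by (rule L2I[OF assms(1)])
  have "ennreal (nsq f) = (\<integral>\<^sup>+x. ennreal ((cmod (f x))\<^sup>2) \<partial>lebesgue)"
    unfolding nsq_def by (rule nn_integral_eq_integral[symmetric]) (use i in auto)
  then show "nsq f \<le> B" using assms by (metis ennreal_le_iff)
qed

lemma nn_integral_nsq:
  assumes "f \<in> L2"
  shows "(\<integral>\<^sup>+x. ennreal ((cmod (f x))\<^sup>2) \<partial>lebesgue) = ennreal (nsq f)"
  unfolding nsq_def by (rule nn_integral_eq_integral) (use assms in \<open>auto simp: L2_def\<close>)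

lemma norm_integral_le_nn_integral:
  fixes h :: "'a \<Rightarrow> complex"
  shows "ennreal (cmod (integral\<^sup>L M h)) \<le> (\<integral>\<^sup>+x. ennreal (cmod (h x)) \<partial>M)"
proof (cases "integrable M h")
  case True
  then show ?thesis by (rule integral_norm_bound_ennreal)
qed (simp add: not_integrable_integral_eq)

lemma lebesgue_measurable_borel:
  "f \<in> borel_measurable borel \<Longrightarrow> f \<in> borel_measurable lebesgue"
  by (simp add: measurable_completion)

lemma nn_integral_gauss_translate:
  "0 < s \<Longrightarrow> (\<integral>\<^sup>+y. ennreal (gauss s (x - y)) \<partial>lborel) = 1"
  using nn_integral_lborel_reflect[of "\<lambda>y. ennreal (gauss s y)" x] by (simp add: nn_integral_gauss)

lemma gauss_symmetric: "gauss s (x - y) = gauss s (y - x)"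
  unfolding gauss_def by (simp add: normal_density_def inner_diff_left power2_commute)

text \<open>Schur's test for the Gaussian kernel, which has mass one in either variable.\<close>

lemma gauss_form_le:
  fixes f :: "'a::euclidean_space \<Rightarrow> complex"
  assumes [measurable]: "f \<in> borel_measurable borel" and s: "0 < s"
  shows "(\<integral>\<^sup>+x. ennreal (cmod (f x)) * (\<integral>\<^sup>+y. ennreal (cmod (f y) * gauss s (x - y)) \<partial>lborel) \<partial>lborel)
    \<le> (\<integral>\<^sup>+x. ennreal ((cmod (f x))\<^sup>2) \<partial>lborel)"
proof -
  let ?q = "\<lambda>x. ennreal ((cmod (f x))\<^sup>2 / 2)" and ?g = "\<lambda>x y. ennreal (gauss s (x - y))"
  have "(\<integral>\<^sup>+x. ennreal (cmod (f x)) * (\<integral>\<^sup>+y. ennreal (cmod (f y) * gauss s (x - y)) \<partial>lborel) \<partial>lborel)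
     = (\<integral>\<^sup>+x. (\<integral>\<^sup>+y. ennreal (cmod (f x) * cmod (f y)) * ?g x y \<partial>lborel) \<partial>lborel)"
    by (simp add: nn_integral_cmult[symmetric] ennreal_mult mult.assoc)
  also have "\<dots> \<le> (\<integral>\<^sup>+x. (\<integral>\<^sup>+y. (?q x + ?q y) * ?g x y \<partial>lborel) \<partial>lborel)"
  proof (intro nn_integral_mono mult_right_mono)
    fix x y
    have "cmod (f x) * cmod (f y) \<le> (cmod (f x))\<^sup>2 / 2 + (cmod (f y))\<^sup>2 / 2"
      using mult_le_half_squares[of "cmod (f x)" "cmod (f y)"] by (simp add: add_divide_distrib)
    then show "ennreal (cmod (f x) * cmod (f y)) \<le> ?q x + ?q y"
      by (subst ennreal_plus[symmetric]) (auto intro: ennreal_leI simp del: ennreal_plus)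
  qed auto
  also have "\<dots> = (\<integral>\<^sup>+x. (\<integral>\<^sup>+y. ?q x * ?g x y \<partial>lborel) + (\<integral>\<^sup>+y. ?q y * ?g x y \<partial>lborel) \<partial>lborel)"
    by (simp add: distrib_right nn_integral_add)
  also have "\<dots> = (\<integral>\<^sup>+x. (\<integral>\<^sup>+y. ?q x * ?g x y \<partial>lborel) \<partial>lborel) + (\<integral>\<^sup>+x. (\<integral>\<^sup>+y. ?q y * ?g x y \<partial>lborel) \<partial>lborel)"
    by (rule nn_integral_add) measurable
  also have "(\<integral>\<^sup>+x. (\<integral>\<^sup>+y. ?q y * ?g x y \<partial>lborel) \<partial>lborel) = (\<integral>\<^sup>+y. (\<integral>\<^sup>+x. ?q y * ?g x y \<partial>lborel) \<partial>lborel)"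
    by (rule lborel_pair.Fubini'[symmetric]) measurable
  also have "\<dots> = (\<integral>\<^sup>+y. ?q y * (\<integral>\<^sup>+x. ?g y x \<partial>lborel) \<partial>lborel)"
    by (simp add: nn_integral_cmult gauss_symmetric)
  also have "(\<integral>\<^sup>+x. (\<integral>\<^sup>+y. ?q x * ?g x y \<partial>lborel) \<partial>lborel) = (\<integral>\<^sup>+x. ?q x * (\<integral>\<^sup>+y. ?g x y \<partial>lborel) \<partial>lborel)"
    by (simp add: nn_integral_cmult)
  also have "\<dots> + (\<integral>\<^sup>+y. ?q y * (\<integral>\<^sup>+x. ?g y x \<partial>lborel) \<partial>lborel) = (\<integral>\<^sup>+x. ?q x + ?q x \<partial>lborel)"
    by (simp add: nn_integral_gauss_translate[OF s] nn_integral_add)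
  also have "\<dots> = (\<integral>\<^sup>+x. ennreal ((cmod (f x))\<^sup>2) \<partial>lborel)"
    by (intro nn_integral_cong) (simp flip: ennreal_plus)
  finally show ?thesis by simp
qed

lemma integrable_damped:
  fixes h :: "'a::euclidean_space \<Rightarrow> complex"
  assumes "0 < s" "h \<in> borel_measurable borel" "\<And>\<xi>. cmod (h \<xi>) \<le> B"
  shows "integrable lebesgue (\<lambda>\<xi>. complex_of_real (exp (- s * (norm \<xi>)\<^sup>2 / 2)) * h \<xi>)"
proof (rule Bochner_Integration.integrable_bound)
  show "integrable lebesgue (\<lambda>\<xi>::'a. exp (- s * (norm \<xi>)\<^sup>2 / 2) * B)"
    using integrable_exp_norm[OF assms(1)] by (intro integrable_mult_left) (simp add: integrable_completion)
  show "AE x in lebesgue. norm (complex_of_real (exp (- s * (norm x)\<^sup>2 / 2)) * h x) \<le> norm (exp (- s * (norm x)\<^sup>2 / 2) * B)"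
  proof (rule AE_I2)
    fix x
    have "cmod (h x) \<le> \<bar>B\<bar>" using assms(3)[of x] by linarith
    then show "norm (complex_of_real (exp (- s * (norm x)\<^sup>2 / 2)) * h x) \<le> norm (exp (- s * (norm x)\<^sup>2 / 2) * B)"
      by (simp add: norm_mult abs_mult mult_left_mono)
  qed
  show "(\<lambda>\<xi>. complex_of_real (exp (- s * (norm \<xi>)\<^sup>2 / 2)) * h \<xi>) \<in> borel_measurable lebesgue"
    using assms(2) by (intro lebesgue_measurable_borel) measurable
qed

text \<open>This is Fourier inversion with a convergence factor: the right-hand side is the Gaussian
  mollification of the conjugate of \<open>f\<close>.\<close>

lemma fourier_integral_damped:
  fixes f :: "'a::euclidean_space \<Rightarrow> complex"
  assumes f: "integrable lebesgue f" and s: "0 < s"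
  shows "fourier_integral (\<lambda>\<xi>. complex_of_real (exp (- s * (norm \<xi>)\<^sup>2 / 2)) * cnj (fourier_integral f \<xi>)) x
     = (LINT y|lebesgue. cnj (f y) * complex_of_real (gauss s (x - y)))"
proof -
  let ?w = "\<lambda>\<xi>::'a. complex_of_real (exp (- s * (norm \<xi>)\<^sup>2 / 2))"
  let ?c = "complex_of_real (fourier_norm DIM('a))"
  have w: "integrable lebesgue ?w"
    using integrable_damped[OF s, of "\<lambda>_. 1" 1] by simp
  have eq: "?w \<xi> * cnj (fourier_integral f \<xi>) * cis (\<xi> \<bullet> x) =
      ?c * (?w \<xi> * (LINT y|lebesgue. cnj (f y) * cis (\<xi> \<bullet> (x - y))))" for \<xi>
  proof -
    have "cnj (fourier_integral f \<xi>) * cis (\<xi> \<bullet> x) = ?c * ((LINT y|lebesgue. cnj (f y * cis (y \<bullet> \<xi>))) * cis (\<xi> \<bullet> x))"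
      unfolding fourier_integral_cis Bochner_Integration.integral_cnj by simp
    also have "(LINT y|lebesgue. cnj (f y * cis (y \<bullet> \<xi>))) * cis (\<xi> \<bullet> x) = (LINT y|lebesgue. cnj (f y) * cis (\<xi> \<bullet> (x - y)))"
      unfolding integral_mult_left_zero[symmetric]
      by (intro Bochner_Integration.integral_cong refl)
         (simp add: cis_cnj cis_mult mult.assoc inner_diff_right inner_commute)
    finally show ?thesis by (simp add: mult_ac)
  qed
  have "fourier_integral (\<lambda>\<xi>. ?w \<xi> * cnj (fourier_integral f \<xi>)) x =
      ?c * (?c * (LINT \<xi>|lebesgue. ?w \<xi> * (LINT y|lebesgue. cnj (f y) * cis (\<xi> \<bullet> (x - y)))))"
    unfolding fourier_integral_cis[of _ x] eq by simp
  also have "(LINT \<xi>|lebesgue. ?w \<xi> * (LINT y|lebesgue. cnj (f y) * cis (\<xi> \<bullet> (x - y)))) =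
     (LINT y|lebesgue. cnj (f y) * (LINT \<xi>|lebesgue. ?w \<xi> * cis (\<xi> \<bullet> (x - y))))"
    by (rule Fubini_bounded_kernel[where B=1]) (use f w in auto)
  also have "\<dots> = (LINT y|lebesgue. of_real ((2 * pi) powr real DIM('a)) * (cnj (f y) * complex_of_real (gauss s (x - y))))"
  proof (intro Bochner_Integration.integral_cong refl)
    fix y
    have "(LINT \<xi>|lebesgue. ?w \<xi> * cis (\<xi> \<bullet> (x - y))) = (LINT \<xi>|lborel. cis (\<xi> \<bullet> (x - y)) * ?w \<xi>)"
      by (subst integral_completion) (auto simp: mult.commute)
    then show "cnj (f y) * (LINT \<xi>|lebesgue. ?w \<xi> * cis (\<xi> \<bullet> (x - y))) =
       of_real ((2 * pi) powr real DIM('a)) * (cnj (f y) * complex_of_real (gauss s (x - y)))"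
      by (simp only: integral_exp_cis[OF s]) simp
  qed
  also have "?c * (?c * \<dots>) = of_real ((fourier_norm DIM('a))\<^sup>2 * (2 * pi) powr real DIM('a)) *
      (LINT y|lebesgue. cnj (f y) * complex_of_real (gauss s (x - y)))"
    by (simp add: power2_eq_square)
  also have "(fourier_norm DIM('a))\<^sup>2 * (2 * pi) powr real DIM('a) = 1"
    by (simp add: fourier_norm_sq powr_add[symmetric])
  finally show ?thesis by simp
qed

text \<open>Insert the damped inversion formula into the duality relation, with one of the two functions the
  damped conjugate transform.\<close>

lemma damped_Plancherel:
  fixes f :: "'a::euclidean_space \<Rightarrow> complex"
  assumes f: "integrable lebesgue f" and s: "0 < s"
  shows "complex_of_real (LINT \<xi>|lebesgue. exp (- s * (norm \<xi>)\<^sup>2 / 2) * (cmod (fourier_integral f \<xi>))\<^sup>2)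
     = (LINT x|lebesgue. f x * (LINT y|lebesgue. cnj (f y) * complex_of_real (gauss s (x - y))))"
    and "integrable lebesgue (\<lambda>\<xi>. exp (- s * (norm \<xi>)\<^sup>2 / 2) * (cmod (fourier_integral f \<xi>))\<^sup>2)"
proof -
  let ?w = "\<lambda>\<xi>::'a. complex_of_real (exp (- s * (norm \<xi>)\<^sup>2 / 2))"
  let ?g = "\<lambda>\<xi>. ?w \<xi> * cnj (fourier_integral f \<xi>)"
  let ?B = "fourier_norm DIM('a) * (LINT x|lebesgue. cmod (f x))"
  note B = fourier_integral_bounded[OF f]
  have [measurable]: "fourier_integral f \<in> borel_measurable borel"
    by (rule fourier_integral_measurable[OF f])
  have mc: "(\<lambda>\<xi>. cnj (fourier_integral f \<xi>)) \<in> borel_measurable borel"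
    by (intro borel_measurable_continuous_onI continuous_on_cnj fourier_integral_continuous f)
  have g: "integrable lebesgue ?g"
    by (rule integrable_damped[OF s mc]) (use B in simp)
  have eq: "?g \<xi> * fourier_integral f \<xi> = complex_of_real (exp (- s * (norm \<xi>)\<^sup>2 / 2) * (cmod (fourier_integral f \<xi>))\<^sup>2)" for \<xi>
    by (simp add: complex_norm_square mult.commute mult.assoc del: of_real_power)
  have B0: "0 \<le> ?B" using B[of 0] norm_ge_zero order_trans by blast
  have "integrable lebesgue (\<lambda>\<xi>. ?w \<xi> * (complex_of_real ((cmod (fourier_integral f \<xi>))\<^sup>2)))"
    by (rule integrable_damped[OF s, of _ "?B\<^sup>2"]) (use B B0 in \<open>auto simp: norm_power intro!: power_mono\<close>)
  then have "integrable lebesgue (\<lambda>\<xi>. complex_of_real (exp (- s * (norm \<xi>)\<^sup>2 / 2) * (cmod (fourier_integral f \<xi>))\<^sup>2))"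
    by simp
  then show "integrable lebesgue (\<lambda>\<xi>. exp (- s * (norm \<xi>)\<^sup>2 / 2) * (cmod (fourier_integral f \<xi>))\<^sup>2)"
    by (simp only: complex_of_real_integrable_eq)
  have "complex_of_real (LINT \<xi>|lebesgue. exp (- s * (norm \<xi>)\<^sup>2 / 2) * (cmod (fourier_integral f \<xi>))\<^sup>2)
     = (LINT \<xi>|lebesgue. ?g \<xi> * fourier_integral f \<xi>)"
    unfolding eq by (rule integral_complex_of_real[symmetric])
  also have "\<dots> = (LINT x|lebesgue. f x * fourier_integral ?g x)"
    by (rule fourier_integral_duality[OF f g, symmetric])
  finally show "complex_of_real (LINT \<xi>|lebesgue. exp (- s * (norm \<xi>)\<^sup>2 / 2) * (cmod (fourier_integral f \<xi>))\<^sup>2)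
     = (LINT x|lebesgue. f x * (LINT y|lebesgue. cnj (f y) * complex_of_real (gauss s (x - y))))"
    by (simp only: fourier_integral_damped[OF f s])
qed

lemma damped_Plancherel_le:
  fixes f :: "'a::euclidean_space \<Rightarrow> complex"
  assumes f: "integrable lebesgue f" "f \<in> L2" and s: "0 < s"
  shows "(LINT \<xi>|lebesgue. exp (- s * (norm \<xi>)\<^sup>2 / 2) * (cmod (fourier_integral f \<xi>))\<^sup>2) \<le> nsq f"
proof -
  let ?L = "LINT \<xi>|lebesgue. exp (- s * (norm \<xi>)\<^sup>2 / 2) * (cmod (fourier_integral f \<xi>))\<^sup>2"
  have fm: "f \<in> borel_measurable lebesgue" using f by (simp add: L2_measurable)
  obtain h where h [measurable]: "h \<in> borel_measurable borel" and fh: "AE x in lborel. f x = h x"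
    using ex_borel_representative[OF fm] by metis
  have hm: "h \<in> borel_measurable lebesgue" by (rule lebesgue_measurable_borel) fact
  have ae: "AE x in lebesgue. f x = h x" using fh AE_completion by blast
  have FI: "fourier_integral f = fourier_integral h" by (rule fourier_integral_cong_AE[OF ae fm hm])
  have ih: "integrable lebesgue h" using f integrable_cong_AE[OF fm hm ae] by simp
  have L0: "0 \<le> ?L" by simp
  have "ennreal ?L = ennreal (cmod (complex_of_real ?L))" using L0 by (simp del: of_real_mult)
  also have "\<dots> = ennreal (cmod (LINT x|lebesgue. h x * (LINT y|lebesgue. cnj (h y) * complex_of_real (gauss s (x - y)))))"
    unfolding FI damped_Plancherel(1)[OF ih s] ..
  also have "\<dots> \<le> (\<integral>\<^sup>+x. ennreal (cmod (h x * (LINT y|lebesgue. cnj (h y) * complex_of_real (gauss s (x - y))))) \<partial>lebesgue)"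
    by (rule norm_integral_le_nn_integral)
  also have "\<dots> = (\<integral>\<^sup>+x. ennreal (cmod (h x)) * ennreal (cmod (LINT y|lebesgue. cnj (h y) * complex_of_real (gauss s (x - y)))) \<partial>lebesgue)"
    by (simp add: norm_mult ennreal_mult)
  also have "\<dots> \<le> (\<integral>\<^sup>+x. ennreal (cmod (h x)) * (\<integral>\<^sup>+y. ennreal (cmod (cnj (h y) * complex_of_real (gauss s (x - y)))) \<partial>lebesgue) \<partial>lebesgue)"
    by (intro nn_integral_mono mult_left_mono norm_integral_le_nn_integral) auto
  also have "\<dots> = (\<integral>\<^sup>+x. ennreal (cmod (h x)) * (\<integral>\<^sup>+y. ennreal (cmod (h y) * gauss s (x - y)) \<partial>lborel) \<partial>lborel)"
    by (simp add: nn_integral_completion norm_mult)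
  also have "\<dots> \<le> (\<integral>\<^sup>+x. ennreal ((cmod (h x))\<^sup>2) \<partial>lborel)"
    by (rule gauss_form_le[OF h s])
  also have "\<dots> = (\<integral>\<^sup>+x. ennreal ((cmod (f x))\<^sup>2) \<partial>lborel)"
    by (rule nn_integral_cong_AE) (use fh in auto)
  also have "\<dots> = ennreal (nsq f)"
    using nn_integral_nsq[OF f(2)] by (simp add: nn_integral_completion)
  finally show ?thesis by simp
qed

text \<open>The bounds for the damped norms are uniform, so Fatou's lemma removes the damping.\<close>

theorem Plancherel_le:
  fixes f :: "'a::euclidean_space \<Rightarrow> complex"
  assumes f: "integrable lebesgue f" "f \<in> L2"
  shows "fourier_integral f \<in> L2" "nsq (fourier_integral f) \<le> nsq f"
proof -
  let ?h = "fourier_integral f"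
  let ?u = "\<lambda>n \<xi>. ennreal (exp (- (1 / real (Suc n)) * (norm \<xi>)\<^sup>2 / 2) * (cmod (?h \<xi>))\<^sup>2)"
  have hb [measurable]: "?h \<in> borel_measurable borel" by (rule fourier_integral_measurable[OF f(1)])
  have hm: "?h \<in> borel_measurable lebesgue" by (rule lebesgue_measurable_borel[OF hb])
  have um: "?u n \<in> borel_measurable lebesgue" for n
    by (rule lebesgue_measurable_borel) measurable
  have lim: "(\<lambda>n. ?u n \<xi>) \<longlonglongrightarrow> ennreal ((cmod (?h \<xi>))\<^sup>2)" for \<xi>
  proof (rule tendsto_ennrealI)
    have "(\<lambda>n. exp (- (1 / real (Suc n)) * (norm \<xi>)\<^sup>2 / 2) * (cmod (?h \<xi>))\<^sup>2) \<longlonglongrightarrow> exp (- 0 * (norm \<xi>)\<^sup>2 / 2) * (cmod (?h \<xi>))\<^sup>2"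
      by (intro tendsto_intros LIMSEQ_Suc[OF lim_1_over_n]) auto
    then show "(\<lambda>n. exp (- (1 / real (Suc n)) * (norm \<xi>)\<^sup>2 / 2) * (cmod (?h \<xi>))\<^sup>2) \<longlonglongrightarrow> (cmod (?h \<xi>))\<^sup>2"
      by simp
  qed
  have u: "(\<integral>\<^sup>+\<xi>. ?u n \<xi> \<partial>lebesgue) \<le> ennreal (nsq f)" for n
  proof -
    have s: "0 < 1 / real (Suc n)" by simp
    show ?thesis
      using damped_Plancherel_le[OF f s] damped_Plancherel(2)[OF f(1) s]
      by (subst nn_integral_eq_integral) (auto intro: ennreal_leI)
  qed
  have "(\<integral>\<^sup>+\<xi>. ennreal ((cmod (?h \<xi>))\<^sup>2) \<partial>lebesgue) = (\<integral>\<^sup>+\<xi>. liminf (\<lambda>n. ?u n \<xi>) \<partial>lebesgue)"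
    using lim_imp_Liminf[OF _ lim] by simp
  also have "\<dots> \<le> liminf (\<lambda>n. \<integral>\<^sup>+\<xi>. ?u n \<xi> \<partial>lebesgue)"
    by (rule nn_integral_liminf[OF um])
  also have "\<dots> \<le> limsup (\<lambda>n. \<integral>\<^sup>+\<xi>. ?u n \<xi> \<partial>lebesgue)"
    by (rule Liminf_le_Limsup) simp
  also have "\<dots> \<le> ennreal (nsq f)"
    by (rule Limsup_bounded) (use u in auto)
  finally show "?h \<in> L2" "nsq ?h \<le> nsq f"
    using L2_from_nn_integral[OF hm] by auto
qed

lemma inv_Plancherel_le:
  fixes f :: "'a::euclidean_space \<Rightarrow> complex"
  assumes f: "integrable lebesgue f" "f \<in> L2"
  shows "inv_fourier_integral f \<in> L2" "nsq (inv_fourier_integral f) \<le> nsq f"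
proof -
  note P = Plancherel_le[OF f]
  have eq: "inv_fourier_integral f = (\<lambda>x. fourier_integral f (0 + (-1) *\<^sub>R x))"
    by (simp add: fun_eq_iff inv_fourier_integral_reflect)
  have m: "(\<lambda>x. (cmod (fourier_integral f x))\<^sup>2) \<in> borel_measurable lebesgue"
    using L2_measurable[OF P(1)] by auto
  show "inv_fourier_integral f \<in> L2"
    unfolding eq using integral_lebesgue_isometry(2)[OF _ m, of "-1" 0] L2_integrable_sq[OF P(1)]
      integral_lebesgue_isometry(3)[OF _ L2_measurable[OF P(1)], of "-1" 0]
    by (intro L2I) auto
  show "nsq (inv_fourier_integral f) \<le> nsq f"
    unfolding eq using integral_lebesgue_isometry(1)[OF _ m, of "-1" 0] P(2) by (simp add: nsq_def)
qed

lemma nsq_inv_fourier_integral: "integrable lebesgue f \<Longrightarrow> nsq (inv_fourier_integral f) = nsq (fourier_integral f)"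
proof -
  assume f: "integrable lebesgue f"
  have m: "(\<lambda>x. (cmod (fourier_integral f x))\<^sup>2) \<in> borel_measurable lebesgue"
    using lebesgue_measurable_borel[OF fourier_integral_measurable[OF f]] by auto
  show ?thesis using integral_lebesgue_isometry(1)[OF _ m, of "-1" 0]
    by (simp add: nsq_def inv_fourier_integral_reflect)
qed

section \<open>Overlaps of translates\<close>

definition overlap :: "'a::euclidean_space set \<Rightarrow> 'a \<Rightarrow> 'a set" where
  "overlap U z = {x \<in> U. x - z \<in> U}"

lemma overlap_sets_lebesgue:
  assumes "U \<in> sets lebesgue"
  shows "overlap U z \<in> sets lebesgue"
proof -
  have "(\<lambda>x. - z + 1 *\<^sub>R x) -` U \<inter> space lebesgue \<in> sets lebesgue"
    by (rule measurable_sets[OF lebesgue_isometry(2) assms]) simp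
  also have "(\<lambda>x. - z + 1 *\<^sub>R x) -` U \<inter> space lebesgue = {x. x - z \<in> U}" by auto
  finally have "U \<inter> {x. x - z \<in> U} \<in> sets lebesgue" using assms by blast
  then show ?thesis by (simp add: overlap_def Int_def)
qed

lemma overlap_sets_borel [measurable]:
  assumes [measurable]: "U \<in> sets borel"
  shows "overlap U z \<in> sets borel"
  unfolding overlap_def by measurable

lemma overlap_lmeasurable: "U \<in> lmeasurable \<Longrightarrow> overlap U z \<in> lmeasurable"
  by (rule fmeasurableI2[of U]) (simp_all add: overlap_sets_lebesgue fmeasurableD, auto simp: overlap_def)

lemma ex_borel_set_representative:
  assumes "U \<in> sets lebesgue"
  obtains U' where "U' \<in> sets borel" "AE x in lborel. x \<in> U \<longleftrightarrow> x \<in> U'"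
proof -
  obtain S N N' where "U = S \<union> N" "N \<subseteq> N'" "N' \<in> null_sets lborel" "S \<in> sets lborel"
    using sets_completionE[OF assms] by metis
  moreover from this have "AE x in lborel. x \<in> U \<longleftrightarrow> x \<in> S"
    by (intro AE_I'[of N']) auto
  ultimately show thesis using that by auto
qed

lemma emeasure_overlap_representative:
  assumes "U \<in> sets lebesgue" "U' \<in> sets borel" "AE x in lborel. x \<in> U \<longleftrightarrow> x \<in> U'"
  shows "emeasure lebesgue (overlap U z) = emeasure lborel (overlap U' z)"
proof -
  have "AE x in lborel. x \<in> overlap U z \<longleftrightarrow> x \<in> overlap U' z"
    using assms(3) AE_lebesgue_translate[OF assms(3), of z] by eventually_elim (auto simp: overlap_def)
  then have "AE x in lebesgue. x \<in> overlap U z \<longleftrightarrow> x \<in> overlap U' z" by (rule AE_completion)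
  then have "emeasure lebesgue (overlap U z) = emeasure lebesgue (overlap U' z)"
    using assms by (intro emeasure_eq_AE overlap_sets_lebesgue) auto
  then show ?thesis using assms by simp
qed

lemma emeasure_overlap_eq_nn_integral:
  assumes [measurable]: "U \<in> sets borel"
  shows "emeasure lborel (overlap U z) = (\<integral>\<^sup>+x. indicator U x * indicator U (x - z) \<partial>lborel)"
proof -
  have "(\<integral>\<^sup>+x. indicator U x * indicator U (x - z) \<partial>lborel) = (\<integral>\<^sup>+x. indicator (overlap U z) x \<partial>lborel)"
    by (intro nn_integral_cong) (auto simp: overlap_def indicator_def)
  also have "\<dots> = emeasure lborel (overlap U z)"
    by (rule nn_integral_indicator) simp
  finally show ?thesis ..
qed

lemma emeasure_overlap_measurable [measurable]:
  assumes [measurable]: "U \<in> sets borel"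
  shows "(\<lambda>z. emeasure lborel (overlap U z)) \<in> borel_measurable borel"
  unfolding emeasure_overlap_eq_nn_integral[OF assms] by measurable

text \<open>Substitute \<open>y = x - z\<close> in the inner integral and interchange. This is applied to a Gaussian
  density, for Plancherel's identity, and to \<open>\<bar>\<kappa>\<bar>\<^sup>2\<close>, for the Hilbert--Schmidt norm.\<close>

lemma nn_integral_overlap_borel:
  fixes U :: "'a::euclidean_space set"
  assumes [measurable]: "U \<in> sets borel" "g \<in> borel_measurable borel"
  shows "(\<integral>\<^sup>+x. indicator U x * (\<integral>\<^sup>+y. indicator U y * g (x - y) \<partial>lborel) \<partial>lborel)
     = (\<integral>\<^sup>+z. g z * emeasure lborel (overlap U z) \<partial>lborel)"
proof -
  have "(\<integral>\<^sup>+y. indicator U y * g (x - y) \<partial>lborel) = (\<integral>\<^sup>+z. indicator U (x - z) * g z \<partial>lborel)" for x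
    using nn_integral_lborel_reflect[of "\<lambda>z. indicator U (x - z) * g z" x] by simp
  then have "(\<integral>\<^sup>+x. indicator U x * (\<integral>\<^sup>+y. indicator U y * g (x - y) \<partial>lborel) \<partial>lborel)
     = (\<integral>\<^sup>+x. (\<integral>\<^sup>+z. g z * (indicator U x * indicator U (x - z)) \<partial>lborel) \<partial>lborel)"
    by (simp add: nn_integral_cmult[symmetric] mult_ac)
  also have "\<dots> = (\<integral>\<^sup>+z. (\<integral>\<^sup>+x. g z * (indicator U x * indicator U (x - z)) \<partial>lborel) \<partial>lborel)"
    by (rule lborel_pair.Fubini'[symmetric]) measurable
  also have "\<dots> = (\<integral>\<^sup>+z. g z * emeasure lborel (overlap U z) \<partial>lborel)"
  proof (intro nn_integral_cong)
    fix z
    have "(\<integral>\<^sup>+x. g z * (indicator U x * indicator U (x - z)) \<partial>lborel) =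
      g z * (\<integral>\<^sup>+x. indicator U x * indicator U (x - z) \<partial>lborel)"
      by (rule nn_integral_cmult) measurable
    also have "(\<integral>\<^sup>+x. indicator U x * indicator U (x - z) \<partial>lborel) = emeasure lborel (overlap U z)"
      by (simp add: emeasure_overlap_eq_nn_integral)
    finally show "(\<integral>\<^sup>+x. g z * (indicator U x * indicator U (x - z)) \<partial>lborel) = g z * emeasure lborel (overlap U z)" .
  qed
  finally show ?thesis .
qed

lemma nn_integral_overlap:
  fixes U :: "'a::euclidean_space set"
  assumes U: "U \<in> sets lebesgue" and g [measurable]: "g \<in> borel_measurable borel"
  shows "(\<integral>\<^sup>+x. indicator U x * (\<integral>\<^sup>+y. indicator U y * g (x - y) \<partial>lebesgue) \<partial>lebesgue)
     = (\<integral>\<^sup>+z. g z * emeasure lebesgue (overlap U z) \<partial>lebesgue)"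
proof -
  obtain U' where U': "U' \<in> sets borel" and ae: "AE x in lborel. x \<in> U \<longleftrightarrow> x \<in> U'"
    using ex_borel_set_representative[OF U] by metis
  have "(\<integral>\<^sup>+y. indicator U y * g (x - y) \<partial>lborel) = (\<integral>\<^sup>+y. indicator U' y * g (x - y) \<partial>lborel)" for x
    by (rule nn_integral_cong_AE) (use ae in eventually_elim, auto simp: indicator_def)
  moreover have "(\<integral>\<^sup>+x. indicator U x * h x \<partial>lborel) = (\<integral>\<^sup>+x. indicator U' x * h x \<partial>lborel)" for h :: "'a \<Rightarrow> ennreal"
    by (rule nn_integral_cong_AE) (use ae in eventually_elim, auto simp: indicator_def)
  ultimately show ?thesis
    using nn_integral_overlap_borel[OF U' g]
    by (simp add: nn_integral_completion emeasure_overlap_representative[OF U U' ae])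
qed

section \<open>Plancherel's identity for indicator functions\<close>

lemma indicator_L2:
  fixes S :: "'a::euclidean_space set"
  assumes "S \<in> lmeasurable"
  shows "(indicator S :: 'a \<Rightarrow> complex) \<in> L2" "integrable lebesgue (indicator S :: 'a \<Rightarrow> complex)"
    and "nsq (indicator S) = measure lebesgue S"
proof -
  show "(indicator S :: 'a \<Rightarrow> complex) \<in> L2" "integrable lebesgue (indicator S :: 'a \<Rightarrow> complex)"
    using L2_bounded_on_finite[OF assms, of "\<lambda>_. 1" 1] by auto
  have "nsq (indicator S) = (LINT x|lebesgue. indicator S x)"
    unfolding nsq_def by (intro Bochner_Integration.integral_cong) (auto simp: indicator_def)
  then show "nsq (indicator S) = measure lebesgue S" by simp
qed

lemma damped_Plancherel_indicator:
  fixes S :: "'a::euclidean_space set"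
  assumes S [measurable]: "S \<in> sets borel" and fin: "emeasure lborel S < \<infinity>" and s: "0 < s"
  shows "ennreal (LINT \<xi>|lebesgue. exp (- s * (norm \<xi>)\<^sup>2 / 2) * (cmod (fourier_integral (indicator S) \<xi>))\<^sup>2)
    = (\<integral>\<^sup>+z. ennreal (gauss s z) * emeasure lborel (overlap S z) \<partial>lborel)"
proof -
  let ?f = "indicator S :: 'a \<Rightarrow> complex"
  define H where "H x = (LINT y|lborel. indicator S y * gauss s (x - y))" for x :: 'a
  have Sl: "S \<in> lmeasurable" using fin by (intro fmeasurableI) auto
  have H [measurable]: "H \<in> borel_measurable borel" unfolding H_def by measurable
  have int: "integrable lborel (\<lambda>y. indicator S y * gauss s (x - y))" for x
  proof (rule Bochner_Integration.integrable_bound)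
    show "integrable lborel (\<lambda>y. gauss s (x - y))"
      by (rule integrableI_nonneg) (auto simp: nn_integral_gauss_translate[OF s])
  qed (auto simp: indicator_def)
  have nnH: "ennreal (H x) = (\<integral>\<^sup>+y. indicator S y * ennreal (gauss s (x - y)) \<partial>lborel)" for x
  proof -
    have "ennreal (H x) = (\<integral>\<^sup>+y. ennreal (indicator S y * gauss s (x - y)) \<partial>lborel)"
      unfolding H_def by (rule nn_integral_eq_integral[OF int, symmetric]) auto
    also have "\<dots> = (\<integral>\<^sup>+y. indicator S y * ennreal (gauss s (x - y)) \<partial>lborel)"
      by (intro nn_integral_cong) (auto simp: indicator_def)
    finally show ?thesis .
  qed
  have H0: "0 \<le> H x" for x unfolding H_def by (intro Bochner_Integration.integral_nonneg) auto
  have H1: "ennreal (H x) \<le> 1" for x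
  proof -
    have "ennreal (H x) \<le> (\<integral>\<^sup>+y. ennreal (gauss s (x - y)) \<partial>lborel)"
      unfolding nnH by (intro nn_integral_mono) (auto simp: indicator_def)
    then show ?thesis by (simp add: nn_integral_gauss_translate[OF s])
  qed
  have inner: "(LINT y|lebesgue. cnj (?f y) * complex_of_real (gauss s (x - y))) = of_real (H x)" for x
  proof -
    have "(LINT y|lebesgue. cnj (?f y) * complex_of_real (gauss s (x - y))) = (LINT y|lebesgue. complex_of_real (indicator S y * gauss s (x - y)))"
      by (intro Bochner_Integration.integral_cong) (auto simp: indicator_def)
    also have "\<dots> = (LINT y|lborel. complex_of_real (indicator S y * gauss s (x - y)))"
      by (rule integral_completion) measurable
    finally show ?thesis unfolding H_def by (simp only: integral_complex_of_real)
  qed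
  have "(\<integral>\<^sup>+x. ennreal (indicator S x * H x) \<partial>lborel) \<le> (\<integral>\<^sup>+x. indicator S x \<partial>lborel)"
    using H1 by (intro nn_integral_mono) (auto simp: indicator_def)
  then have "(\<integral>\<^sup>+x. ennreal (indicator S x * H x) \<partial>lborel) < \<infinity>" using fin by (auto simp: le_less_trans)
  then have intH: "integrable lborel (\<lambda>x. indicator S x * H x)"
    by (intro integrableI_nonneg) (auto simp: H0)
  have "complex_of_real (LINT \<xi>|lebesgue. exp (- s * (norm \<xi>)\<^sup>2 / 2) * (cmod (fourier_integral ?f \<xi>))\<^sup>2)
     = (LINT x|lebesgue. ?f x * of_real (H x))"
    unfolding damped_Plancherel(1)[OF indicator_L2(2)[OF Sl] s] inner ..
  also have "\<dots> = (LINT x|lebesgue. complex_of_real (indicator S x * H x))"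
    by (intro Bochner_Integration.integral_cong) (auto simp: indicator_def)
  also have "\<dots> = (LINT x|lborel. complex_of_real (indicator S x * H x))"
    by (rule integral_completion) measurable
  finally have "(LINT \<xi>|lebesgue. exp (- s * (norm \<xi>)\<^sup>2 / 2) * (cmod (fourier_integral ?f \<xi>))\<^sup>2) = (LINT x|lborel. indicator S x * H x)"
    by (simp only: integral_complex_of_real of_real_eq_iff)
  then have "ennreal (LINT \<xi>|lebesgue. exp (- s * (norm \<xi>)\<^sup>2 / 2) * (cmod (fourier_integral ?f \<xi>))\<^sup>2) = ennreal (LINT x|lborel. indicator S x * H x)"
    by simp
  also have "\<dots> = (\<integral>\<^sup>+x. ennreal (indicator S x * H x) \<partial>lborel)"
    by (rule nn_integral_eq_integral[OF intH, symmetric]) (auto simp: H0)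
  also have "\<dots> = (\<integral>\<^sup>+x. indicator S x * (\<integral>\<^sup>+y. indicator S y * ennreal (gauss s (x - y)) \<partial>lborel) \<partial>lborel)"
    unfolding nnH[symmetric] by (intro nn_integral_cong) (auto simp: indicator_def)
  also have "\<dots> = (\<integral>\<^sup>+z. ennreal (gauss s z) * emeasure lborel (overlap S z) \<partial>lborel)"
    by (rule nn_integral_overlap_borel) auto
  finally show ?thesis .
qed

lemma gauss_scale:
  fixes u :: "'a::euclidean_space"
  assumes "0 < s"
  shows "sqrt s ^ DIM('a) * gauss s (sqrt s *\<^sub>R u) = gauss 1 u"
proof -
  have "sqrt s * normal_density 0 (sqrt s) (sqrt s * v) = normal_density 0 1 v" for v
    using assms by (simp add: normal_density_def power_mult_distrib real_sqrt_mult field_simps)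
  then have "(\<Prod>b\<in>Basis. sqrt s * normal_density 0 (sqrt s) (sqrt s * (u \<bullet> b))) = gauss 1 u"
    by (simp add: gauss_def)
  then show ?thesis by (simp add: gauss_def prod.distrib)
qed

lemma nn_integral_gauss_rescale:
  fixes m :: "'a::euclidean_space \<Rightarrow> ennreal"
  assumes "0 < s" and [measurable]: "m \<in> borel_measurable borel"
  shows "(\<integral>\<^sup>+z. ennreal (gauss s z) * m z \<partial>lborel) = (\<integral>\<^sup>+u. ennreal (gauss 1 u) * m (sqrt s *\<^sub>R u) \<partial>lborel)"
proof -
  have "(\<integral>\<^sup>+z. ennreal (gauss s z) * m z \<partial>lborel) =
     ennreal (sqrt s ^ DIM('a)) * (\<integral>\<^sup>+u. ennreal (gauss s (sqrt s *\<^sub>R u)) * m (sqrt s *\<^sub>R u) \<partial>lborel)"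
    using nn_integral_lborel_affine[of "sqrt s" "\<lambda>z. ennreal (gauss s z) * m z" 0] assms by simp
  also have "\<dots> = (\<integral>\<^sup>+u. ennreal (gauss 1 u) * m (sqrt s *\<^sub>R u) \<partial>lborel)"
    using assms by (simp add: nn_integral_cmult[symmetric] mult.assoc[symmetric] ennreal_mult[symmetric] gauss_scale)
  finally show ?thesis .
qed

text \<open>The damped norms are averages of the overlaps of \<open>S\<close> with its translates by \<open>sqrt s u\<close>, where \<open>u\<close> is
  standard Gaussian. The hypothesis makes the overlap continuous at \<open>0\<close>, so as \<open>s\<close> tends to zero
  Fatou's lemma bounds \<open>\<bar>S\<bar>\<close> by the limit of the damped norms.\<close>

theorem Plancherel_indicator:
  fixes S :: "'a::euclidean_space set"
  assumes S: "S \<in> lmeasurable" and \<eta>: "0 < \<eta>"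
    and P: "\<And>h. measure lebesgue S - measure lebesgue (overlap S h) \<le> P * norm h powr \<eta>"
  shows "nsq (fourier_integral (indicator S :: 'a \<Rightarrow> complex)) = measure lebesgue S"
proof (rule antisym)
  let ?f = "indicator S :: 'a \<Rightarrow> complex"
  note f = indicator_L2[OF S]
  show "nsq (fourier_integral ?f) \<le> measure lebesgue S"
    using Plancherel_le(2)[OF f(2,1)] f(3) by simp
  have Sl: "S \<in> sets lebesgue" using S by auto
  obtain S' where S' [measurable]: "S' \<in> sets borel" and ae: "AE x in lborel. x \<in> S \<longleftrightarrow> x \<in> S'"
    using ex_borel_set_representative[OF Sl] by metis
  have ae': "AE x in lebesgue. x \<in> S \<longleftrightarrow> x \<in> S'" using ae by (rule AE_completion)
  have FI: "fourier_integral ?f = fourier_integral (indicator S')"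
  proof (rule fourier_integral_cong_AE)
    show "AE x in lebesgue. ?f x = indicator S' x" using ae' by eventually_elim (auto simp: indicator_def)
    show "indicator S' \<in> borel_measurable lebesgue" by (rule lebesgue_measurable_borel) measurable
  qed (use Sl in simp)
  define m where "m z = emeasure lborel (overlap S' z)" for z
  have m [measurable]: "m \<in> borel_measurable borel" unfolding m_def by measurable
  have m_eq: "m z = ennreal (measure lebesgue (overlap S z))" for z
    unfolding m_def emeasure_overlap_representative[OF Sl S' ae, symmetric]
    using overlap_lmeasurable[OF S] by (simp add: emeasure_eq_measure2 fmeasurableD2)
  have m0: "m 0 = ennreal (measure lebesgue S)" unfolding m_eq by (simp add: overlap_def)
  have fin: "emeasure lborel S' < \<infinity>" using m0 by (auto simp: m_def overlap_def)
  have le: "measure lebesgue (overlap S h) \<le> measure lebesgue S" for h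
    using S overlap_sets_lebesgue[OF Sl] by (intro measure_mono_fmeasurable) (auto simp: overlap_def)
  let ?s = "\<lambda>n. 1 / real (Suc n)"
  have lim: "(\<lambda>n. ennreal (gauss 1 u) * m (sqrt (?s n) *\<^sub>R u)) \<longlonglongrightarrow> ennreal (gauss 1 u) * m 0" for u
  proof (rule ennreal_tendsto_cmult)
    show "ennreal (gauss 1 u) < top" by simp
    have "(\<lambda>n. measure lebesgue (overlap S (sqrt (?s n) *\<^sub>R u))) \<longlonglongrightarrow> measure lebesgue S"
    proof (rule tendsto_sandwich[of "\<lambda>n. measure lebesgue S - P * norm (sqrt (?s n) *\<^sub>R u) powr \<eta>"])
      have "(\<lambda>n. measure lebesgue S - P * norm (sqrt (?s n) *\<^sub>R u) powr \<eta>) \<longlonglongrightarrow> measure lebesgue S - P * norm (sqrt 0 *\<^sub>R u) powr \<eta>"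
        using \<eta> by (intro tendsto_intros LIMSEQ_Suc[OF lim_1_over_n]) auto
      then show "(\<lambda>n. measure lebesgue S - P * norm (sqrt (?s n) *\<^sub>R u) powr \<eta>) \<longlonglongrightarrow> measure lebesgue S"
        by simp
      show "\<forall>\<^sub>F n in sequentially. measure lebesgue S - P * norm (sqrt (?s n) *\<^sub>R u) powr \<eta> \<le> measure lebesgue (overlap S (sqrt (?s n) *\<^sub>R u))"
        using P by (intro always_eventually allI) (smt (verit))
      show "\<forall>\<^sub>F n in sequentially. measure lebesgue (overlap S (sqrt (?s n) *\<^sub>R u)) \<le> measure lebesgue S"
        using le by (intro always_eventually allI)
    qed simp
    then show "(\<lambda>n. m (sqrt (?s n) *\<^sub>R u)) \<longlonglongrightarrow> m 0"
      unfolding m0 unfolding m_eq by (rule tendsto_ennrealI)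
  qed
  have u: "(\<integral>\<^sup>+u. ennreal (gauss 1 u) * m (sqrt (?s n) *\<^sub>R u) \<partial>lborel) \<le> ennreal (nsq (fourier_integral ?f))" for n
  proof -
    have s: "0 < ?s n" by simp
    have "(\<integral>\<^sup>+u. ennreal (gauss 1 u) * m (sqrt (?s n) *\<^sub>R u) \<partial>lborel) = (\<integral>\<^sup>+z. ennreal (gauss (?s n) z) * m z \<partial>lborel)"
      by (rule nn_integral_gauss_rescale[OF s, symmetric]) measurable
    also have "\<dots> = ennreal (LINT \<xi>|lebesgue. exp (- ?s n * (norm \<xi>)\<^sup>2 / 2) * (cmod (fourier_integral ?f \<xi>))\<^sup>2)"
      unfolding m_def FI by (rule damped_Plancherel_indicator[OF S' fin s, symmetric])
    also have "\<dots> \<le> ennreal (nsq (fourier_integral ?f))"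
      unfolding nsq_def
      by (intro ennreal_leI integral_mono damped_Plancherel(2)[OF f(2) s] L2_integrable_sq Plancherel_le(1) f mult_left_le_one_le)
         auto
    finally show ?thesis .
  qed
  have "ennreal (measure lebesgue S) = (\<integral>\<^sup>+u. ennreal (gauss 1 u) * m 0 \<partial>(lborel :: 'a measure))"
    by (simp add: m0 nn_integral_multc nn_integral_gauss)
  also have "\<dots> = (\<integral>\<^sup>+u. liminf (\<lambda>n. ennreal (gauss 1 u) * m (sqrt (?s n) *\<^sub>R u)) \<partial>lborel)"
    using lim_imp_Liminf[OF _ lim] by simp
  also have "\<dots> \<le> liminf (\<lambda>n. \<integral>\<^sup>+u. ennreal (gauss 1 u) * m (sqrt (?s n) *\<^sub>R u) \<partial>lborel)"
    by (rule nn_integral_liminf) measurable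
  also have "\<dots> \<le> limsup (\<lambda>n. \<integral>\<^sup>+u. ennreal (gauss 1 u) * m (sqrt (?s n) *\<^sub>R u) \<partial>lborel)"
    by (rule Liminf_le_Limsup) simp
  also have "\<dots> \<le> ennreal (nsq (fourier_integral ?f))"
    by (rule Limsup_bounded) (use u in auto)
  finally show "measure lebesgue S \<le> nsq (fourier_integral ?f)" by simp
qed

section \<open>The transforms on square integrable functions\<close>

text \<open>A contraction maps every sequence approximating \<open>f\<close> to a sequence converging to \<open>A f\<close>, so the
  function chosen in the extension can only be \<open>A f\<close>, up to a null set; the constant sequence shows
  that a choice is possible.\<close>

lemma L2_extension_integral:
  fixes f :: "'a::euclidean_space \<Rightarrow> complex"
  assumes A: "\<And>f. integrable lebesgue f \<Longrightarrow> f \<in> L2 \<Longrightarrow> A f \<in> L2 \<and> nsq (A f) \<le> nsq f"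
    and diff: "\<And>f g x. integrable lebesgue f \<Longrightarrow> integrable lebesgue g \<Longrightarrow> A (\<lambda>x. f x - g x) x = A f x - A g x"
    and f: "integrable lebesgue f" "f \<in> L2"
  shows "L2_extension A f \<in> L2" "AE x in lebesgue. L2_extension A f x = A f x"
proof -
  let ?Q = "\<lambda>g. g \<in> L2 \<and> (\<exists>u. (\<forall>n::nat. u n \<in> L2 \<and> integrable lebesgue (u n)) \<and>
          L2_tendsto u f \<and> L2_tendsto (\<lambda>n. A (u n)) g)"
  have "?Q (A f)"
    using A[OF f] f by (intro conjI exI[of _ "\<lambda>n. f"]) (auto simp: L2_tendsto_iff nsq_def)
  then have Q: "?Q (L2_extension A f)"
    unfolding L2_extension_def by (rule someI[where P = ?Q])
  let ?g = "L2_extension A f"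
  show g: "?g \<in> L2" using Q by blast
  obtain u where u: "\<And>n. u n \<in> L2" "\<And>n. integrable lebesgue (u n)" "L2_tendsto u f" "L2_tendsto (\<lambda>n. A (u n)) ?g"
    using Q by blast
  have Af: "A f \<in> L2" and Au: "A (u n) \<in> L2" for n using A f u by auto
  have l1: "(\<lambda>n. nsq (\<lambda>x. u n x - f x)) \<longlonglongrightarrow> 0" using L2_tendsto_iff u f by blast
  have l2: "(\<lambda>n. nsq (\<lambda>x. A (u n) x - ?g x)) \<longlonglongrightarrow> 0" using L2_tendsto_iff[of "\<lambda>n. A (u n)"] u Au g by blast
  have "nsq (\<lambda>x. ?g x - A f x) \<le> 2 * nsq (\<lambda>x. A (u n) x - ?g x) + 2 * nsq (\<lambda>x. u n x - f x)" for n
  proof -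
    have "nsq (\<lambda>x. ?g x - A f x) = nsq (\<lambda>x. (?g x - A (u n) x) + (A (u n) x - A f x))" by simp
    also have "\<dots> \<le> 2 * nsq (\<lambda>x. ?g x - A (u n) x) + 2 * nsq (\<lambda>x. A (u n) x - A f x)"
      by (intro nsq_add_le L2_diff g Au Af)
    also have "nsq (\<lambda>x. ?g x - A (u n) x) = nsq (\<lambda>x. A (u n) x - ?g x)" by (rule nsq_minus_commute)
    also have "(\<lambda>x. A (u n) x - A f x) = A (\<lambda>x. u n x - f x)"
      using diff[OF u(2) f(1)] by auto
    also have "nsq (A (\<lambda>x. u n x - f x)) \<le> nsq (\<lambda>x. u n x - f x)"
      using A u f L2_diff by blast
    finally show ?thesis by simp
  qed
  moreover have "(\<lambda>n. 2 * nsq (\<lambda>x. A (u n) x - ?g x) + 2 * nsq (\<lambda>x. u n x - f x)) \<longlonglongrightarrow> 2 * 0 + 2 * 0"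
    by (intro tendsto_intros l1 l2)
  ultimately have "nsq (\<lambda>x. ?g x - A f x) \<le> 0"
    by (intro LIMSEQ_le_const) auto
  then have "nsq (\<lambda>x. ?g x - A f x) = 0" using nsq_nonneg antisym by blast
  then have "AE x in lebesgue. ?g x - A f x = 0"
    by (subst (asm) nsq_eq_0_iff) (intro L2_diff g Af)
  then show "AE x in lebesgue. ?g x = A f x" by simp
qed

lemma fourier_eq_integral:
  assumes "integrable lebesgue f" "f \<in> L2"
  shows "fourier f \<in> L2" "AE x in lebesgue. fourier f x = fourier_integral f x"
  unfolding fourier_def
  using L2_extension_integral[of fourier_integral, OF _ fourier_integral_diff assms] Plancherel_le by blast+

lemma inv_fourier_integral_diff:
  assumes "integrable lebesgue f" "integrable lebesgue g"
  shows "inv_fourier_integral (\<lambda>x. f x - g x) \<xi> = inv_fourier_integral f \<xi> - inv_fourier_integral g \<xi>"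
  using fourier_integral_diff[OF assms] by (simp add: inv_fourier_integral_reflect)

lemma inv_fourier_eq_integral:
  assumes "integrable lebesgue f" "f \<in> L2"
  shows "inv_fourier f \<in> L2" "AE x in lebesgue. inv_fourier f x = inv_fourier_integral f x"
  unfolding inv_fourier_def
  using L2_extension_integral[of inv_fourier_integral, OF _ inv_fourier_integral_diff assms] inv_Plancherel_le by blast+

section \<open>The operator with explicit kernel\<close>

lemma space_proj_L2: "U \<in> sets lebesgue \<Longrightarrow> f \<in> L2 \<Longrightarrow> space_proj U f \<in> L2"
  unfolding space_proj_def by (rule L2_indicator_mult)

lemma space_proj_integrable: "U \<in> lmeasurable \<Longrightarrow> f \<in> L2 \<Longrightarrow> integrable lebesgue (space_proj U f)"
  unfolding space_proj_def by (rule L2_integrable_on_finite)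

lemma nsq_space_proj_le:
  assumes "U \<in> sets lebesgue" "f \<in> L2"
  shows "nsq (space_proj U f) \<le> nsq f"
  unfolding nsq_def
  by (intro integral_mono L2_integrable_sq space_proj_L2 assms) (auto simp: space_proj_def indicator_def)

lemma inv_fourier_integral_cnj:
  fixes h :: "'a::euclidean_space \<Rightarrow> complex"
  shows "inv_fourier_integral h x = cnj (fourier_integral (\<lambda>\<xi>. cnj (h \<xi>)) x)"
  unfolding inv_fourier_integral_reflect fourier_integral_cis
  by (simp add: cis_cnj flip: Bochner_Integration.integral_cnj)

lemma inv_fourier_integral_measurable:
  "integrable lebesgue f \<Longrightarrow> inv_fourier_integral f \<in> borel_measurable borel"
  unfolding inv_fourier_integral_reflect[abs_def]
  by (rule measurable_compose[OF _ fourier_integral_measurable]) simp_all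

lemma fourier_integral_scale:
  "fourier_integral (\<lambda>x. c * f x) \<xi> = c * fourier_integral f \<xi>"
  unfolding fourier_integral_cis by (simp add: mult.assoc)

lemma indicator_cis_L2:
  fixes U :: "'a::euclidean_space set"
  assumes "U \<in> lmeasurable"
  shows "(\<lambda>y. indicator U y * cis (y \<bullet> \<xi>)) \<in> L2"
    and "nsq (\<lambda>y. indicator U y * cis (y \<bullet> \<xi>)) = measure lebesgue U"
proof -
  show "(\<lambda>y. indicator U y * cis (y \<bullet> \<xi>)) \<in> L2"
    by (rule L2_bounded_on_finite[OF assms, where B=1]) (auto intro: cis_inner_measurable id_lebesgue_measurable)
  show "nsq (\<lambda>y. indicator U y * cis (y \<bullet> \<xi>)) = measure lebesgue U"
    using indicator_L2(3)[OF assms] by (simp add: nsq_def norm_mult)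
qed

locale finite_measure_sets =
  fixes E S :: "'a::euclidean_space set"
  assumes E: "E \<in> lmeasurable" and S: "S \<in> lmeasurable"
begin

text \<open>The operators \<open>A\<close> and \<open>T\<close> use Fourier integrals, which converge absolutely here because both sets have
  finite measure. In contrast to the transforms on \<open>L2\<close>, their values at individual points are
  determined.\<close>

definition A :: "('a \<Rightarrow> complex) \<Rightarrow> 'a \<Rightarrow> complex" where
  "A f = space_proj S (fourier_integral (space_proj E f))"

definition T :: "('a \<Rightarrow> complex) \<Rightarrow> 'a \<Rightarrow> complex" where
  "T f = space_proj E (inv_fourier_integral (A f))"

lemma Es: "E \<in> sets lebesgue" and Ss: "S \<in> sets lebesgue"
  using E S by auto

lemma fourier_E:
  assumes "f \<in> L2"
  shows "fourier_integral (space_proj E f) \<in> L2"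
    and "nsq (fourier_integral (space_proj E f)) \<le> nsq f"
  using Plancherel_le[OF space_proj_integrable[OF E assms] space_proj_L2[OF Es assms]]
    nsq_space_proj_le[OF Es assms] by auto

lemma A_L2: "f \<in> L2 \<Longrightarrow> A f \<in> L2"
  unfolding A_def by (intro space_proj_L2 Ss fourier_E)

lemma A_integrable: "f \<in> L2 \<Longrightarrow> integrable lebesgue (A f)"
  unfolding A_def by (intro space_proj_integrable S fourier_E)

lemma nsq_A_le: "f \<in> L2 \<Longrightarrow> nsq (A f) \<le> nsq f"
  unfolding A_def by (rule order_trans[OF nsq_space_proj_le[OF Ss fourier_E(1)] fourier_E(2)])

lemma T_L2: "f \<in> L2 \<Longrightarrow> T f \<in> L2"
  unfolding T_def by (intro space_proj_L2 Es inv_Plancherel_le A_integrable A_L2)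

lemma nsq_T_le: "f \<in> L2 \<Longrightarrow> nsq (T f) \<le> nsq (A f)"
  unfolding T_def
  by (rule order_trans[OF nsq_space_proj_le[OF Es inv_Plancherel_le(1)[OF A_integrable A_L2]]
        inv_Plancherel_le(2)[OF A_integrable A_L2]])

lemma A_diff:
  assumes "f \<in> L2" "g \<in> L2"
  shows "A (\<lambda>x. f x - g x) = (\<lambda>x. A f x - A g x)"
proof -
  have "space_proj E (\<lambda>x. f x - g x) = (\<lambda>x. space_proj E f x - space_proj E g x)"
    by (simp add: space_proj_def right_diff_distrib)
  then show ?thesis
    using assms by (simp add: A_def space_proj_def[of S] fourier_integral_diff space_proj_integrable E right_diff_distrib)
qed

lemma A_scale: "A (\<lambda>x. a * f x) = (\<lambda>x. a * A f x)"
proof -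
  have "space_proj E (\<lambda>x. a * f x) = (\<lambda>x. a * space_proj E f x)"
    by (simp add: space_proj_def mult.left_commute)
  then show ?thesis
    by (simp add: A_def space_proj_def[of S] fourier_integral_scale mult.left_commute)
qed

lemma T_diff:
  assumes "f \<in> L2" "g \<in> L2"
  shows "T (\<lambda>x. f x - g x) = (\<lambda>x. T f x - T g x)"
  using assms by (simp add: T_def A_diff space_proj_def[of E] inv_fourier_integral_diff A_integrable right_diff_distrib)

lemma T_scale: "T (\<lambda>x. a * f x) = (\<lambda>x. a * T f x)"
  by (simp add: T_def A_scale space_proj_def[of E] inv_fourier_integral_reflect fourier_integral_scale mult.left_commute)

text \<open>Duality moves the inverse transform in \<open>T f\<close> onto \<open>g\<close>, and the cut-off in \<open>A f\<close> restricts both factors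
  to \<open>S\<close>. So \<open>T = A\<^sup>*A\<close>.\<close>

lemma ip_T:
  assumes f: "f \<in> L2" and g: "g \<in> L2"
  shows "ip (T f) g = ip (A f) (A g)"
proof -
  let ?G = "space_proj E g" and ?h = "\<lambda>\<xi>. cnj (A f \<xi>)"
  have G: "integrable lebesgue ?G" by (rule space_proj_integrable[OF E g])
  have h: "integrable lebesgue ?h" using A_integrable[OF f] by simp
  have "ip (T f) g = (LINT x|lebesgue. cnj (?G x * fourier_integral ?h x))"
    unfolding ip_def T_def
    by (intro Bochner_Integration.integral_cong refl) (auto simp: space_proj_def inv_fourier_integral_cnj indicator_def)
  also have "\<dots> = cnj (LINT x|lebesgue. ?G x * fourier_integral ?h x)" by (rule Bochner_Integration.integral_cnj)
  also have "\<dots> = cnj (LINT \<xi>|lebesgue. ?h \<xi> * fourier_integral ?G \<xi>)"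
    by (simp only: fourier_integral_duality[OF G h])
  also have "\<dots> = (LINT \<xi>|lebesgue. A f \<xi> * cnj (fourier_integral ?G \<xi>))"
    by (simp flip: Bochner_Integration.integral_cnj)
  also have "\<dots> = ip (A f) (A g)"
    unfolding ip_def A_def[of g]
    by (intro Bochner_Integration.integral_cong refl) (auto simp: A_def space_proj_def indicator_def)
  finally show ?thesis .
qed

lemma ip_T_self: "f \<in> L2 \<Longrightarrow> ip (T f) f = of_real (nsq (A f))"
  by (simp add: ip_T ip_self)

lemma T_selfadjoint: "f \<in> L2 \<Longrightarrow> g \<in> L2 \<Longrightarrow> ip (T f) g = ip f (T g)"
  using ip_T[of f g] ip_T[of g f] by (metis ip_commute)

subsection \<open>The limiting operator\<close>

lemma freq_proj_AE:
  assumes f: "f \<in> L2"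
  shows "AE x in lebesgue. space_proj E (freq_proj S (space_proj E f)) x = T f x"
proof -
  let ?u = "space_proj E f"
  let ?v = "space_proj S (fourier ?u)"
  note u = space_proj_integrable[OF E f] space_proj_L2[OF Es f]
  note F = fourier_eq_integral[OF u]
  have v: "?v \<in> L2" "integrable lebesgue ?v"
    using F(1) by (auto intro: space_proj_L2 space_proj_integrable S Ss)
  have "AE \<xi> in lebesgue. ?v \<xi> = A f \<xi>"
    using F(2) by eventually_elim (simp add: space_proj_def A_def)
  then have "fourier_integral ?v = fourier_integral (A f)"
    by (rule fourier_integral_cong_AE) (use v A_L2[OF f] in \<open>auto intro: L2_measurable\<close>)
  then have "inv_fourier_integral ?v = inv_fourier_integral (A f)"
    by (simp add: inv_fourier_integral_reflect fun_eq_iff)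
  then show ?thesis
    using inv_fourier_eq_integral(2)[OF v(2,1)]
    by (auto elim!: eventually_mono simp: freq_proj_def T_def space_proj_def)
qed

subsection \<open>Kernels\<close>

text \<open>The sign of the frequency compensates the conjugation in \<open>ip\<close>, so that \<open>A f \<xi>\<close> is a multiple of
  \<open>ip f (wave \<xi>)\<close>.\<close>

definition wave :: "'a \<Rightarrow> 'a \<Rightarrow> complex" where
  "wave \<xi> y = indicator E y * cis (y \<bullet> (- \<xi>))"

definition \<kappa> :: "'a \<Rightarrow> complex" where
  "\<kappa> = inv_fourier_integral (indicator S)"

text \<open>The section at \<open>x\<close> of the kernel of \<open>T\<close>, conjugated so that \<open>T f x = ip f (K x)\<close>.\<close>

definition K :: "'a \<Rightarrow> 'a \<Rightarrow> complex" where
  "K x y = indicator E x * (indicator E y * (of_real (fourier_norm DIM('a)) * cnj (\<kappa> (x - y))))"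

lemma wave_L2: "wave \<xi> \<in> L2" and nsq_wave: "nsq (wave \<xi>) = measure lebesgue E"
  unfolding wave_def using indicator_cis_L2[OF E] by blast+

lemma fourier_integral_ip: "fourier_integral (space_proj E f) \<xi> = of_real (fourier_norm DIM('a)) * ip f (wave \<xi>)"
  unfolding fourier_integral_cis ip_def wave_def space_proj_def
  by (rule arg_cong2[where f="(*)"], rule refl, rule Bochner_Integration.integral_cong)
     (auto simp: cis_cnj indicator_def)

lemma \<kappa>_measurable: "\<kappa> \<in> borel_measurable borel"
  unfolding \<kappa>_def by (rule inv_fourier_integral_measurable) (rule indicator_L2[OF S])

lemma \<kappa>_bounded: "cmod (\<kappa> z) \<le> fourier_norm DIM('a) * measure lebesgue S"
proof -
  have "cmod (\<kappa> z) \<le> fourier_norm DIM('a) * (LINT x|lebesgue. cmod (indicator S x))"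
    unfolding \<kappa>_def inv_fourier_integral_reflect by (rule fourier_integral_bounded) (rule indicator_L2[OF S])
  also have "(LINT x|lebesgue. cmod (indicator S x)) = (LINT x|lebesgue. indicator S x)"
    by (intro Bochner_Integration.integral_cong) (auto simp: indicator_def)
  finally show ?thesis by simp
qed

lemma K_L2: "K x \<in> L2"
proof -
  have "(\<lambda>y. of_real (fourier_norm DIM('a)) * cnj (\<kappa> (x - y))) \<in> borel_measurable borel"
  proof -
    have "continuous_on UNIV (fourier_integral (indicator S :: 'a \<Rightarrow> complex))"
      by (rule fourier_integral_continuous) (rule indicator_L2[OF S])
    then have "continuous_on UNIV (\<lambda>y. of_real (fourier_norm DIM('a)) * cnj (fourier_integral (indicator S) (- (x - y))))"
      by (intro continuous_intros continuous_on_cnj continuous_on_compose2[of UNIV _ UNIV "\<lambda>y. - (x - y)"]) auto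
    then show ?thesis
      unfolding \<kappa>_def inv_fourier_integral_reflect by (rule borel_measurable_continuous_onI)
  qed
  then have "(\<lambda>y. indicator E y * (of_real (fourier_norm DIM('a)) * cnj (\<kappa> (x - y)))) \<in> L2"
    by (intro L2_bounded_on_finite(1)[OF E lebesgue_measurable_borel, where B="fourier_norm DIM('a) * (fourier_norm DIM('a) * measure lebesgue S)"])
       (auto simp: norm_mult less_imp_le \<kappa>_bounded)
  then show ?thesis
    unfolding K_def by (rule L2_scale)
qed

lemma T_eq_ip_K:
  assumes f: "f \<in> L2"
  shows "T f x = ip f (K x)"
proof -
  let ?u = "space_proj E f" and ?s = "indicator S :: 'a \<Rightarrow> complex"
  have "A f \<xi> * cis (\<xi> \<bullet> (- x)) = of_real (fourier_norm DIM('a)) * (?s \<xi> * (LINT y|lebesgue. ?u y * cis (\<xi> \<bullet> (y - x))))" for \<xi>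
  proof -
    have "(LINT y|lebesgue. ?u y * cis (y \<bullet> \<xi>)) * cis (\<xi> \<bullet> (- x)) = (LINT y|lebesgue. ?u y * cis (\<xi> \<bullet> (y - x)))"
      unfolding integral_mult_left_zero[symmetric]
      by (intro Bochner_Integration.integral_cong refl) (simp add: cis_mult inner_diff_right inner_commute mult.assoc)
    then show ?thesis by (simp add: A_def space_proj_def[of S] fourier_integral_cis mult_ac)
  qed
  then have "inv_fourier_integral (A f) x = of_real (fourier_norm DIM('a)) * (of_real (fourier_norm DIM('a)) * (LINT \<xi>|lebesgue. ?s \<xi> * (LINT y|lebesgue. ?u y * cis (\<xi> \<bullet> (y - x)))))"
    unfolding inv_fourier_integral_reflect fourier_integral_cis[of "A f"] by simp
  also have "(LINT \<xi>|lebesgue. ?s \<xi> * (LINT y|lebesgue. ?u y * cis (\<xi> \<bullet> (y - x)))) =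
      (LINT y|lebesgue. ?u y * (LINT \<xi>|lebesgue. ?s \<xi> * cis (\<xi> \<bullet> (y - x))))"
    by (rule Fubini_bounded_kernel[where B=1]) (auto intro: indicator_L2[OF S] space_proj_integrable[OF E f])
  also have "of_real (fourier_norm DIM('a)) * \<dots> = (LINT y|lebesgue. ?u y * \<kappa> (x - y))"
    unfolding \<kappa>_def inv_fourier_integral_reflect fourier_integral_cis integral_mult_right_zero[symmetric]
    by (intro Bochner_Integration.integral_cong refl) (simp add: mult_ac)
  finally have "T f x = indicator E x * (of_real (fourier_norm DIM('a)) * (LINT y|lebesgue. ?u y * \<kappa> (x - y)))"
    by (simp add: T_def space_proj_def[of E])
  also have "\<dots> = ip f (K x)"
    unfolding ip_def K_def integral_mult_right_zero[symmetric]
    by (intro Bochner_Integration.integral_cong refl) (auto simp: space_proj_def indicator_def)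
  finally show ?thesis .
qed

lemma nn_integral_nsq_K:
  "(\<integral>\<^sup>+x. ennreal (nsq (K x)) \<partial>lebesgue) =
     (\<integral>\<^sup>+z. ennreal ((fourier_norm DIM('a))\<^sup>2 * (cmod (\<kappa> z))\<^sup>2) * emeasure lebesgue (overlap E z) \<partial>lebesgue)"
proof -
  note \<kappa>_measurable [measurable]
  have "ennreal (nsq (K x)) = indicator E x * (\<integral>\<^sup>+y. indicator E y * ennreal ((fourier_norm DIM('a))\<^sup>2 * (cmod (\<kappa> (x - y)))\<^sup>2) \<partial>lebesgue)" for x
  proof -
    have "ennreal (nsq (K x)) = (\<integral>\<^sup>+y. ennreal ((cmod (K x y))\<^sup>2) \<partial>lebesgue)"
      by (rule nn_integral_nsq[OF K_L2, symmetric])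
    also have "\<dots> = indicator E x * (\<integral>\<^sup>+y. indicator E y * ennreal ((fourier_norm DIM('a))\<^sup>2 * (cmod (\<kappa> (x - y)))\<^sup>2) \<partial>lebesgue)"
      by (cases "x \<in> E") (auto simp: K_def norm_mult power_mult_distrib indicator_def intro!: nn_integral_cong)
    finally show ?thesis .
  qed
  then show ?thesis
    using nn_integral_overlap[OF Es, of "\<lambda>z. ennreal ((fourier_norm DIM('a))\<^sup>2 * (cmod (\<kappa> z))\<^sup>2)"] by simp
qed

text \<open>The value at \<open>x\<close> is an inner product of \<open>A f\<close> with a character on \<open>S\<close>. That this holds at every point,
  and not just in norm, is what turns the bound for the quadratic form off a maximal family into a bound
  for the residuals of the sections \<open>K x\<close>.\<close>

lemma T_pointwise_bound:
  assumes f: "f \<in> L2"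
  shows "(cmod (T f x))\<^sup>2 \<le> (fourier_norm DIM('a))\<^sup>2 * measure lebesgue S * nsq (A f)"
proof -
  let ?e = "\<lambda>\<xi>. indicator S \<xi> * cis (\<xi> \<bullet> x)"
  note e = indicator_cis_L2[OF S, of x]
  have "inv_fourier_integral (A f) x = of_real (fourier_norm DIM('a)) * ip (A f) ?e"
    unfolding inv_fourier_integral_reflect fourier_integral_cis[of "A f"] ip_def
    by (rule arg_cong2[where f="(*)"], rule refl, rule Bochner_Integration.integral_cong)
       (auto simp: cis_cnj indicator_def A_def space_proj_def)
  then have "cmod (T f x) \<le> cmod (of_real (fourier_norm DIM('a)) * ip (A f) ?e)"
    by (auto simp: T_def space_proj_def[of E] indicator_def)
  then have "(cmod (T f x))\<^sup>2 \<le> (cmod (of_real (fourier_norm DIM('a)) * ip (A f) ?e))\<^sup>2"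
    by (intro power_mono) auto
  also have "\<dots> = (fourier_norm DIM('a))\<^sup>2 * (cmod (ip (A f) ?e))\<^sup>2" by (simp add: norm_mult power_mult_distrib)
  also have "\<dots> \<le> (fourier_norm DIM('a))\<^sup>2 * (nsq (A f) * measure lebesgue S)"
    using ip_Cauchy_Schwarz[OF A_L2[OF f] e(1)] e(2) by (intro mult_left_mono) auto
  finally show ?thesis by (simp add: mult_ac)
qed

text \<open>Bessel's inequality for \<open>wave \<xi>\<close>, integrated over \<open>\<xi> \<in> S\<close>: the Hilbert--Schmidt norm of \<open>A\<close> dominates
  the sum over every orthonormal family.\<close>

lemma sum_nsq_A_le:
  assumes "orthonormal n b"
  shows "(\<Sum>i<n. nsq (A (b i))) \<le> (fourier_norm DIM('a))\<^sup>2 * measure lebesgue E * measure lebesgue S"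
proof -
  have b: "\<And>i. i < n \<Longrightarrow> b i \<in> L2" using assms by (auto simp: orthonormal_def)
  have "(\<Sum>i<n. nsq (A (b i))) = (LINT \<xi>|lebesgue. (\<Sum>i<n. (cmod (A (b i) \<xi>))\<^sup>2))"
    unfolding nsq_def by (rule Bochner_Integration.integral_sum[symmetric]) (use A_L2 b L2_integrable_sq in auto)
  also have "\<dots> \<le> (LINT \<xi>|lebesgue. (fourier_norm DIM('a))\<^sup>2 * measure lebesgue E * indicator S \<xi>)"
  proof (rule integral_mono)
    show "integrable lebesgue (\<lambda>\<xi>. \<Sum>i<n. (cmod (A (b i) \<xi>))\<^sup>2)"
      by (intro Bochner_Integration.integrable_sum) (use A_L2 b L2_integrable_sq in auto)
    show "integrable lebesgue (\<lambda>\<xi>. (fourier_norm DIM('a))\<^sup>2 * measure lebesgue E * indicator S \<xi>)"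
      using S by (intro integrable_mult_right integrable_real_indicator) (auto simp: fmeasurable_def)
    fix \<xi>
    show "(\<Sum>i<n. (cmod (A (b i) \<xi>))\<^sup>2) \<le> (fourier_norm DIM('a))\<^sup>2 * measure lebesgue E * indicator S \<xi>"
    proof (cases "\<xi> \<in> S")
      case True
      have "(\<Sum>i<n. (cmod (A (b i) \<xi>))\<^sup>2) = (fourier_norm DIM('a))\<^sup>2 * (\<Sum>i<n. (cmod (ip (wave \<xi>) (b i)))\<^sup>2)"
        using True by (simp add: A_def space_proj_def[of S] fourier_integral_ip norm_mult power_mult_distrib
            sum_distrib_left ip_commute[of "wave \<xi>"])
      also have "\<dots> \<le> (fourier_norm DIM('a))\<^sup>2 * nsq (wave \<xi>)"
        by (intro mult_left_mono Bessel_inequality[OF assms wave_L2]) auto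
      finally show ?thesis using True by (simp add: nsq_wave)
    qed (simp add: A_def space_proj_def)
  qed
  also have "\<dots> = (fourier_norm DIM('a))\<^sup>2 * measure lebesgue E * measure lebesgue S" using Ss by simp
  finally show ?thesis .
qed

subsection \<open>Compactness\<close>

lemma nsq_wave_diff_tendsto:
  assumes "X \<longlonglongrightarrow> \<xi>"
  shows "(\<lambda>n. nsq (\<lambda>y. wave (X n) y - wave \<xi> y)) \<longlonglongrightarrow> 0"
proof -
  have m: "(\<lambda>y. wave \<xi> y) \<in> borel_measurable lebesgue" for \<xi> using wave_L2 L2_measurable by blast
  have "(\<lambda>n. LINT y|lebesgue. (cmod (wave (X n) y - wave \<xi> y))\<^sup>2) \<longlonglongrightarrow> (LINT y|(lebesgue :: 'a measure). 0)"
  proof (rule integral_dominated_convergence)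
    show "integrable lebesgue (\<lambda>y. 4 * indicator E y :: real)"
      using E by (intro integrable_mult_right integrable_real_indicator) (auto simp: fmeasurable_def)
    show "AE y in lebesgue. (\<lambda>n. (cmod (wave (X n) y - wave \<xi> y))\<^sup>2) \<longlonglongrightarrow> 0"
    proof (rule AE_I2)
      fix y
      have "(\<lambda>n. (cmod (wave (X n) y - wave \<xi> y))\<^sup>2) \<longlonglongrightarrow> (cmod (wave \<xi> y - wave \<xi> y))\<^sup>2"
        unfolding wave_def cis_conv_exp using assms by (intro tendsto_intros)
      then show "(\<lambda>n. (cmod (wave (X n) y - wave \<xi> y))\<^sup>2) \<longlonglongrightarrow> 0" by simp
    qed
    show "AE y in lebesgue. norm ((cmod (wave (X n) y - wave \<xi> y))\<^sup>2) \<le> 4 * indicator E y" for n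
    proof (rule AE_I2)
      fix y
      have "cmod (wave (X n) y - wave \<xi> y) \<le> 2 * indicator E y"
        using norm_triangle_ineq4[of "cis (y \<bullet> (- X n))" "cis (y \<bullet> (- \<xi>))"] by (auto simp: wave_def indicator_def)
      then have "(cmod (wave (X n) y - wave \<xi> y))\<^sup>2 \<le> (2 * indicator E y)\<^sup>2" by (intro power_mono) auto
      then show "norm ((cmod (wave (X n) y - wave \<xi> y))\<^sup>2) \<le> 4 * indicator E y"
        by (cases "y \<in> E") (auto simp: power_mult_distrib)
    qed
  qed (use m in auto)
  then show ?thesis by (simp add: nsq_def)
qed

text \<open>The transforms of the functions \<open>f n\<close> cut off to \<open>E\<close> are uniformly bounded and equicontinuous at every
  point. A diagonal subsequence converging on a countable dense set therefore converges pointwise, hence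
  in \<open>L\<^sup>2\<close> on \<open>S\<close>, which has finite measure; the inverse transform is a contraction.\<close>

lemma T_compact:
  assumes f: "\<And>n. f n \<in> L2" and nf: "\<And>n. nsq (f n) \<le> 1"
  obtains k :: "nat \<Rightarrow> nat" and g where "strict_mono k" "g \<in> L2"
    "(\<lambda>n. nsq (\<lambda>x. T (f (k n)) x - g x)) \<longlonglongrightarrow> 0"
proof -
  define B where "B n \<xi> = fourier_integral (space_proj E (f n)) \<xi>" for n \<xi>
  have Bip: "B n \<xi> = of_real (fourier_norm DIM('a)) * ip (f n) (wave \<xi>)" for n \<xi> by (simp add: B_def fourier_integral_ip)
  define M where "M = fourier_norm DIM('a) * sqrt (measure lebesgue E)"
  have ip_le: "cmod (ip (f n) g) \<le> sqrt (nsq g)" if "g \<in> L2" for n g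
  proof -
    have "(cmod (ip (f n) g))\<^sup>2 \<le> nsq (f n) * nsq g" by (rule ip_Cauchy_Schwarz[OF f that])
    also have "\<dots> \<le> nsq g" using nf[of n] by (simp add: mult_left_le_one_le)
    finally show ?thesis by (simp add: real_le_rsqrt)
  qed
  have BM: "cmod (B n \<xi>) \<le> M" for n \<xi>
    using ip_le[OF wave_L2, of n \<xi>] by (simp add: Bip norm_mult M_def nsq_wave abs_of_pos mult_left_mono)
  have Bdiff: "cmod (B n \<xi> - B n \<xi>') \<le> fourier_norm DIM('a) * sqrt (nsq (\<lambda>y. wave \<xi>' y - wave \<xi> y))" for n \<xi> \<xi>'
  proof -
    have "B n \<xi> - B n \<xi>' = of_real (fourier_norm DIM('a)) * ip (f n) (\<lambda>y. wave \<xi> y - wave \<xi>' y)"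
      by (simp add: Bip ip_diff_right[OF wave_L2 wave_L2 f] right_diff_distrib)
    then show ?thesis
      using ip_le[OF L2_diff[OF wave_L2 wave_L2], of n \<xi> \<xi>'] by (simp add: norm_mult nsq_minus_commute[of "wave \<xi>"] abs_of_pos mult_left_mono)
  qed
  obtain D :: "'a set" where D: "countable D" "\<And>X. open X \<Longrightarrow> X \<noteq> {} \<Longrightarrow> \<exists>d\<in>D. d \<in> X"
    using countable_dense_exists by metis
  obtain k :: "nat \<Rightarrow> nat" where k: "strict_mono k" and kD: "\<And>d. d \<in> D \<Longrightarrow> \<exists>l. (\<lambda>n. B (k n) d) \<longlonglongrightarrow> l"
    using function_convergent_subsequence[OF D(1), of B M] BM by metis
  have "convergent (\<lambda>n. B (k n) \<xi>)" for \<xi>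
  proof (rule Cauchy_convergent, rule metric_CauchyI)
    fix e :: real assume e: "0 < e"
    have "\<exists>d\<in>D. fourier_norm DIM('a) * sqrt (nsq (\<lambda>y. wave d y - wave \<xi> y)) < e / 3"
    proof -
      have "\<exists>d\<in>D. d \<in> ball \<xi> (1 / real (Suc n))" for n by (rule D(2)) auto
      then obtain X where X: "\<And>n. X n \<in> D" "\<And>n. dist \<xi> (X n) < 1 / real (Suc n)" by (metis mem_ball)
      have l: "(\<lambda>n. 1 / real (Suc n)) \<longlonglongrightarrow> 0" by (rule LIMSEQ_Suc[OF lim_1_over_n])
      have "X \<longlonglongrightarrow> \<xi>"
        by (rule metric_tendsto_imp_tendsto[OF l])
           (use X(2) in \<open>auto simp: dist_commute less_imp_le intro!: always_eventually\<close>)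
      then have "(\<lambda>n. fourier_norm DIM('a) * sqrt (nsq (\<lambda>y. wave (X n) y - wave \<xi> y))) \<longlonglongrightarrow> fourier_norm DIM('a) * sqrt 0"
        by (intro tendsto_intros nsq_wave_diff_tendsto)
      then have "\<forall>\<^sub>F n in sequentially. fourier_norm DIM('a) * sqrt (nsq (\<lambda>y. wave (X n) y - wave \<xi> y)) < e / 3"
        by (rule order_tendstoD) (use e in simp)
      then show ?thesis using X(1) eventually_happens'[OF sequentially_bot] by blast
    qed
    then obtain d where d: "d \<in> D" "fourier_norm DIM('a) * sqrt (nsq (\<lambda>y. wave d y - wave \<xi> y)) < e / 3" by blast
    have "Cauchy (\<lambda>n. B (k n) d)" using kD[OF d(1)] convergent_Cauchy convergent_def by blast
    then obtain N where N: "\<And>m n. m \<ge> N \<Longrightarrow> n \<ge> N \<Longrightarrow> dist (B (k m) d) (B (k n) d) < e / 3"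
      using e unfolding Cauchy_def by (metis divide_pos_pos zero_less_numeral)
    have "dist (B (k m) \<xi>) (B (k n) \<xi>) < e" if "m \<ge> N" "n \<ge> N" for m n
    proof -
      have 1: "dist (B (k m) \<xi>) (B (k m) d) < e / 3" "dist (B (k n) \<xi>) (B (k n) d) < e / 3"
        unfolding dist_norm by (rule le_less_trans[OF Bdiff d(2)])+
      show ?thesis using 1 N[OF that] by metric
    qed
    then show "\<exists>N. \<forall>m\<ge>N. \<forall>n\<ge>N. dist (B (k m) \<xi>) (B (k n) \<xi>) < e" by blast
  qed
  then obtain h where h: "\<And>\<xi>. (\<lambda>n. B (k n) \<xi>) \<longlonglongrightarrow> h \<xi>" unfolding convergent_def by metis
  have Bm: "B n \<in> borel_measurable lebesgue" for n
    unfolding B_def using fourier_E(1)[OF f] L2_measurable by blast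
  have hm: "h \<in> borel_measurable lebesgue"
    by (rule borel_measurable_LIMSEQ_metric[OF Bm h])
  have hM: "cmod (h \<xi>) \<le> M" for \<xi>
    by (rule LIMSEQ_le_const2[OF tendsto_norm[OF h]]) (use BM in auto)
  define H where "H = space_proj S h"
  have H: "H \<in> L2" "integrable lebesgue H"
    unfolding H_def space_proj_def by (rule L2_bounded_on_finite[OF S hm hM])+
  have "(\<lambda>n. LINT \<xi>|lebesgue. (cmod (A (f (k n)) \<xi> - H \<xi>))\<^sup>2) \<longlonglongrightarrow> (LINT \<xi>|(lebesgue :: 'a measure). 0)"
  proof (rule integral_dominated_convergence)
    show "integrable lebesgue (\<lambda>y. (2 * M)\<^sup>2 * indicator S y :: real)"
      using S by (intro integrable_mult_right integrable_real_indicator) (auto simp: fmeasurable_def)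
    show "AE \<xi> in lebesgue. (\<lambda>n. (cmod (A (f (k n)) \<xi> - H \<xi>))\<^sup>2) \<longlonglongrightarrow> 0"
    proof (rule AE_I2)
      fix \<xi>
      have "(\<lambda>n. (cmod (indicator S \<xi> * B (k n) \<xi> - indicator S \<xi> * h \<xi>))\<^sup>2) \<longlonglongrightarrow> (cmod (indicator S \<xi> * h \<xi> - indicator S \<xi> * h \<xi>))\<^sup>2"
        by (intro tendsto_intros h)
      then show "(\<lambda>n. (cmod (A (f (k n)) \<xi> - H \<xi>))\<^sup>2) \<longlonglongrightarrow> 0"
        by (simp add: A_def H_def space_proj_def[of S] B_def)
    qed
    show "AE \<xi> in lebesgue. norm ((cmod (A (f (k n)) \<xi> - H \<xi>))\<^sup>2) \<le> (2 * M)\<^sup>2 * indicator S \<xi>" for n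
    proof (rule AE_I2)
      fix \<xi>
      have "cmod (B (k n) \<xi> - h \<xi>) \<le> 2 * M"
        using norm_triangle_ineq4[of "B (k n) \<xi>" "h \<xi>"] BM[of "k n" \<xi>] hM[of \<xi>] by linarith
      then have "(cmod (B (k n) \<xi> - h \<xi>))\<^sup>2 \<le> (2 * M)\<^sup>2" by (intro power_mono) auto
      then show "norm ((cmod (A (f (k n)) \<xi> - H \<xi>))\<^sup>2) \<le> (2 * M)\<^sup>2 * indicator S \<xi>"
        by (simp add: A_def H_def space_proj_def[of S] B_def indicator_def)
    qed
  next
    show "(\<lambda>\<xi>. (cmod (A (f (k n)) \<xi> - H \<xi>))\<^sup>2) \<in> borel_measurable lebesgue" for n
      using L2_integrable_sq[OF L2_diff[OF A_L2[OF f] H(1)]] by auto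
  qed auto
  then have lim: "(\<lambda>n. nsq (\<lambda>\<xi>. A (f (k n)) \<xi> - H \<xi>)) \<longlonglongrightarrow> 0" by (simp add: nsq_def)
  define g where "g = space_proj E (inv_fourier_integral H)"
  have g: "g \<in> L2" unfolding g_def by (intro space_proj_L2 Es inv_Plancherel_le H)
  have le: "nsq (\<lambda>x. T (f (k n)) x - g x) \<le> nsq (\<lambda>\<xi>. A (f (k n)) \<xi> - H \<xi>)" for n
  proof -
    let ?d = "\<lambda>\<xi>. A (f (k n)) \<xi> - H \<xi>"
    have d: "?d \<in> L2" "integrable lebesgue ?d" using L2_diff[OF A_L2[OF f] H(1)] A_integrable[OF f] H(2) by auto
    have "(\<lambda>x. T (f (k n)) x - g x) = space_proj E (inv_fourier_integral ?d)"
      using f H(2) by (simp add: T_def g_def space_proj_def[of E] inv_fourier_integral_diff A_integrable right_diff_distrib)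
    then show ?thesis
      using nsq_space_proj_le[OF Es inv_Plancherel_le(1)[OF d(2,1)]] inv_Plancherel_le(2)[OF d(2,1)] by simp
  qed
  have "(\<lambda>n. nsq (\<lambda>x. T (f (k n)) x - g x)) \<longlonglongrightarrow> 0"
    by (rule tendsto_sandwich[OF _ _ tendsto_const lim]) (use le in auto)
  with k g show thesis by (rule that)
qed

end

lemma limiting_op_AE:
  assumes "finite_measure_sets ((\<lambda>x. R *\<^sub>R x) ` F) S" "f \<in> L2"
  shows "AE x in lebesgue. limiting_op F S R f x = finite_measure_sets.T ((\<lambda>x. R *\<^sub>R x) ` F) S f x"
  using finite_measure_sets.freq_proj_AE[OF assms] by (simp add: limiting_op_def Let_def)

section \<open>Spectral decomposition\<close>

context finite_measure_sets
begin

definition eigenfamily :: "real \<Rightarrow> nat \<Rightarrow> (nat \<Rightarrow> 'a \<Rightarrow> complex) \<Rightarrow> (nat \<Rightarrow> real) \<Rightarrow> bool" where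
  "eigenfamily \<delta> n b l \<longleftrightarrow> orthonormal n b \<and>
     (\<forall>i<n. \<delta> < l i \<and> (AE x in lebesgue. T (b i) x = of_real (l i) * b i x))"

definition orthogonal_to :: "nat \<Rightarrow> (nat \<Rightarrow> 'a \<Rightarrow> complex) \<Rightarrow> ('a \<Rightarrow> complex) \<Rightarrow> bool" where
  "orthogonal_to n b f \<longleftrightarrow> f \<in> L2 \<and> (\<forall>i<n. ip f (b i) = 0)"

lemma eigenfamilyD:
  assumes "eigenfamily \<delta> n b l" "i < n"
  shows "b i \<in> L2" "nsq (b i) = 1" "\<delta> < l i" "AE x in lebesgue. T (b i) x = of_real (l i) * b i x"
proof -
  show "b i \<in> L2" "\<delta> < l i" "AE x in lebesgue. T (b i) x = of_real (l i) * b i x"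
    using assms by (auto simp: eigenfamily_def orthonormal_def)
  have "ip (b i) (b i) = 1" using assms by (auto simp: eigenfamily_def orthonormal_def)
  then show "nsq (b i) = 1" by (simp add: ip_self)
qed

lemma ip_eigenvector:
  assumes "AE x in lebesgue. T b x = of_real l * b x" "b \<in> L2" "f \<in> L2"
  shows "ip (T f) b = of_real l * ip f b"
proof -
  have "ip (T f) b = ip f (T b)" by (rule T_selfadjoint) fact+
  also have "\<dots> = ip f (\<lambda>x. of_real l * b x)"
    by (rule ip_cong_AE) (use assms T_L2 L2_scale in auto)
  finally show ?thesis by (simp add: ip_scale_right)
qed

lemma nsq_T_A_eigenvector:
  assumes "AE x in lebesgue. T b x = of_real l * b x" "b \<in> L2"
  shows "nsq (A b) = l * nsq b" "nsq (T b) = l\<^sup>2 * nsq b"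
proof -
  have "complex_of_real (nsq (A b)) = of_real (l * nsq b)"
    using ip_eigenvector[OF assms assms(2)] ip_T_self[OF assms(2)] by (simp add: ip_self)
  then show "nsq (A b) = l * nsq b" by (simp only: of_real_eq_iff)
  have "nsq (T b) = nsq (\<lambda>x. of_real l * b x)"
    by (rule nsq_cong_AE) (use assms T_L2 L2_scale in auto)
  then show "nsq (T b) = l\<^sup>2 * nsq b" by (simp add: nsq_scale)
qed

lemma eigenfamily_le_1: "eigenfamily \<delta> n b l \<Longrightarrow> i < n \<Longrightarrow> l i \<le> 1"
  using nsq_T_A_eigenvector(1)[of "b i" "l i"] eigenfamilyD[of \<delta> n b l i] nsq_A_le[of "b i"] by simp

lemma eigenfamily_sum_le:
  assumes "eigenfamily \<delta> n b l"
  shows "(\<Sum>i<n. l i) \<le> (fourier_norm DIM('a))\<^sup>2 * measure lebesgue E * measure lebesgue S"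
proof -
  have "(\<Sum>i<n. l i) = (\<Sum>i<n. nsq (A (b i)))"
    using nsq_T_A_eigenvector(1)[OF eigenfamilyD(4,1)[OF assms]] eigenfamilyD(2)[OF assms] by (intro sum.cong) auto
  also have "\<dots> \<le> (fourier_norm DIM('a))\<^sup>2 * measure lebesgue E * measure lebesgue S"
    using assms by (intro sum_nsq_A_le) (auto simp: eigenfamily_def)
  finally show ?thesis .
qed

lemma orthogonal_to_T:
  assumes "eigenfamily \<delta> n b l" "orthogonal_to n b f"
  shows "orthogonal_to n b (T f)"
proof -
  have f: "f \<in> L2" "\<And>i. i < n \<Longrightarrow> ip f (b i) = 0" using assms(2) by (auto simp: orthogonal_to_def)
  have "ip (T f) (b i) = 0" if "i < n" for i
    using ip_eigenvector[OF eigenfamilyD(4,1)[OF assms(1) that] f(1)] f(2)[OF that] by simp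
  then show ?thesis using T_L2[OF f(1)] by (simp add: orthogonal_to_def)
qed

lemma orthogonal_to_scale: "orthogonal_to n b f \<Longrightarrow> orthogonal_to n b (\<lambda>x. z * f x)"
  by (auto simp: orthogonal_to_def L2_scale ip_scale_left)

lemma nsq_normalise:
  assumes "0 < nsq f"
  shows "nsq (\<lambda>x. complex_of_real (1 / sqrt (nsq f)) * f x) = 1"
proof -
  have "(cmod (complex_of_real (1 / sqrt (nsq f))))\<^sup>2 = 1 / nsq f"
    using assms unfolding norm_of_real power2_abs by (simp add: power_divide)
  then show ?thesis using assms by (simp add: nsq_scale del: of_real_divide)
qed

lemma nsq_A_normalise:
  assumes "0 < nsq f"
  shows "nsq (A (\<lambda>x. complex_of_real (1 / sqrt (nsq f)) * f x)) = nsq (A f) / nsq f"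
proof -
  have "(cmod (complex_of_real (1 / sqrt (nsq f))))\<^sup>2 = 1 / nsq f"
    using assms unfolding norm_of_real power2_abs by (simp add: power_divide)
  then show ?thesis by (simp add: A_scale nsq_scale del: of_real_divide)
qed

text \<open>The supremum \<open>\<mu>\<close> of the quadratic form over unit vectors orthogonal to the family is attained:
  for a maximising sequence \<open>T f - \<mu> f\<close> tends to zero, and \<open>T f\<close> converges along a subsequence.\<close>

lemma ex_eigenvector:
  assumes fam: "eigenfamily \<delta> n b l" and \<delta>: "0 \<le> \<delta>"
    and f0: "orthogonal_to n b f0" "\<delta> * nsq f0 < nsq (A f0)"
  obtains \<psi> \<mu> where "orthogonal_to n b \<psi>" "nsq \<psi> = 1" "\<delta> < \<mu>"
    "AE x in lebesgue. T \<psi> x = of_real \<mu> * \<psi> x"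
proof -
  let ?W = "orthogonal_to n b"
  have WL: "f \<in> L2" if "?W f" for f using that by (simp add: orthogonal_to_def)
  define Q where "Q = {nsq (A f) | f. ?W f \<and> nsq f = 1}"
  define \<mu> where "\<mu> = Sup Q"
  have Q1: "x \<le> 1" if "x \<in> Q" for x using that nsq_A_le WL by (fastforce simp: Q_def)
  then have bdd: "bdd_above Q" by (rule bdd_aboveI)
  have pos: "0 < nsq f0"
  proof (rule ccontr)
    assume "\<not> 0 < nsq f0"
    then have "nsq f0 = 0" using nsq_nonneg[of f0] by linarith
    then show False using f0(2) nsq_A_le[OF WL[OF f0(1)]] by simp
  qed
  have f1: "nsq (A f0) / nsq f0 \<in> Q"
    unfolding Q_def mem_Collect_eq
    by (intro exI conjI, rule nsq_A_normalise[OF pos, symmetric])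
       (intro orthogonal_to_scale f0(1), rule nsq_normalise[OF pos])
  have "\<delta> < nsq (A f0) / nsq f0" using f0(2) pos by (simp add: field_simps)
  also have "\<dots> \<le> \<mu>" unfolding \<mu>_def by (rule cSup_upper[OF f1 bdd])
  finally have \<mu>: "\<delta> < \<mu>" .
  then have \<mu>0: "0 < \<mu>" using \<delta> by simp
  have bound: "nsq (A f) \<le> \<mu> * nsq f" if f: "?W f" for f
  proof (cases "0 < nsq f")
    case True
    have "nsq (A f) / nsq f \<in> Q"
      unfolding Q_def mem_Collect_eq
      by (intro exI conjI, rule nsq_A_normalise[OF True, symmetric])
         (intro orthogonal_to_scale f, rule nsq_normalise[OF True])
    then have "nsq (A f) / nsq f \<le> \<mu>" unfolding \<mu>_def by (rule cSup_upper[OF _ bdd])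
    then show ?thesis using True by (simp add: field_simps)
  next
    case False
    then have "nsq f = 0" using nsq_nonneg[of f] by linarith
    then show ?thesis using nsq_A_le[OF WL[OF f]] by simp
  qed
  \<comment> \<open>Cauchy-Schwarz for the form \<open>\<langle>A f, A g\<rangle>\<close> with \<open>g = T f\<close>, which is again orthogonal to the family.\<close>
  have nT: "nsq (T f) \<le> \<mu> * nsq (A f)" if f: "?W f" for f
  proof (cases "nsq (T f) = 0")
    case False
    have "(nsq (T f))\<^sup>2 = (cmod (ip (T f) (T f)))\<^sup>2" by (simp add: ip_self)
    also have "\<dots> = (cmod (ip (A f) (A (T f))))\<^sup>2" using ip_T[OF WL[OF f] T_L2[OF WL[OF f]]] by simp
    also have "\<dots> \<le> nsq (A f) * nsq (A (T f))" by (intro ip_Cauchy_Schwarz A_L2 T_L2 WL f)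
    also have "\<dots> \<le> nsq (A f) * (\<mu> * nsq (T f))" by (intro mult_left_mono bound orthogonal_to_T[OF fam] f) simp
    finally have "nsq (T f) * nsq (T f) \<le> (\<mu> * nsq (A f)) * nsq (T f)" by (simp add: power2_eq_square mult_ac)
    moreover have "0 < nsq (T f)" using False nsq_nonneg[of "T f"] by linarith
    ultimately show ?thesis by simp
  qed (use \<mu>0 in simp)
  \<comment> \<open>For a maximising sequence the right-hand side tends to zero.\<close>
  have near: "nsq (\<lambda>x. of_real \<mu> * f x - T f x) \<le> \<mu> * (\<mu> - nsq (A f))" if f: "?W f" "nsq f = 1" for f
  proof -
    have "nsq (\<lambda>x. of_real \<mu> * f x - T f x) = \<mu>\<^sup>2 * nsq f - 2 * (\<mu> * Re (ip f (T f))) + nsq (T f)"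
      using WL[OF f(1)] by (subst nsq_diff) (auto simp: L2_scale T_L2 nsq_scale ip_scale_left)
    also have "ip f (T f) = of_real (nsq (A f))"
      using WL[OF f(1)] by (simp add: T_selfadjoint[symmetric] ip_T_self)
    finally have "nsq (\<lambda>x. of_real \<mu> * f x - T f x) = \<mu>\<^sup>2 - 2 * (\<mu> * nsq (A f)) + nsq (T f)" using f by simp
    then show ?thesis using nT[OF f(1)] by (simp add: algebra_simps power2_eq_square)
  qed
  have "\<exists>f. ?W f \<and> nsq f = 1 \<and> \<mu> - 1 / real (Suc m) < nsq (A f)" for m
  proof -
    have "\<exists>q\<in>Q. \<mu> - 1 / real (Suc m) < q"
      unfolding \<mu>_def by (subst less_cSup_iff[symmetric]) (use f1 bdd in auto)
    then show ?thesis unfolding Q_def by blast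
  qed
  then obtain f where f: "\<And>m. ?W (f m)" "\<And>m. nsq (f m) = 1" "\<And>m. \<mu> - 1 / real (Suc m) < nsq (A (f m))" by metis
  have fL: "f m \<in> L2" for m using f WL by blast
  obtain k :: "nat \<Rightarrow> nat" and g where k: "strict_mono k" and g: "g \<in> L2"
    and lim: "(\<lambda>m. nsq (\<lambda>x. T (f (k m)) x - g x)) \<longlonglongrightarrow> 0"
    by (rule T_compact[OF fL eq_refl[OF f(2)]])
  define \<psi> where "\<psi> = (\<lambda>x. complex_of_real (1 / \<mu>) * g x)"
  have \<psi>: "\<psi> \<in> L2" unfolding \<psi>_def by (rule L2_scale[OF g])
  define d where "d m = nsq (\<lambda>x. f (k m) x - \<psi> x)" for m
  define e where "e m = nsq (\<lambda>x. of_real \<mu> * f (k m) x - T (f (k m)) x)" for m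
  have e: "e \<longlonglongrightarrow> 0"
  proof (rule tendsto_sandwich[of "\<lambda>_. 0"])
    show "\<forall>\<^sub>F m in sequentially. e m \<le> \<mu> * (1 / real (Suc m))"
    proof (intro always_eventually allI)
      fix m
      have "e m \<le> \<mu> * (\<mu> - nsq (A (f (k m))))" unfolding e_def by (rule near[OF f(1,2)])
      also have "\<mu> - nsq (A (f (k m))) \<le> 1 / real (Suc (k m))" using f(3)[of "k m"] by simp
      also have "1 / real (Suc (k m)) \<le> 1 / real (Suc m)"
        using seq_suble[OF k, of m] by (simp add: frac_le)
      finally show "e m \<le> \<mu> * (1 / real (Suc m))" using \<mu>0 by simp
    qed
    have "(\<lambda>m. \<mu> * (1 / real (Suc m))) \<longlonglongrightarrow> \<mu> * 0" by (intro tendsto_intros LIMSEQ_Suc[OF lim_1_over_n])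
    then show "(\<lambda>m. \<mu> * (1 / real (Suc m))) \<longlonglongrightarrow> 0" by simp
  qed (auto simp: e_def)
  have d: "d \<longlonglongrightarrow> 0"
  proof (rule tendsto_sandwich[of "\<lambda>_. 0"])
    show "\<forall>\<^sub>F m in sequentially. d m \<le> (1 / \<mu>)\<^sup>2 * (2 * e m + 2 * nsq (\<lambda>x. T (f (k m)) x - g x))"
    proof (intro always_eventually allI)
      fix m
      have "(\<lambda>x. f (k m) x - \<psi> x) = (\<lambda>x. complex_of_real (1 / \<mu>) * ((of_real \<mu> * f (k m) x - T (f (k m)) x) + (T (f (k m)) x - g x)))"
        using \<mu>0 by (auto simp: \<psi>_def field_simps)
      then have "d m = (1 / \<mu>)\<^sup>2 * nsq (\<lambda>x. (of_real \<mu> * f (k m) x - T (f (k m)) x) + (T (f (k m)) x - g x))"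
        unfolding d_def using \<mu>0 by (simp only: nsq_scale norm_of_real power2_abs)
      also have "\<dots> \<le> (1 / \<mu>)\<^sup>2 * (2 * e m + 2 * nsq (\<lambda>x. T (f (k m)) x - g x))"
        unfolding e_def by (intro mult_left_mono nsq_add_le L2_diff L2_scale fL T_L2 g) simp
      finally show "d m \<le> (1 / \<mu>)\<^sup>2 * (2 * e m + 2 * nsq (\<lambda>x. T (f (k m)) x - g x))" .
    qed
    have "(\<lambda>m. (1 / \<mu>)\<^sup>2 * (2 * e m + 2 * nsq (\<lambda>x. T (f (k m)) x - g x))) \<longlonglongrightarrow> (1 / \<mu>)\<^sup>2 * (2 * 0 + 2 * 0)"
      by (intro tendsto_intros e lim)
    then show "(\<lambda>m. (1 / \<mu>)\<^sup>2 * (2 * e m + 2 * nsq (\<lambda>x. T (f (k m)) x - g x))) \<longlonglongrightarrow> 0" by simp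
  qed (auto simp: d_def)
  \<comment> \<open>The limit does not vanish; it is normalised at the end.\<close>
  have "1 \<le> 2 * nsq \<psi> + 2 * d m" for m
    using nsq_add_le[OF \<psi> L2_diff[OF fL \<psi>], of "k m"] f(2)[of "k m"] by (simp add: d_def)
  moreover have "(\<lambda>m. 2 * nsq \<psi> + 2 * d m) \<longlonglongrightarrow> 2 * nsq \<psi> + 2 * 0" by (intro tendsto_intros d)
  ultimately have "1 \<le> 2 * nsq \<psi> + 2 * 0" by (intro LIMSEQ_le_const) auto
  then have \<psi>pos: "0 < nsq \<psi>" by simp
  have "ip \<psi> (b i) = 0" if i: "i < n" for i
  proof -
    have "(cmod (ip \<psi> (b i)))\<^sup>2 \<le> d m" for m
    proof -
      have "ip \<psi> (b i) = - ip (\<lambda>x. f (k m) x - \<psi> x) (b i)"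
        using f(1)[of "k m"] i eigenfamilyD(1)[OF fam i] by (subst ip_diff_left) (auto simp: fL \<psi> orthogonal_to_def)
      then have "(cmod (ip \<psi> (b i)))\<^sup>2 \<le> d m * nsq (b i)"
        unfolding d_def by (simp add: ip_Cauchy_Schwarz L2_diff fL \<psi> eigenfamilyD(1)[OF fam i])
      then show ?thesis by (simp add: eigenfamilyD(2)[OF fam i])
    qed
    then have "(cmod (ip \<psi> (b i)))\<^sup>2 \<le> 0" by (intro LIMSEQ_le_const[OF d]) auto
    then show ?thesis by simp
  qed
  then have W\<psi>: "?W \<psi>" using \<psi> by (simp add: orthogonal_to_def)
  have "nsq (\<lambda>x. T \<psi> x - of_real \<mu> * \<psi> x) \<le> 2 * (2 * d m + 2 * e m) + 2 * (\<mu>\<^sup>2 * d m)" for m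
  proof -
    let ?f = "f (k m)"
    have 1: "nsq (\<lambda>x. T \<psi> x - T ?f x) \<le> d m"
    proof -
      have "nsq (T (\<lambda>x. \<psi> x - ?f x)) \<le> nsq (\<lambda>x. \<psi> x - ?f x)"
        by (rule order_trans[OF nsq_T_le nsq_A_le]; rule L2_diff[OF \<psi> fL])
      then show ?thesis using T_diff[OF \<psi> fL] by (simp add: d_def nsq_minus_commute[of \<psi>])
    qed
    have 2: "nsq (\<lambda>x. of_real \<mu> * ?f x - of_real \<mu> * \<psi> x) = \<mu>\<^sup>2 * d m"
      unfolding d_def right_diff_distrib[symmetric] nsq_scale by simp
    have "nsq (\<lambda>x. T \<psi> x - of_real \<mu> * \<psi> x) =
       nsq (\<lambda>x. ((T \<psi> x - T ?f x) + (T ?f x - of_real \<mu> * ?f x)) + (of_real \<mu> * ?f x - of_real \<mu> * \<psi> x))"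
      by simp
    also have "\<dots> \<le> 2 * nsq (\<lambda>x. (T \<psi> x - T ?f x) + (T ?f x - of_real \<mu> * ?f x)) + 2 * (\<mu>\<^sup>2 * d m)"
      unfolding 2[symmetric] by (intro nsq_add_le L2_add L2_diff L2_scale T_L2 fL \<psi>)
    also have "nsq (\<lambda>x. (T \<psi> x - T ?f x) + (T ?f x - of_real \<mu> * ?f x)) \<le>
        2 * nsq (\<lambda>x. T \<psi> x - T ?f x) + 2 * nsq (\<lambda>x. T ?f x - of_real \<mu> * ?f x)"
      by (intro nsq_add_le L2_add L2_diff L2_scale T_L2 fL \<psi>)
    also have "nsq (\<lambda>x. T ?f x - of_real \<mu> * ?f x) = e m"
      unfolding e_def by (rule nsq_minus_commute)
    finally show ?thesis using 1 by simp
  qed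
  moreover have "(\<lambda>m. 2 * (2 * d m + 2 * e m) + 2 * (\<mu>\<^sup>2 * d m)) \<longlonglongrightarrow> 2 * (2 * 0 + 2 * 0) + 2 * (\<mu>\<^sup>2 * 0)"
    by (intro tendsto_intros d e)
  ultimately have "nsq (\<lambda>x. T \<psi> x - of_real \<mu> * \<psi> x) \<le> 0"
    by (intro LIMSEQ_le_const) auto
  then have "nsq (\<lambda>x. T \<psi> x - of_real \<mu> * \<psi> x) = 0" using nsq_nonneg antisym by blast
  then have "AE x in lebesgue. T \<psi> x - of_real \<mu> * \<psi> x = 0"
    by (subst (asm) nsq_eq_0_iff) (intro L2_diff L2_scale T_L2 \<psi>)
  then have eig: "AE x in lebesgue. T (\<lambda>x. complex_of_real (1 / sqrt (nsq \<psi>)) * \<psi> x) x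
      = of_real \<mu> * (complex_of_real (1 / sqrt (nsq \<psi>)) * \<psi> x)"
    unfolding T_scale by eventually_elim simp
  show thesis
    by (rule that[OF orthogonal_to_scale[OF W\<psi>] nsq_normalise[OF \<psi>pos] \<mu> eig])
qed

lemma eigenfamily_extend:
  assumes fam: "eigenfamily \<delta> n b l"
    and \<psi>: "orthogonal_to n b \<psi>" "nsq \<psi> = 1" "\<delta> < \<mu>" "AE x in lebesgue. T \<psi> x = of_real \<mu> * \<psi> x"
  shows "eigenfamily \<delta> (Suc n) (b(n := \<psi>)) (l(n := \<mu>))"
proof -
  have "ip (b i) \<psi> = 0" if "i < n" for i
    using \<psi>(1) that ip_commute[of \<psi> "b i"] ip_commute[of "b i" \<psi>] by (simp add: orthogonal_to_def)
  then show ?thesis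
    using assms by (auto simp: eigenfamily_def orthonormal_def orthogonal_to_def less_Suc_eq ip_self)
qed

text \<open>The bound on the sum of the eigenvalues limits the size of such families, and a largest one leaves no
  eigenvector with eigenvalue above \<open>\<delta>\<close> in its orthogonal complement.\<close>

lemma ex_maximal_eigenfamily:
  assumes \<delta>: "0 < \<delta>"
  obtains n b l where "eigenfamily \<delta> n b l" "\<And>f. orthogonal_to n b f \<Longrightarrow> nsq (A f) \<le> \<delta> * nsq f"
proof -
  let ?P = "\<lambda>n. \<exists>b l. eigenfamily \<delta> n b l"
  let ?H = "(fourier_norm DIM('a))\<^sup>2 * measure lebesgue E * measure lebesgue S"
  have P0: "?P 0" by (auto simp: eigenfamily_def orthonormal_def)
  have bound: "n \<le> nat \<lceil>?H / \<delta>\<rceil>" if "?P n" for n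
  proof -
    obtain b l where fam: "eigenfamily \<delta> n b l" using \<open>?P n\<close> by blast
    have "real n * \<delta> = (\<Sum>i<n. \<delta>)" by simp
    also have "\<dots> \<le> (\<Sum>i<n. l i)" using eigenfamilyD(3)[OF fam] by (intro sum_mono) (auto intro: less_imp_le)
    also have "\<dots> \<le> ?H" by (rule eigenfamily_sum_le[OF fam])
    finally have "real n \<le> ?H / \<delta>" using \<delta> by (simp add: field_simps)
    then show ?thesis by linarith
  qed
  obtain n where n: "?P n" "\<And>m. ?P m \<Longrightarrow> m \<le> n"
    using ex_has_greatest_nat[of ?P 0 "\<lambda>n. n"] P0 bound by (metis less_Suc_eq_le)
  obtain b l where fam: "eigenfamily \<delta> n b l" using n(1) by blast
  have "nsq (A f) \<le> \<delta> * nsq f" if f: "orthogonal_to n b f" for f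
  proof (rule ccontr)
    assume "\<not> nsq (A f) \<le> \<delta> * nsq f"
    then have "\<delta> * nsq f < nsq (A f)" by simp
    then obtain \<psi> \<mu> where "orthogonal_to n b \<psi>" "nsq \<psi> = 1" "\<delta> < \<mu>" "AE x in lebesgue. T \<psi> x = of_real \<mu> * \<psi> x"
      using ex_eigenvector[OF fam less_imp_le[OF \<delta>] f] by metis
    then have "?P (Suc n)" using eigenfamily_extend[OF fam] by blast
    then show False using n(2) by fastforce
  qed
  with fam show thesis by (rule that)
qed

lemma residual_orthogonal_to: "orthonormal n b \<Longrightarrow> f \<in> L2 \<Longrightarrow> orthogonal_to n b (residual n b f)"
  by (simp add: orthogonal_to_def residual_L2 residual_orthogonal)

text \<open>The residual \<open>r\<close> of an eigenvector for \<open>\<mu>\<close> satisfies \<open>\<langle>T r, r\<rangle> = \<mu> \<parallel>r\<parallel>\<^sup>2\<close>, which exceeds \<open>\<delta> \<parallel>r\<parallel>\<^sup>2\<close> unless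
  \<open>r = 0\<close>. So the eigenvector lies in the span of the family, and self-adjointness removes the
  coefficients belonging to other eigenvalues.\<close>

lemma eigenspace_has_dim:
  assumes fam: "eigenfamily \<delta> n b l" and \<delta>: "0 < \<delta>"
    and max: "\<And>f. orthogonal_to n b f \<Longrightarrow> nsq (A f) \<le> \<delta> * nsq f" and \<mu>: "\<delta> < \<mu>"
  shows "has_dim {f \<in> L2. AE x in lebesgue. T f x = of_real \<mu> * f x} (card {i. i < n \<and> l i = \<mu>})"
proof -
  let ?I = "{i. i < n \<and> l i = \<mu>}"
  let ?V = "{f \<in> L2. AE x in lebesgue. T f x = of_real \<mu> * f x}"
  have on: "orthonormal n b" using fam by (simp add: eigenfamily_def)
  have bL: "i < n \<Longrightarrow> b i \<in> L2" for i using eigenfamilyD[OF fam] by blast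
  obtain h where h: "bij_betw h {..<card ?I} ?I"
    using ex_bij_betw_nat_finite[of ?I] by (auto simp: atLeast0LessThan)
  have hI: "i < card ?I \<Longrightarrow> h i < n \<and> l (h i) = \<mu>" for i using bij_betwE[OF h] by auto
  have hinj: "i < card ?I \<Longrightarrow> j < card ?I \<Longrightarrow> h i = h j \<longleftrightarrow> i = j" for i j
    using bij_betw_imp_inj_on[OF h] by (auto simp: inj_on_def)
  have span: "AE x in lebesgue. f x = (\<Sum>i<card ?I. ip f (b (h i)) * b (h i) x)" if f: "f \<in> ?V" for f
  proof -
    have fL: "f \<in> L2" and fe: "AE x in lebesgue. T f x = of_real \<mu> * f x" using f by auto
    let ?r = "residual n b f" and ?s = "\<lambda>x. \<Sum>i<n. ip f (b i) * b i x"
    have r: "?r \<in> L2" by (rule residual_L2[OF on fL])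
    have s: "?s \<in> L2" using bL by (intro L2_sum L2_scale) auto
    have "ip (T ?s) ?r = ip ?s (T ?r)" by (rule T_selfadjoint[OF s r])
    also have "\<dots> = (\<Sum>i<n. ip f (b i) * ip (b i) (T ?r))"
      using bL T_L2[OF r] by (subst ip_sum_left) (auto simp: L2_scale ip_scale_left)
    also have "\<dots> = 0"
    proof (rule sum.neutral, rule ballI)
      fix i assume "i \<in> {..<n}"
      then have "ip (T ?r) (b i) = 0"
        using orthogonal_to_T[OF fam residual_orthogonal_to[OF on fL]] by (simp add: orthogonal_to_def)
      then show "ip f (b i) * ip (b i) (T ?r) = 0" by (subst (2) ip_commute) simp
    qed
    finally have 0: "ip (T ?s) ?r = 0" .
    have "of_real (nsq (A ?r)) = ip (T ?r) ?r" by (simp add: ip_T_self[OF r])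
    also have "T ?r = (\<lambda>x. T f x - T ?s x)" unfolding residual_def by (rule T_diff[OF fL s])
    also have "ip (\<lambda>x. T f x - T ?s x) ?r = ip (T f) ?r"
      using 0 by (subst ip_diff_left) (auto intro: T_L2 fL s r)
    also have "\<dots> = ip (\<lambda>x. of_real \<mu> * f x) ?r"
      by (rule ip_cong_AE) (use fe fL r T_L2 L2_scale in auto)
    also have "\<dots> = of_real \<mu> * of_real (nsq ?r)"
      using nsq_residual(2)[OF on fL] by (simp add: ip_scale_left ip_commute[of f ?r])
    finally have "complex_of_real (nsq (A ?r)) = of_real (\<mu> * nsq ?r)" by simp
    then have "nsq (A ?r) = \<mu> * nsq ?r" by (simp only: of_real_eq_iff)
    then have "(\<mu> - \<delta>) * nsq ?r \<le> 0"
      using max[OF residual_orthogonal_to[OF on fL]] by (simp add: algebra_simps)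
    then have "nsq ?r = 0" using \<mu> nsq_nonneg[of ?r] by (simp add: mult_le_0_iff)
    then have ae: "AE x in lebesgue. ?r x = 0" using nsq_eq_0_iff[OF r] by simp
    have z: "ip f (b i) = 0" if "i < n" "l i \<noteq> \<mu>" for i
    proof -
      have "ip (T f) (b i) = of_real (l i) * ip f (b i)"
        using eigenfamilyD[OF fam that(1)] by (intro ip_eigenvector fL)
      moreover have "ip (T f) (b i) = ip (\<lambda>x. of_real \<mu> * f x) (b i)"
        by (rule ip_cong_AE) (use fe fL bL[OF that(1)] T_L2 L2_scale in auto)
      ultimately show ?thesis using that(2) by (simp add: ip_scale_left)
    qed
    have "?s x = (\<Sum>i<card ?I. ip f (b (h i)) * b (h i) x)" for x
    proof -
      have "?s x = (\<Sum>i\<in>?I. ip f (b i) * b i x)"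
        using z by (intro sum.mono_neutral_right) auto
      also have "\<dots> = (\<Sum>i<card ?I. ip f (b (h i)) * b (h i) x)"
        by (rule sum.reindex_bij_betw[OF h, symmetric])
      finally show ?thesis .
    qed
    with ae show ?thesis by (auto simp: residual_def elim!: eventually_mono)
  qed
  have ind: "c j = 0" if "AE x in lebesgue. (\<Sum>i<card ?I. c i * b (h i) x) = 0" "j < card ?I" for c j
  proof -
    have on': "orthonormal (card ?I) (\<lambda>i. b (h i))"
      using on hI hinj by (auto simp: orthonormal_def)
    have "c j = ip (\<lambda>x. \<Sum>i<card ?I. c i * b (h i) x) (b (h j))"
      using orthonormal_sum_ip[OF on' that(2), of c] by simp
    also have "\<dots> = ip (\<lambda>x. 0) (b (h j))"
      using that hI bL by (intro ip_cong_AE L2_sum L2_scale L2_zero) auto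
    finally show ?thesis by (simp add: ip_def)
  qed
  show ?thesis unfolding has_dim_def
  proof (intro exI[of _ "\<lambda>i. b (h i)"] conjI allI impI ballI)
    fix i assume "i < card ?I"
    then show "b (h i) \<in> ?V" using hI[of i] eigenfamilyD[OF fam, of "h i"] by auto
  next
    fix f assume "f \<in> ?V"
    from span[OF this] show "\<exists>c. AE x in lebesgue. f x = (\<Sum>i<card ?I. c i * b (h i) x)"
      by (rule exI[of _ "\<lambda>i. ip f (b (h i))"])
  qed (use ind in blast)
qed

text \<open>The squared eigenvalues above \<open>\<delta>\<close> exhaust the Hilbert--Schmidt norm up to a multiple of \<open>\<delta>\<close>:
  the residual \<open>r\<close> of a section \<open>K x\<close> has \<open>\<parallel>r\<parallel>\<^sup>2 = (T r) x\<close>, and \<open>T\<close> is small on the complement.\<close>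

lemma Hilbert_Schmidt_le:
  assumes fam: "eigenfamily \<delta> n b l" and \<delta>: "0 < \<delta>"
    and max: "\<And>f. orthogonal_to n b f \<Longrightarrow> nsq (A f) \<le> \<delta> * nsq f"
  shows "(\<integral>\<^sup>+x. ennreal (nsq (K x)) \<partial>lebesgue) \<le>
    ennreal ((\<Sum>i<n. (l i)\<^sup>2) + \<delta> * ((fourier_norm DIM('a))\<^sup>2 * measure lebesgue E * measure lebesgue S))"
proof -
  let ?c2 = "(fourier_norm DIM('a))\<^sup>2"
  have on: "orthonormal n b" using fam by (simp add: eigenfamily_def)
  have bL: "i < n \<Longrightarrow> b i \<in> L2" for i using eigenfamilyD[OF fam] by blast
  have pt: "nsq (K x) \<le> (\<Sum>i<n. (cmod (T (b i) x))\<^sup>2) + \<delta> * ?c2 * measure lebesgue S * indicator E x" for x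
  proof (cases "x \<in> E")
    case False
    then show ?thesis by (simp add: nsq_def K_def sum_nonneg)
  next
    case True
    let ?r = "residual n b (K x)"
    have r: "?r \<in> L2" by (rule residual_L2[OF on K_L2])
    have "(nsq ?r)\<^sup>2 = (cmod (T ?r x))\<^sup>2"
      unfolding T_eq_ip_K[OF r] nsq_residual(2)[OF on K_L2] by simp
    also have "\<dots> \<le> ?c2 * measure lebesgue S * nsq (A ?r)" by (rule T_pointwise_bound[OF r])
    also have "\<dots> \<le> ?c2 * measure lebesgue S * (\<delta> * nsq ?r)"
      by (intro mult_left_mono max residual_orthogonal_to[OF on K_L2]) auto
    finally have *: "nsq ?r * nsq ?r \<le> (\<delta> * ?c2 * measure lebesgue S) * nsq ?r"
      by (simp add: power2_eq_square mult_ac)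
    have "nsq ?r \<le> \<delta> * ?c2 * measure lebesgue S"
    proof (cases "nsq ?r = 0")
      case False
      then have "0 < nsq ?r" using nsq_nonneg[of ?r] by linarith
      then show ?thesis using * by simp
    qed (use \<delta> in simp)
    moreover have "(\<Sum>i<n. (cmod (ip (K x) (b i)))\<^sup>2) = (\<Sum>i<n. (cmod (T (b i) x))\<^sup>2)"
      by (intro sum.cong refl) (simp add: T_eq_ip_K[OF bL] ip_commute[of "K x"])
    ultimately show ?thesis using nsq_residual(1)[OF on K_L2, of x] True by simp
  qed
  have TL: "i < n \<Longrightarrow> T (b i) \<in> L2" for i using T_L2 bL by blast
  have i1: "integrable lebesgue (\<lambda>x. \<Sum>i<n. (cmod (T (b i) x))\<^sup>2)"
    by (intro Bochner_Integration.integrable_sum L2_integrable_sq TL) simp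
  have i2: "integrable lebesgue (\<lambda>x. \<delta> * ?c2 * measure lebesgue S * indicator E x)"
    using E by (intro integrable_mult_right integrable_real_indicator) (auto simp: fmeasurable_def)
  have "(\<integral>\<^sup>+x. ennreal (nsq (K x)) \<partial>lebesgue) \<le>
     (\<integral>\<^sup>+x. ennreal ((\<Sum>i<n. (cmod (T (b i) x))\<^sup>2) + \<delta> * ?c2 * measure lebesgue S * indicator E x) \<partial>lebesgue)"
    by (intro nn_integral_mono ennreal_leI pt)
  also have "\<dots> = ennreal (LINT x|lebesgue. (\<Sum>i<n. (cmod (T (b i) x))\<^sup>2) + \<delta> * ?c2 * measure lebesgue S * indicator E x)"
    using \<delta> by (intro nn_integral_eq_integral Bochner_Integration.integrable_add i1 i2) (auto intro!: AE_I2 add_nonneg_nonneg sum_nonneg)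
  also have "(LINT x|lebesgue. (\<Sum>i<n. (cmod (T (b i) x))\<^sup>2) + \<delta> * ?c2 * measure lebesgue S * indicator E x) =
     (\<Sum>i<n. nsq (T (b i))) + \<delta> * ?c2 * measure lebesgue S * measure lebesgue E"
  proof -
    have "(LINT x|lebesgue. (\<Sum>i<n. (cmod (T (b i) x))\<^sup>2)) = (\<Sum>i<n. nsq (T (b i)))"
      unfolding nsq_def by (rule Bochner_Integration.integral_sum) (use TL L2_integrable_sq in auto)
    then show ?thesis using i1 i2 Es by simp
  qed
  also have "(\<Sum>i<n. nsq (T (b i))) = (\<Sum>i<n. (l i)\<^sup>2)"
    using nsq_T_A_eigenvector(2)[OF eigenfamilyD(4,1)[OF fam]] eigenfamilyD(2)[OF fam] by (intro sum.cong) auto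
  finally show ?thesis by (simp add: mult_ac)
qed

end

section \<open>Counting eigenvalues\<close>

text \<open>Gaussian elimination: a pivot \<open>p\<close> is used to remove one equation and one unknown.\<close>

lemma homogeneous_system_nontrivial:
  fixes C :: "'j \<Rightarrow> nat \<Rightarrow> complex"
  assumes "finite J" "m < card J"
  shows "\<exists>a. (\<exists>j\<in>J. a j \<noteq> 0) \<and> (\<forall>i<m. (\<Sum>j\<in>J. a j * C j i) = 0)"
  using assms
proof (induction m arbitrary: J C)
  case 0
  then obtain j where "j \<in> J" by fastforce
  then show ?case by (intro exI[of _ "\<lambda>_. 1"]) auto
next
  case (Suc m)
  show ?case
  proof (cases "\<forall>j\<in>J. C j m = 0")
    case True
    obtain a where "\<exists>j\<in>J. a j \<noteq> 0" "\<forall>i<m. (\<Sum>j\<in>J. a j * C j i) = 0"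
      using Suc.IH[of J C] Suc.prems by auto
    then show ?thesis using True by (intro exI[of _ a]) (auto simp: less_Suc_eq)
  next
    case False
    then obtain p where p: "p \<in> J" "C p m \<noteq> 0" by blast
    let ?J = "J - {p}" and ?C = "\<lambda>j i. C j i - C j m / C p m * C p i"
    have "m < card ?J" using Suc.prems p by (simp add: card_Diff_singleton)
    then obtain a where a: "\<exists>j\<in>?J. a j \<noteq> 0" "\<forall>i<m. (\<Sum>j\<in>?J. a j * ?C j i) = 0"
      using Suc.IH[of ?J ?C] Suc.prems by auto
    define a' where "a' j = (if j = p then - (\<Sum>j\<in>?J. a j * C j m) / C p m else a j)" for j
    have "(\<Sum>j\<in>J. a' j * C j i) = (\<Sum>j\<in>?J. a j * ?C j i)" for i
    proof -
      have "(\<Sum>j\<in>J. a' j * C j i) = a' p * C p i + (\<Sum>j\<in>?J. a' j * C j i)"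
        using Suc.prems p by (intro sum.remove) auto
      also have "(\<Sum>j\<in>?J. a' j * C j i) = (\<Sum>j\<in>?J. a j * C j i)"
        by (intro sum.cong) (auto simp: a'_def)
      also have "a' p * C p i = - (\<Sum>j\<in>?J. a j * (C j m / C p m * C p i))"
        by (simp add: a'_def sum_distrib_right sum_divide_distrib mult.assoc)
      finally show ?thesis by (simp add: right_diff_distrib sum_subtractf)
    qed
    moreover have "(\<Sum>j\<in>?J. a j * ?C j m) = 0" using p by simp
    ultimately have "\<forall>i<Suc m. (\<Sum>j\<in>J. a' j * C j i) = 0" using a(2) by (auto simp: less_Suc_eq)
    moreover have "\<exists>j\<in>J. a' j \<noteq> 0" using a(1) by (auto simp: a'_def)
    ultimately show ?thesis by blast
  qed
qed

lemma has_dim_le: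
  assumes "has_dim V n" "has_dim V m"
  shows "n \<le> m"
proof (rule ccontr)
  assume "\<not> n \<le> m"
  then have mn: "m < card {..<n}" by simp
  obtain b where b: "\<forall>i<n. b i \<in> V"
    and ind: "\<forall>c. (AE x in lebesgue. (\<Sum>i<n. c i * b i x) = 0) \<longrightarrow> (\<forall>i<n. c i = 0)"
    using assms(1) unfolding has_dim_def by blast
  obtain d where span: "\<forall>f\<in>V. \<exists>c. AE x in lebesgue. f x = (\<Sum>i<m. c i * d i x)"
    using assms(2) unfolding has_dim_def by blast
  have "\<forall>j\<in>{..<n}. \<exists>c. AE x in lebesgue. b j x = (\<Sum>i<m. c i * d i x)" using span b by blast
  then obtain C where C: "\<forall>j\<in>{..<n}. AE x in lebesgue. b j x = (\<Sum>i<m. C j i * d i x)"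
    by (rule bchoice[THEN exE])
  obtain a where a: "\<exists>j\<in>{..<n}. a j \<noteq> 0" "\<forall>i<m. (\<Sum>j<n. a j * C j i) = 0"
    using homogeneous_system_nontrivial[OF _ mn, of C] by auto
  have "AE x in lebesgue. \<forall>j\<in>{..<n}. b j x = (\<Sum>i<m. C j i * d i x)"
    using C by (intro AE_finite_allI) auto
  then have "AE x in lebesgue. (\<Sum>j<n. a j * b j x) = 0"
  proof eventually_elim
    case (elim x)
    have "(\<Sum>j<n. a j * b j x) = (\<Sum>j<n. \<Sum>i<m. a j * (C j i * d i x))"
      using elim by (intro sum.cong) (auto simp: sum_distrib_left)
    also have "\<dots> = (\<Sum>i<m. (\<Sum>j<n. a j * C j i) * d i x)"
      by (subst sum.swap) (simp add: sum_distrib_right mult.assoc)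
    finally show ?case using a(2) by simp
  qed
  then show False using ind a(1) by blast
qed

lemma has_dim_unique: "has_dim V n \<Longrightarrow> has_dim V m \<Longrightarrow> n = m"
  using has_dim_le antisym by metis

lemma finite_gap_above:
  fixes t :: real
  assumes "finite Z" "\<forall>z\<in>Z. t < z"
  obtains s where "t < s" "\<forall>z\<in>Z. s < z"
proof (cases "Z = {}")
  case True
  then show thesis using that[of "t + 1"] by simp
next
  case False
  then have M: "Min Z \<in> Z" "\<forall>z\<in>Z. Min Z \<le> z" using assms(1) by auto
  then have "t < Min Z" using assms(2) by blast
  then show thesis using M(2) by (intro that[of "(t + Min Z) / 2"]) force+
qed

lemma finite_gap_below:
  fixes \<mu> :: real
  assumes "finite Z" "\<forall>z\<in>Z. z < \<mu>" "m < \<mu>"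
  obtains t where "m \<le> t" "t < \<mu>" "\<forall>z\<in>Z. z \<le> t"
proof (rule that)
  show "Max (insert m Z) < \<mu>" using assms by (subst Max_less_iff) auto
  show "m \<le> Max (insert m Z)" "\<forall>z\<in>Z. z \<le> Max (insert m Z)" using assms(1) by auto
qed

text \<open>Decreasing rearrangement: \<open>ev k\<close> is the least level above which at most \<open>k\<close> values lie, so that
  \<open>ev k > t\<close> iff more than \<open>k\<close> values exceed \<open>t\<close>.\<close>

lemma decreasing_rearrangement:
  fixes v :: "'x \<Rightarrow> real"
  assumes fin: "\<And>t. 0 < t \<Longrightarrow> finite {x \<in> X. t < v x}"
  obtains ev :: "nat \<Rightarrow> real" where "decseq ev" "\<And>k. 0 \<le> ev k" "ev \<longlonglongrightarrow> 0"
    "\<And>\<mu>. 0 < \<mu> \<Longrightarrow> card {k. ev k = \<mu>} = card {x \<in> X. v x = \<mu>}"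
proof -
  define N where "N t = card {x \<in> X. t < v x}" for t
  define L where "L k = {t. 0 < t \<and> N t \<le> k}" for k
  define ev where "ev k = Inf (L k)" for k
  have N_anti: "N t \<le> N s" if "0 < s" "s \<le> t" for s t
    unfolding N_def by (rule card_mono[OF fin[OF that(1)]]) (use that in auto)
  have bdd: "bdd_below (L k)" for k by (rule bdd_belowI[of _ 0]) (auto simp: L_def)
  have "\<exists>t>0. N t = 0"
  proof -
    have f: "finite (v ` {x \<in> X. 1 < v x})" using fin[of 1] by simp
    obtain t where t: "\<And>x. x \<in> X \<Longrightarrow> 1 < v x \<Longrightarrow> v x \<le> t"
      using bdd_above_finite[OF f] by (auto simp: bdd_above_def)
    have "{x \<in> X. max 1 t < v x} = {}" using t by fastforce
    then have "N (max 1 t) = 0" unfolding N_def by (simp only: card.empty)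
    then show ?thesis by (intro exI[of _ "max 1 t"]) auto
  qed
  then obtain t0 where t0: "0 < t0" "N t0 = 0" by blast
  then have ne: "t0 \<in> L k" for k by (simp add: L_def)
  have ev0: "0 \<le> ev k" for k
    unfolding ev_def by (rule cInf_greatest) (use ne in \<open>auto simp: L_def\<close>)
  have key: "t < ev k \<longleftrightarrow> k < N t" if t: "0 < t" for t k
  proof
    assume "t < ev k"
    show "k < N t"
    proof (rule ccontr)
      assume "\<not> k < N t"
      then have "t \<in> L k" using t by (simp add: L_def)
      then have "ev k \<le> t" unfolding ev_def by (rule cInf_lower[OF _ bdd])
      then show False using \<open>t < ev k\<close> by simp
    qed
  next
    assume k: "k < N t"
    let ?Y = "{x \<in> X. t < v x}"
    obtain s where ts: "t < s" and s: "\<forall>z\<in>v ` ?Y. s < z"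
    proof (rule finite_gap_above)
      show "finite (v ` ?Y)" using fin[OF t] by simp
      show "\<forall>z\<in>v ` ?Y. t < z" by auto
    qed
    have "{x \<in> X. s < v x} = ?Y" using ts s by auto
    then have Ns: "N s = N t" by (simp add: N_def)
    have "s \<le> u" if "u \<in> L k" for u
    proof (rule ccontr)
      assume "\<not> s \<le> u"
      then have "N s \<le> N u" using that by (intro N_anti) (auto simp: L_def)
      then show False using that k Ns by (auto simp: L_def)
    qed
    then have "s \<le> ev k" unfolding ev_def using ne by (intro cInf_greatest) auto
    then show "t < ev k" using ts by simp
  qed
  show thesis
  proof (rule that)
    show "decseq ev"
    proof (rule decseq_SucI)
      fix k
      have "L k \<subseteq> L (Suc k)" by (auto simp: L_def)
      then show "ev (Suc k) \<le> ev k" unfolding ev_def using ne bdd by (intro cInf_superset_mono) auto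
    qed
    show "0 \<le> ev k" for k by (rule ev0)
    show "ev \<longlonglongrightarrow> 0"
    proof (rule LIMSEQ_I)
      fix r :: real assume r: "0 < r"
      have "norm (ev k - 0) < r" if "k \<ge> N (r / 2)" for k
        using key[of "r / 2" k] that r ev0[of k] by auto
      then show "\<exists>no. \<forall>k\<ge>no. norm (ev k - 0) < r" by blast
    qed
    fix \<mu> :: real assume \<mu>: "0 < \<mu>"
    let ?Y = "{x \<in> X. \<mu> / 2 < v x \<and> v x < \<mu>}"
    have "finite ?Y"
      by (rule finite_subset[OF _ fin[of "\<mu> / 2"]]) (use \<mu> in auto)
    obtain t where t: "\<mu> / 2 \<le> t" and t\<mu>: "t < \<mu>" and tY: "\<forall>z\<in>v ` ?Y. z \<le> t"
    proof (rule finite_gap_below)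
      show "finite (v ` ?Y)" using \<open>finite ?Y\<close> by simp
      show "\<forall>z\<in>v ` ?Y. z < \<mu>" by auto
      show "\<mu> / 2 < \<mu>" using \<mu> by simp
    qed
    have t0: "0 < t" using t \<mu> by linarith
    have gap: "v x \<le> t \<or> \<mu> \<le> v x" if "x \<in> X" for x
    proof (cases "\<mu> / 2 < v x \<and> v x < \<mu>")
      case True
      then show ?thesis using that tY by auto
    next
      case False
      then show ?thesis using t by linarith
    qed
    have Neq: "N s = N t" if "t \<le> s" "s < \<mu>" for s
    proof -
      have "{x \<in> X. s < v x} = {x \<in> X. t < v x}" using gap that by fastforce
      then show ?thesis by (simp add: N_def)
    qed
    have "{k. ev k = \<mu>} = {N \<mu>..<N t}"
    proof (intro set_eqI iffI)
      fix k assume "k \<in> {k. ev k = \<mu>}"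
      then show "k \<in> {N \<mu>..<N t}" using key[OF t0, of k] key[OF \<mu>, of k] t\<mu> by auto
    next
      fix k assume k: "k \<in> {N \<mu>..<N t}"
      then have "t < ev k" "ev k \<le> \<mu>" using key[OF t0, of k] key[OF \<mu>, of k] by auto
      moreover have "\<not> ev k < \<mu>"
      proof
        assume "ev k < \<mu>"
        then have "N (ev k) = N t" using \<open>t < ev k\<close> by (intro Neq) auto
        then have "ev k < ev k" using key[of "ev k" k] k \<open>t < ev k\<close> t0 by auto
        then show False by simp
      qed
      ultimately show "k \<in> {k. ev k = \<mu>}" by simp
    qed
    then have "card {k. ev k = \<mu>} = N t - N \<mu>" by simp
    also have "N t = N \<mu> + card {x \<in> X. v x = \<mu>}"
    proof -
      have eq: "{x \<in> X. t < v x} = {x \<in> X. \<mu> < v x} \<union> {x \<in> X. v x = \<mu>}"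
      proof (intro set_eqI iffI)
        fix x assume "x \<in> {x \<in> X. t < v x}"
        then have "x \<in> X" "t < v x" by auto
        then have "\<mu> \<le> v x" using gap[of x] by linarith
        then show "x \<in> {x \<in> X. \<mu> < v x} \<union> {x \<in> X. v x = \<mu>}" using \<open>x \<in> X\<close> by auto
      next
        fix x assume "x \<in> {x \<in> X. \<mu> < v x} \<union> {x \<in> X. v x = \<mu>}"
        then show "x \<in> {x \<in> X. t < v x}" using t\<mu> by (auto simp del: Max_less_iff)
      qed
      have "finite {x \<in> X. t < v x}" by (rule fin[OF t0])
      then have "finite {x \<in> X. \<mu> < v x}" "finite {x \<in> X. v x = \<mu>}" unfolding eq by auto
      then show ?thesis unfolding N_def eq by (intro card_Un_disjoint) auto
    qed
    finally show "card {k. ev k = \<mu>} = card {x \<in> X. v x = \<mu>}" by simp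
  qed
qed

text \<open>The eigenvalues above \<open>\<delta>\<close>, listed with multiplicity in any order.\<close>

definition spectral_list ::
    "(('a::euclidean_space \<Rightarrow> complex) \<Rightarrow> 'a \<Rightarrow> complex) \<Rightarrow> real \<Rightarrow> nat \<Rightarrow> (nat \<Rightarrow> real) \<Rightarrow> bool" where
  "spectral_list U \<delta> n l \<longleftrightarrow> (\<forall>i<n. \<delta> < l i) \<and>
     (\<forall>\<mu>>\<delta>. has_dim (eigenspace U \<mu>) (card {i. i < n \<and> l i = \<mu>}))"

text \<open>Rearrange the first components of the pairs \<open>(\<mu>, j)\<close> with \<open>j\<close> smaller than the multiplicity of \<open>\<mu>\<close>. The
  spectral lists guarantee that only finitely many pairs lie above a positive level.\<close>

lemma ex_ordered_eigenvalues:
  assumes ex: "\<And>\<delta>. 0 < \<delta> \<Longrightarrow> \<exists>n l. spectral_list U \<delta> n l"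
  shows "\<exists>ev. ordered_eigenvalues U ev"
proof -
  define m where "m \<mu> = (THE d. has_dim (eigenspace U \<mu>) d)" for \<mu>
  have m: "m \<mu> = d" if "has_dim (eigenspace U \<mu>) d" for \<mu> d
    unfolding m_def by (rule the_equality) (use that has_dim_unique in auto)
  define X where "X = {(\<mu>, j). 0 < \<mu> \<and> j < m \<mu>}"
  have finX: "finite {x \<in> X. t < fst x}" if t: "0 < t" for t
  proof -
    obtain n l where sl: "spectral_list U t n l" using ex[OF t] by blast
    have "{x \<in> X. t < fst x} \<subseteq> Sigma (l ` {..<n}) (\<lambda>\<mu>. {..<m \<mu>})"
    proof
      fix x assume "x \<in> {x \<in> X. t < fst x}"
      then obtain \<mu> j where x: "x = (\<mu>, j)" "t < \<mu>" "j < m \<mu>" by (auto simp: X_def)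
      then have "m \<mu> = card {i. i < n \<and> l i = \<mu>}" using sl by (intro m) (auto simp: spectral_list_def)
      then have "0 < card {i. i < n \<and> l i = \<mu>}" using x(3) by linarith
      then have "{i. i < n \<and> l i = \<mu>} \<noteq> {}" unfolding card_gt_0_iff by (rule conjunct1)
      then show "x \<in> Sigma (l ` {..<n}) (\<lambda>\<mu>. {..<m \<mu>})" using x by auto
    qed
    then show ?thesis by (rule finite_subset) auto
  qed
  obtain ev where ev: "decseq ev" "\<And>k. 0 \<le> ev k" "ev \<longlonglongrightarrow> 0"
    and card_ev: "\<And>\<mu>. 0 < \<mu> \<Longrightarrow> card {k::nat. ev k = \<mu>} = card {x \<in> X. fst x = \<mu>}"
    by (rule decreasing_rearrangement[of X fst], erule finX) (rule that)
  have "has_dim (eigenspace U \<mu>) (card {k. ev k = \<mu>})" if \<mu>: "0 < \<mu>" for \<mu>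
  proof -
    obtain n l where sl: "spectral_list U (\<mu> / 2) n l" using ex[of "\<mu> / 2"] \<mu> by auto
    then have d: "has_dim (eigenspace U \<mu>) (card {i. i < n \<and> l i = \<mu>})"
      using \<mu> by (auto simp: spectral_list_def)
    have "{x \<in> X. fst x = \<mu>} = {\<mu>} \<times> {..<m \<mu>}" using \<mu> by (auto simp: X_def)
    then have "card {k. ev k = \<mu>} = m \<mu>" using card_ev[OF \<mu>] by (simp add: card_cartesian_product)
    then show ?thesis using d m[OF d] by simp
  qed
  with ev show ?thesis unfolding ordered_eigenvalues_def by blast
qed

lemma card_level_set_fibres:
  assumes "finite {k. P k}"
  shows "card {k. P k} = (\<Sum>\<mu>\<in>f ` {k. P k}. card {k. P k \<and> f k = \<mu>})"
proof -
  have "card {k. P k} = (\<Sum>\<mu>\<in>f ` {k. P k}. sum (\<lambda>_. 1) {k \<in> {k. P k}. f k = \<mu>})"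
    unfolding card_eq_sum by (rule sum.group[symmetric]) (use assms in auto)
  then show ?thesis by simp
qed

text \<open>Both numbers are the sum of the dimensions of the eigenspaces above \<open>\<epsilon>\<close>, so it does not matter which
  sequence of ordered eigenvalues is taken.\<close>

lemma card_ordered_eigenvalues:
  assumes ev: "ordered_eigenvalues U ev" and sl: "spectral_list U \<delta> n l" and \<delta>: "0 < \<delta>" "\<delta> \<le> \<epsilon>"
  shows "card {k. ev k > \<epsilon>} = card {i. i < n \<and> \<epsilon> < l i}"
proof -
  have \<epsilon>: "0 < \<epsilon>" using \<delta> by simp
  have fin1: "finite {k. \<epsilon> < ev k}"
  proof -
    have lim: "ev \<longlonglongrightarrow> 0" using ev by (simp add: ordered_eigenvalues_def)
    have "\<forall>\<^sub>F k in sequentially. ev k < \<epsilon>" by (rule order_tendstoD(2)[OF lim \<epsilon>])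
    then obtain n0 where "\<forall>k\<ge>n0. ev k < \<epsilon>" unfolding eventually_sequentially by blast
    then have "{k. \<epsilon> < ev k} \<subseteq> {..<n0}" by (force simp: not_less[symmetric])
    then show ?thesis by (rule finite_subset) simp
  qed
  have fin2: "finite {i. i < n \<and> \<epsilon> < l i}" by simp
  have eq: "card {k. ev k = \<mu>} = card {i. i < n \<and> l i = \<mu>}" if "\<epsilon> < \<mu>" for \<mu>
    by (rule has_dim_unique[of "eigenspace U \<mu>"])
       (use ev sl that \<delta> \<epsilon> in \<open>auto simp: ordered_eigenvalues_def spectral_list_def\<close>)
  let ?f1 = "\<lambda>\<mu>. card {k. \<epsilon> < ev k \<and> ev k = \<mu>}" and ?f2 = "\<lambda>\<mu>. card {i. (i < n \<and> \<epsilon> < l i) \<and> l i = \<mu>}"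
  have f12: "?f1 \<mu> = ?f2 \<mu>" for \<mu>
  proof (cases "\<epsilon> < \<mu>")
    case True
    then have "{k. \<epsilon> < ev k \<and> ev k = \<mu>} = {k. ev k = \<mu>}" "{i. (i < n \<and> \<epsilon> < l i) \<and> l i = \<mu>} = {i. i < n \<and> l i = \<mu>}"
      by auto
    then show ?thesis using eq[OF True] by simp
  next
    case False
    then have e: "{k. \<epsilon> < ev k \<and> ev k = \<mu>} = {}" "{i. (i < n \<and> \<epsilon> < l i) \<and> l i = \<mu>} = {}" by auto
    show ?thesis unfolding e by simp
  qed
  let ?M1 = "ev ` {k. \<epsilon> < ev k}" and ?M2 = "l ` {i. i < n \<and> \<epsilon> < l i}"
  have z1: "?f1 \<mu> = 0" if "\<mu> \<notin> ?M1" for \<mu>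
  proof -
    have e: "{k. \<epsilon> < ev k \<and> ev k = \<mu>} = {}" using that by auto
    show ?thesis unfolding e by simp
  qed
  have z2: "?f2 \<mu> = 0" if "\<mu> \<notin> ?M2" for \<mu>
  proof -
    have e: "{i. (i < n \<and> \<epsilon> < l i) \<and> l i = \<mu>} = {}" using that by auto
    show ?thesis unfolding e by simp
  qed
  have "card {k. \<epsilon> < ev k} = sum ?f1 ?M1" by (rule card_level_set_fibres[OF fin1])
  also have "\<dots> = sum ?f1 (?M1 \<union> ?M2)"
    by (rule sum.mono_neutral_left) (use fin1 fin2 z1 in auto)
  also have "\<dots> = sum ?f2 (?M1 \<union> ?M2)" by (simp only: f12)
  also have "\<dots> = sum ?f2 ?M2"
    by (rule sum.mono_neutral_right) (use fin1 fin2 z2 in auto)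
  also have "\<dots> = card {i. i < n \<and> \<epsilon> < l i}" by (rule card_level_set_fibres[OF fin2, symmetric])
  finally show ?thesis .
qed

text \<open>Termwise: if \<open>x > \<epsilon>\<close> then \<open>x / (\<epsilon> (1 - \<epsilon>)) \<ge> 1\<close>, and if \<open>x \<le> \<epsilon>\<close> then \<open>(1 - x) / (\<epsilon> (1 - \<epsilon>)) \<ge> 1\<close>.\<close>

lemma count_minus_sum_le:
  fixes l :: "nat \<Rightarrow> real"
  assumes l: "\<And>i. i < n \<Longrightarrow> 0 \<le> l i" "\<And>i. i < n \<Longrightarrow> l i \<le> 1" and \<epsilon>: "0 < \<epsilon>" "\<epsilon> < 1"
  shows "\<bar>real (card {i. i < n \<and> \<epsilon> < l i}) - (\<Sum>i<n. l i)\<bar> \<le> ((\<Sum>i<n. l i) - (\<Sum>i<n. (l i)\<^sup>2)) / (\<epsilon> * (1 - \<epsilon>))"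
proof -
  have pt: "\<bar>(if \<epsilon> < x then 1 else 0) - x\<bar> \<le> (x - x\<^sup>2) / (\<epsilon> * (1 - \<epsilon>))" if x: "0 \<le> x" "x \<le> 1" for x :: real
  proof (cases "\<epsilon> < x")
    case True
    have "\<epsilon> * (1 - \<epsilon>) \<le> \<epsilon> * 1" using \<epsilon> by (intro mult_left_mono) auto
    then have "\<epsilon> * (1 - \<epsilon>) \<le> x" using True by simp
    then have "(1 - x) * (\<epsilon> * (1 - \<epsilon>)) \<le> (1 - x) * x" using x by (intro mult_left_mono) auto
    then have "(1 - x) * (\<epsilon> * (1 - \<epsilon>)) \<le> x - x\<^sup>2" by (simp add: algebra_simps power2_eq_square)
    then have "1 - x \<le> (x - x\<^sup>2) / (\<epsilon> * (1 - \<epsilon>))" using \<epsilon> by (subst pos_le_divide_eq) auto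
    then show ?thesis using True x by simp
  next
    case False
    have "\<epsilon> * (1 - \<epsilon>) \<le> 1 * (1 - \<epsilon>)" using \<epsilon> by (intro mult_right_mono) auto
    then have "\<epsilon> * (1 - \<epsilon>) \<le> 1 - x" using False by simp
    then have "x * (\<epsilon> * (1 - \<epsilon>)) \<le> x * (1 - x)" using x by (intro mult_left_mono) auto
    then have "x * (\<epsilon> * (1 - \<epsilon>)) \<le> x - x\<^sup>2" by (simp add: algebra_simps power2_eq_square)
    then have "x \<le> (x - x\<^sup>2) / (\<epsilon> * (1 - \<epsilon>))" using \<epsilon> by (subst pos_le_divide_eq) auto
    then show ?thesis using False x by simp
  qed
  have "real (card {i. i < n \<and> \<epsilon> < l i}) = (\<Sum>i<n. if \<epsilon> < l i then 1 else 0)"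
    by (simp add: sum.If_cases Int_def)
  then have "\<bar>real (card {i. i < n \<and> \<epsilon> < l i}) - (\<Sum>i<n. l i)\<bar> = \<bar>\<Sum>i<n. (if \<epsilon> < l i then 1 else 0) - l i\<bar>"
    by (simp add: sum_subtractf)
  also have "\<dots> \<le> (\<Sum>i<n. \<bar>(if \<epsilon> < l i then 1 else 0) - l i\<bar>)" by (rule sum_abs)
  also have "\<dots> \<le> (\<Sum>i<n. (l i - (l i)\<^sup>2) / (\<epsilon> * (1 - \<epsilon>)))"
    using pt l by (intro sum_mono) auto
  finally show ?thesis by (simp add: sum_divide_distrib[symmetric] sum_subtractf)
qed

text \<open>Here \<open>H\<close> is the squared Hilbert--Schmidt norm of \<open>A\<close> and \<open>Q\<close> a lower bound for that of \<open>T\<close>. The factor \<open>2\<close>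
  saves the trace identity: for the eigenvalues \<open>l\<close> above \<open>\<delta>\<close>, Bessel's inequality gives \<open>\<Sum>l \<le> H\<close>, while
  \<open>\<Sum>l \<ge> \<Sum>l\<^sup>2\<close> is at least \<open>Q\<close> up to \<open>\<delta> H\<close>. So \<open>\<Sum>l - \<Sum>l\<^sup>2\<close> and \<open>H - \<Sum>l\<close> are both at most \<open>H - Q + \<delta> H\<close>.\<close>

theorem eigenvalue_count_bound:
  fixes F S :: "'a::euclidean_space set" and R :: real
  defines "E \<equiv> (\<lambda>x. R *\<^sub>R x) ` F"
  defines "H \<equiv> (fourier_norm DIM('a))\<^sup>2 * measure lebesgue E * measure lebesgue S"
  assumes fm: "finite_measure_sets E S"
    and Q: "0 \<le> Q" "ennreal Q \<le> (\<integral>\<^sup>+x. ennreal (nsq (finite_measure_sets.K E S x)) \<partial>lebesgue)"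
    and \<epsilon>: "0 < \<epsilon>" "\<epsilon> < 1"
  shows "\<bar>real (eigenvalue_count F S \<epsilon> R) - H\<bar> \<le> 2 * (H - Q) / (\<epsilon> * (1 - \<epsilon>))"
proof -
  interpret finite_measure_sets E S by (rule fm)
  let ?U = "limiting_op F S R"
  have AE_T: "AE x in lebesgue. ?U f x = T f x" if "f \<in> L2" for f
    using limiting_op_AE[of R F S f] that fm by (simp add: E_def)
  have eig: "eigenspace ?U \<mu> = {f \<in> L2. AE x in lebesgue. T f x = of_real \<mu> * f x}" for \<mu>
  proof -
    have eq: "(AE x in lebesgue. ?U f x = of_real \<mu> * f x) \<longleftrightarrow> (AE x in lebesgue. T f x = of_real \<mu> * f x)" if "f \<in> L2" for f
      by (rule eventually_subst) (use AE_T[OF that] in \<open>eventually_elim, auto\<close>)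
    show ?thesis unfolding eigenspace_def by (rule Collect_cong, rule conj_cong[OF refl], rule eq)
  qed
  have fams: "\<exists>n b l. eigenfamily \<delta> n b l \<and> (\<forall>f. orthogonal_to n b f \<longrightarrow> nsq (A f) \<le> \<delta> * nsq f)" if "0 < \<delta>" for \<delta>
    using ex_maximal_eigenfamily[OF that] by metis
  have sl: "spectral_list ?U \<delta> n l"
    if "eigenfamily \<delta> n b l" "\<forall>f. orthogonal_to n b f \<longrightarrow> nsq (A f) \<le> \<delta> * nsq f" "0 < \<delta>" for \<delta> n b l
    unfolding spectral_list_def eig using eigenspace_has_dim[OF that(1,3)] that(2) eigenfamilyD(3)[OF that(1)] by blast
  have "\<exists>n l. spectral_list ?U \<delta> n l" if "0 < \<delta>" for \<delta> using fams[OF that] sl that by blast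
  then have "\<exists>ev. ordered_eigenvalues ?U ev" by (rule ex_ordered_eigenvalues)
  then have ev: "ordered_eigenvalues ?U (eigenvalue_seq ?U)"
    unfolding eigenvalue_seq_def by (rule someI_ex)
  let ?N = "real (eigenvalue_count F S \<epsilon> R)" and ?e = "\<epsilon> * (1 - \<epsilon>)"
  have e: "0 < ?e" "?e \<le> 1" using \<epsilon> by (auto simp: mult_le_one)
  have H0: "0 \<le> H" unfolding H_def by simp
  have approx: "\<bar>?N - H\<bar> * ?e \<le> 2 * (H - Q + \<delta> * H)" if \<delta>: "0 < \<delta>" "\<delta> \<le> \<epsilon>" for \<delta>
  proof -
    obtain n b l where fam: "eigenfamily \<delta> n b l" and mx: "\<forall>f. orthogonal_to n b f \<longrightarrow> nsq (A f) \<le> \<delta> * nsq f"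
      using fams[OF \<delta>(1)] by blast
    define t where "t = (\<Sum>i<n. l i)"
    define q where "q = (\<Sum>i<n. (l i)\<^sup>2)"
    have N: "?N = real (card {i. i < n \<and> \<epsilon> < l i})"
      unfolding eigenvalue_count_def using card_ordered_eigenvalues[OF ev sl[OF fam mx \<delta>(1)] \<delta>] by simp
    have l: "i < n \<Longrightarrow> 0 \<le> l i" "i < n \<Longrightarrow> l i \<le> 1" for i
      using eigenfamilyD(3)[OF fam, of i] eigenfamily_le_1[OF fam, of i] \<delta> by auto
    have Nt: "\<bar>?N - t\<bar> * ?e \<le> t - q"
      using count_minus_sum_le[of n l \<epsilon>, OF l \<epsilon>] e(1) unfolding N t_def q_def by (simp add: pos_le_divide_eq)
    have tH: "t \<le> H" unfolding t_def H_def by (rule eigenfamily_sum_le[OF fam])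
    have qt: "q \<le> t" unfolding q_def t_def
      using l by (intro sum_mono) (simp add: power2_eq_square mult_left_le)
    have "ennreal Q \<le> ennreal (q + \<delta> * H)"
      using Q(2) Hilbert_Schmidt_le[OF fam \<delta>(1)] mx unfolding q_def H_def by (meson order_trans)
    moreover have "0 \<le> q + \<delta> * H" using \<delta> H0 by (simp add: q_def sum_nonneg)
    ultimately have Qq: "Q \<le> q + \<delta> * H" by simp
    have "\<bar>?N - H\<bar> * ?e \<le> (\<bar>?N - t\<bar> + (H - t)) * ?e" using tH e by (intro mult_right_mono) auto
    also have "\<dots> \<le> (t - q) + (H - t) * 1"
      unfolding distrib_right using Nt e tH by (intro add_mono mult_left_mono) auto
    also have "\<dots> = H - q" by simp
    also have "H - q \<le> 2 * (H - Q + \<delta> * H)"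
    proof -
      define X where "X = H - Q + \<delta> * H"
      have "H - q \<le> X" "0 \<le> H - q" using Qq qt tH by (simp_all add: X_def)
      then show ?thesis unfolding X_def[symmetric] by linarith
    qed
    finally show ?thesis .
  qed
  have "\<bar>?N - H\<bar> * ?e \<le> 2 * (H - Q)"
  proof (rule field_le_epsilon)
    fix d :: real assume d: "0 < d"
    \<comment> \<open>\<open>H + 1\<close> instead of \<open>H\<close> avoids a division by zero.\<close>
    define \<delta> where "\<delta> = min \<epsilon> (d / (2 * (H + 1)))"
    have "0 < \<delta>" "\<delta> \<le> \<epsilon>" using \<epsilon> d H0 by (auto simp: \<delta>_def)
    then have "\<bar>?N - H\<bar> * ?e \<le> 2 * (H - Q) + 2 * (\<delta> * H)" using approx[of \<delta>] by (simp add: algebra_simps)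
    also have "\<delta> * H \<le> d / (2 * (H + 1)) * (H + 1)"
      using H0 d by (intro mult_mono) (auto simp: \<delta>_def)
    also have "\<dots> = d / 2" using H0 by (simp add: field_simps)
    finally show "\<bar>?N - H\<bar> * ?e \<le> 2 * (H - Q) + d" by simp
  qed
  then show ?thesis using e(1) by (simp add: pos_le_divide_eq)
qed

section \<open>Perimeters and overlaps\<close>

lemma lmeasurable_sym_diff_translate:
  assumes "U \<in> lmeasurable"
  shows "sym_diff U ((\<lambda>x. x - h) ` U) \<in> lmeasurable"
  using assms measurable_translation_subtract[OF assms, of h] by (intro fmeasurable.Un fmeasurable.Diff) auto

lemma measure_sym_diff_le_Per:
  fixes U :: "'a::euclidean_space set"
  assumes U: "U \<in> lmeasurable" and Per: "Per \<gamma> U < \<infinity>"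
  shows "measure lebesgue (sym_diff U ((\<lambda>x. x - h) ` U)) \<le> enn2real (Per \<gamma> U) * norm h powr \<gamma>"
proof (cases "h = 0")
  case False
  let ?D = "sym_diff U ((\<lambda>x. x - h) ` U)" and ?c = "norm h powr \<gamma>"
  have c: "0 < ?c" using False by simp
  have "emeasure lebesgue ?D / ennreal ?c \<le> Per \<gamma> U"
    unfolding Per_def by (rule SUP_upper) (use False in simp)
  moreover have "emeasure lebesgue ?D = ennreal (measure lebesgue ?D)"
    using lmeasurable_sym_diff_translate[OF U] by (simp add: emeasure_eq_measure2 fmeasurableD2)
  moreover have "Per \<gamma> U = ennreal (enn2real (Per \<gamma> U))" using Per by simp
  ultimately have "ennreal (measure lebesgue ?D / ?c) \<le> ennreal (enn2real (Per \<gamma> U))"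
    using divide_ennreal[OF measure_nonneg c] by metis
  then have "measure lebesgue ?D / ?c \<le> enn2real (Per \<gamma> U)" by simp
  then show ?thesis using c by (simp add: pos_divide_le_eq)
qed simp

lemma overlap_deficit_le_Per:
  fixes U :: "'a::euclidean_space set"
  assumes U: "U \<in> lmeasurable" and Per: "Per \<gamma> U < \<infinity>"
  shows "measure lebesgue U - measure lebesgue (overlap U z) \<le> enn2real (Per \<gamma> U) * norm z powr \<gamma>"
proof -
  have o: "overlap U z \<in> lmeasurable" by (rule overlap_lmeasurable[OF U])
  have "measure lebesgue U - measure lebesgue (overlap U z) = measure lebesgue (U - overlap U z)"
    by (rule measurable_measure_Diff[symmetric]) (use U o in \<open>auto simp: fmeasurableD overlap_def\<close>)
  also have "\<dots> \<le> measure lebesgue (sym_diff U ((\<lambda>x. x - (- z)) ` U))"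
  proof (rule measure_mono_fmeasurable)
    show "U - overlap U z \<subseteq> sym_diff U ((\<lambda>x. x - (- z)) ` U)" by (auto simp: overlap_def)
    show "U - overlap U z \<in> sets lebesgue" using U o by auto
  qed (rule lmeasurable_sym_diff_translate[OF U])
  also have "\<dots> \<le> enn2real (Per \<gamma> U) * norm (- z) powr \<gamma>" by (rule measure_sym_diff_le_Per[OF U Per])
  finally show ?thesis by simp
qed

lemma lmeasurable_scaled:
  fixes F :: "'a::euclidean_space set"
  assumes "F \<in> lmeasurable" "0 < R"
  shows "(\<lambda>x. R *\<^sub>R x) ` F \<in> lmeasurable" "measure lebesgue ((\<lambda>x. R *\<^sub>R x) ` F) = R ^ DIM('a) * measure lebesgue F"
proof -
  show "(\<lambda>x. R *\<^sub>R x) ` F \<in> lmeasurable"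
  proof (rule fmeasurableI)
    have "(\<lambda>x. R *\<^sub>R x) ` F = (*\<^sub>R) (1 / R) -` F \<inter> space lebesgue"
      using assms(2) by (force simp: image_iff)
    also have "\<dots> \<in> sets lebesgue"
      by (rule measurable_sets[OF lebesgue_measurable_scaling]) (use assms(1) in auto)
    finally show "(\<lambda>x. R *\<^sub>R x) ` F \<in> sets lebesgue" .
    show "emeasure lebesgue ((\<lambda>x. R *\<^sub>R x) ` F) < \<infinity>"
      using emeasure_lebesgue_affine[of R 0 F] assms by (auto simp: fmeasurable_def ennreal_mult_less_top)
  qed
  show "measure lebesgue ((\<lambda>x. R *\<^sub>R x) ` F) = R ^ DIM('a) * measure lebesgue F"
    using measure_lebesgue_affine[of R 0 F] assms by simp
qed

lemma overlap_scaled: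
  assumes "0 < R"
  shows "overlap ((\<lambda>x. R *\<^sub>R x) ` F) z = (\<lambda>x. R *\<^sub>R x) ` overlap F (z /\<^sub>R R)"
proof (intro set_eqI iffI)
  fix x assume "x \<in> overlap ((\<lambda>x. R *\<^sub>R x) ` F) z"
  then obtain y y' where y: "x = R *\<^sub>R y" "y \<in> F" "x - z = R *\<^sub>R y'" "y' \<in> F" by (auto simp: overlap_def)
  have "R *\<^sub>R y' = R *\<^sub>R (y - z /\<^sub>R R)" using y assms by (simp add: scaleR_diff_right)
  then have "y' = y - z /\<^sub>R R" using assms by (simp only: scaleR_cancel_left) simp
  then show "x \<in> (\<lambda>x. R *\<^sub>R x) ` overlap F (z /\<^sub>R R)" using y by (auto simp: overlap_def)
next
  fix x assume "x \<in> (\<lambda>x. R *\<^sub>R x) ` overlap F (z /\<^sub>R R)"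
  then obtain y where y: "x = R *\<^sub>R y" "y \<in> F" "y - z /\<^sub>R R \<in> F" by (auto simp: overlap_def)
  have "x - z = R *\<^sub>R (y - z /\<^sub>R R)" using y assms by (simp add: scaleR_diff_right)
  then show "x \<in> overlap ((\<lambda>x. R *\<^sub>R x) ` F) z" using y by (auto simp: overlap_def)
qed

text \<open>The perimeter gives the power of \<open>\<bar>z\<bar> / R\<close>, and the measure of \<open>F\<close> alone gives the bound \<open>1\<close>; adding the two
  constants serves both cases.\<close>

lemma overlap_deficit_scaled:
  fixes F :: "'a::euclidean_space set"
  assumes F: "F \<in> lmeasurable" and Per: "Per \<gamma> F < \<infinity>" and R: "0 < R"
  defines "E \<equiv> (\<lambda>x. R *\<^sub>R x) ` F"
  shows "measure lebesgue E - measure lebesgue (overlap E z) \<le>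
     R ^ DIM('a) * (measure lebesgue F + enn2real (Per \<gamma> F)) * min 1 ((norm z / R) powr \<gamma>)"
proof -
  let ?p = "enn2real (Per \<gamma> F)" and ?u = "(norm z / R) powr \<gamma>"
  let ?d = "measure lebesgue F - measure lebesgue (overlap F (z /\<^sub>R R))"
  have "measure lebesgue E - measure lebesgue (overlap E z) = R ^ DIM('a) * ?d"
    unfolding E_def overlap_scaled[OF R]
    using lmeasurable_scaled(2)[OF F R] lmeasurable_scaled(2)[OF overlap_lmeasurable[OF F] R]
    by (simp add: right_diff_distrib)
  also have "?d \<le> (measure lebesgue F + ?p) * min 1 ?u"
  proof -
    have "?d \<le> ?p * ?u" using overlap_deficit_le_Per[OF F Per, of "z /\<^sub>R R"] R by (simp add: divide_inverse mult.commute)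
    also have "\<dots> \<le> (measure lebesgue F + ?p) * ?u" by (intro mult_right_mono) auto
    finally have "?d \<le> (measure lebesgue F + ?p) * ?u" .
    moreover have "?d \<le> measure lebesgue F + ?p"
      using measure_nonneg[of lebesgue "overlap F (z /\<^sub>R R)"] enn2real_nonneg[of "Per \<gamma> F"] by linarith
    ultimately show ?thesis by (auto simp: min_def)
  qed
  finally show ?thesis using R by (simp add: mult.assoc)
qed

section \<open>Decay of the transform of an indicator function\<close>

lemma inv_fourier_integral_translate:
  fixes S :: "'a::euclidean_space set"
  assumes S: "S \<in> lmeasurable"
  shows "inv_fourier_integral (indicator ((\<lambda>x. x - h) ` S)) z = cis (h \<bullet> z) * inv_fourier_integral (indicator S) z"
proof -
  let ?g = "\<lambda>y. indicator S y * cis ((y - h) \<bullet> (- z))"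
  have m: "?g \<in> borel_measurable lebesgue"
  proof (intro borel_measurable_times)
    show "(\<lambda>y. cis ((y - h) \<bullet> (- z))) \<in> borel_measurable lebesgue"
      by (rule lebesgue_measurable_borel, rule cis_inner_measurable) measurable
  qed (use S in auto)
  have mem: "x \<in> (\<lambda>x. x - h) ` S \<longleftrightarrow> h + x \<in> S" for x by (force simp: image_iff)
  have "(LINT x|lebesgue. indicator ((\<lambda>x. x - h) ` S) x * cis (x \<bullet> (- z))) = (LINT x|lebesgue. ?g (h + 1 *\<^sub>R x))"
    by (intro Bochner_Integration.integral_cong refl) (auto simp: indicator_def mem)
  also have "\<dots> = (LINT x|lebesgue. ?g x)" by (rule integral_lebesgue_isometry(1)[OF _ m]) simp
  also have "\<dots> = (LINT x|lebesgue. cis (h \<bullet> z) * (indicator S x * cis (x \<bullet> (- z))))"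
    by (intro Bochner_Integration.integral_cong refl) (auto simp: indicator_def inner_diff_left cis_mult)
  finally show ?thesis
    unfolding inv_fourier_integral_reflect fourier_integral_cis by simp
qed

text \<open>Apply Plancherel's inequality to the difference of the indicator functions of \<open>S\<close> and of its translate.\<close>

lemma nsq_modulation_le:
  fixes S :: "'a::euclidean_space set"
  assumes S: "S \<in> lmeasurable"
  defines "\<kappa> \<equiv> inv_fourier_integral (indicator S)"
  shows "(\<lambda>z. \<kappa> z * (1 - cis (h \<bullet> z))) \<in> L2"
    and "nsq (\<lambda>z. \<kappa> z * (1 - cis (h \<bullet> z))) \<le> measure lebesgue (sym_diff S ((\<lambda>x. x - h) ` S))"
proof -
  let ?S' = "(\<lambda>x. x - h) ` S"
  let ?f = "\<lambda>x. indicator S x - indicator ?S' x :: complex"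
  have S': "?S' \<in> lmeasurable" by (rule measurable_translation_subtract[OF S])
  have f: "integrable lebesgue ?f" "?f \<in> L2"
    using indicator_L2[OF S] indicator_L2[OF S'] L2_diff by auto
  have eq: "inv_fourier_integral ?f = (\<lambda>z. \<kappa> z * (1 - cis (h \<bullet> z)))"
    using inv_fourier_integral_diff[OF indicator_L2(2)[OF S] indicator_L2(2)[OF S']]
    by (auto simp: inv_fourier_integral_translate[OF S] \<kappa>_def algebra_simps)
  have "nsq ?f = (LINT x|lebesgue. indicator (sym_diff S ?S') x)"
    unfolding nsq_def by (intro Bochner_Integration.integral_cong refl) (auto simp: indicator_def)
  also have "\<dots> = measure lebesgue (sym_diff S ?S')" by simp
  finally have "nsq ?f = measure lebesgue (sym_diff S ?S')" .
  then show "(\<lambda>z. \<kappa> z * (1 - cis (h \<bullet> z))) \<in> L2" "nsq (\<lambda>z. \<kappa> z * (1 - cis (h \<bullet> z))) \<le> measure lebesgue (sym_diff S ?S')"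
    using inv_Plancherel_le[OF f] unfolding eq by auto
qed

lemma half_le_cmod_one_minus_cis:
  assumes "1 \<le> \<bar>t\<bar>" "\<bar>t\<bar> \<le> 2"
  shows "1 / 2 \<le> (cmod (1 - cis t))\<^sup>2"
proof -
  have "(cmod (1 - cis t))\<^sup>2 = (1 - cos t)\<^sup>2 + (sin t)\<^sup>2"
    by (simp add: cmod_power2)
  also have "\<dots> = 2 - 2 * cos t"
    using sin_cos_squared_add[of t] by (simp add: power2_eq_square algebra_simps)
  also have "cos t = cos \<bar>t\<bar>" by simp
  also have "2 - 2 * cos \<bar>t\<bar> \<ge> 2 - 2 * cos (pi / 4)"
    using assms pi_gt3 pi_less_4 by (intro diff_left_mono mult_left_mono cos_monotone_0_pi_le) auto
  moreover have "cos (pi / 4) \<le> 3 / 4"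
  proof -
    have "sqrt 2 \<le> sqrt ((3/2)\<^sup>2)" by (intro real_sqrt_le_mono) (simp add: power2_eq_square)
    then have "sqrt 2 \<le> 3 / 2" by simp
    then show ?thesis by (simp add: cos_45)
  qed
  ultimately show ?thesis by linarith
qed

lemma ex_dyadic_scale:
  fixes m :: real
  assumes "1 \<le> m"
  obtains j :: nat where "2 ^ j \<le> m" "m < 2 ^ Suc j"
proof -
  define j where "j = nat \<lfloor>log 2 m\<rfloor>"
  have l: "0 \<le> log 2 m" using assms by simp
  have "real j \<le> log 2 m" "log 2 m < real (Suc j)" using l unfolding j_def by linarith+
  then have "2 powr real j \<le> m" "m < 2 powr real (Suc j)"
    using assms by (simp_all add: powr_le_iff less_powr_iff)
  moreover have "2 powr real j = 2 ^ j" "2 powr real (Suc j) = 2 ^ Suc j"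
    by (rule powr_realpow, simp)+
  ultimately show thesis by (intro that[of j]) (simp_all only:)
qed

text \<open>If the largest coordinate \<open>\<bar>z \<bullet> i\<bar>\<close> lies in \<open>[2\<^sup>j, 2\<^sup>j\<^sup>+\<^sup>1)\<close>, then translation by \<open>2\<^sup>-\<^sup>j i\<close> rotates the phase at
  \<open>z\<close> by an angle between \<open>1\<close> and \<open>2\<close>, so the term with index \<open>j\<close> is large enough by itself. If no
  coordinate exceeds \<open>1\<close>, the first summand suffices.\<close>

lemma weight_le_dyadic:
  fixes z :: "'a::euclidean_space"
  assumes \<gamma>: "0 < \<gamma>" "\<gamma> \<le> 1" and R: "0 < R"
  defines "d \<equiv> real DIM('a)"
  shows "ennreal (min 1 ((norm z / R) powr \<gamma>)) \<le> ennreal (d * R powr (- \<gamma>)) +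
     (\<Sum>j. ennreal (4 * d * min 1 ((2 ^ j / R) powr \<gamma>) * (\<Sum>i\<in>Basis. (cmod (1 - cis ((i /\<^sub>R 2 ^ j) \<bullet> z)))\<^sup>2)))"
proof -
  let ?w = "min 1 ((norm z / R) powr \<gamma>)"
  let ?t = "\<lambda>j. 4 * d * min 1 ((2 ^ j / R) powr \<gamma>) * (\<Sum>i\<in>Basis. (cmod (1 - cis ((i /\<^sub>R 2 ^ j) \<bullet> z)))\<^sup>2)"
  have d1: "1 \<le> d" unfolding d_def using DIM_positive[where 'a='a] by linarith
  have pl: "x powr \<gamma> \<le> x" if "1 \<le> x" for x :: real
    using powr_mono[OF \<gamma>(2) that] that by simp
  obtain i :: 'a where i: "i \<in> Basis" and imax: "\<And>k. k \<in> Basis \<Longrightarrow> \<bar>z \<bullet> k\<bar> \<le> \<bar>z \<bullet> i\<bar>"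
  proof -
    have "Max ((\<lambda>k. \<bar>z \<bullet> k\<bar>) ` Basis) \<in> (\<lambda>k. \<bar>z \<bullet> k\<bar>) ` Basis" by (intro Max_in) auto
    then obtain i where i: "i \<in> Basis" "Max ((\<lambda>k. \<bar>z \<bullet> k\<bar>) ` Basis) = \<bar>z \<bullet> i\<bar>" by (rule imageE)
    have "\<bar>z \<bullet> k\<bar> \<le> \<bar>z \<bullet> i\<bar>" if "k \<in> Basis" for k
      unfolding i(2)[symmetric] using that by (intro Max_ge) auto
    with i(1) show thesis by (rule that)
  qed
  define m where "m = \<bar>z \<bullet> i\<bar>"
  have "norm z \<le> (\<Sum>k\<in>Basis. \<bar>z \<bullet> k\<bar>)" by (rule norm_le_l1)
  also have "\<dots> \<le> (\<Sum>k\<in>(Basis :: 'a set). m)" unfolding m_def by (intro sum_mono imax)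
  finally have nz: "norm z \<le> d * m" by (simp add: d_def)
  show ?thesis
  proof (cases "m \<le> 1")
    case True
    have "norm z \<le> d" using nz True d1 by (smt (verit) mult_left_le)
    then have "(norm z / R) powr \<gamma> \<le> (d / R) powr \<gamma>"
      using R \<gamma> by (intro powr_mono2) (auto simp: divide_right_mono)
    also have "\<dots> = d powr \<gamma> * R powr (- \<gamma>)" using R d1 by (simp add: powr_divide powr_minus field_simps)
    also have "\<dots> \<le> d * R powr (- \<gamma>)" using pl[OF d1] by (intro mult_right_mono) auto
    finally have "ennreal ?w \<le> ennreal (d * R powr (- \<gamma>))" by (intro ennreal_leI) auto
    then show ?thesis by (simp add: add_increasing2)
  next
    case False
    then obtain j where j: "2 ^ j \<le> m" "m < 2 ^ Suc j" using ex_dyadic_scale[of m] by force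
    have "norm z \<le> 2 * d * 2 ^ j"
    proof -
      have "d * m \<le> d * (2 * 2 ^ j)" using j d1 by (intro mult_left_mono) auto
      with nz show ?thesis by simp
    qed
    then have "(norm z / R) powr \<gamma> \<le> (2 * d * (2 ^ j / R)) powr \<gamma>"
      using R \<gamma> by (intro powr_mono2) (auto simp: field_simps)
    also have "\<dots> = (2 * d) powr \<gamma> * (2 ^ j / R) powr \<gamma>" by (rule powr_mult)
    also have "\<dots> \<le> 2 * d * (2 ^ j / R) powr \<gamma>" using pl[of "2 * d"] d1 by (intro mult_right_mono) auto
    finally have w: "?w \<le> 2 * d * min 1 ((2 ^ j / R) powr \<gamma>)"
      using d1 by (auto simp: min_def)
    have "(i /\<^sub>R 2 ^ j) \<bullet> z = (z \<bullet> i) / 2 ^ j" by (simp add: inner_commute divide_inverse mult.commute)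
    then have "\<bar>(i /\<^sub>R 2 ^ j) \<bullet> z\<bar> = m / 2 ^ j" by (simp add: m_def)
    then have "1 / 2 \<le> (cmod (1 - cis ((i /\<^sub>R 2 ^ j) \<bullet> z)))\<^sup>2"
      using j by (intro half_le_cmod_one_minus_cis) (auto simp: field_simps)
    also have "\<dots> \<le> (\<Sum>i\<in>Basis. (cmod (1 - cis ((i /\<^sub>R 2 ^ j) \<bullet> z)))\<^sup>2)"
      by (rule member_le_sum[OF i]) auto
    finally have s: "1 / 2 \<le> (\<Sum>i\<in>Basis. (cmod (1 - cis ((i /\<^sub>R 2 ^ j) \<bullet> z)))\<^sup>2)" .
    have "?w \<le> 4 * d * min 1 ((2 ^ j / R) powr \<gamma>) * (1 / 2)" using w by simp
    also have "\<dots> \<le> ?t j" using s d1 by (intro mult_left_mono) auto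
    finally have "ennreal ?w \<le> ennreal (?t j)" by (rule ennreal_leI)
    also have "\<dots> \<le> (\<Sum>j. ennreal (?t j))"
      using sum_le_suminf[of "\<lambda>j. ennreal (?t j)" "{j}"] by simp
    finally show ?thesis by (simp add: add_increasing)
  qed
qed

text \<open>The weight at distance \<open>2\<^sup>j\<close> times the bound for the translation of \<open>S\<close> by \<open>2\<^sup>-\<^sup>j\<close>.\<close>

definition dyadic_term :: "real \<Rightarrow> real \<Rightarrow> real \<Rightarrow> nat \<Rightarrow> real" where
  "dyadic_term \<gamma> \<eta> R j = min 1 ((2 ^ j / R) powr \<gamma>) * (1 / 2 ^ j) powr \<eta>"

lemma weighted_nsq_le:
  fixes S :: "'a::euclidean_space set"
  assumes \<gamma>: "0 < \<gamma>" "\<gamma> \<le> 1" and \<eta>: "0 < \<eta>" and R: "0 < R"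
    and S: "S \<in> lmeasurable" "Per \<eta> S < \<infinity>"
  defines "d \<equiv> real DIM('a)" and "\<kappa> \<equiv> inv_fourier_integral (indicator S)"
  shows "(\<integral>\<^sup>+z. ennreal ((cmod (\<kappa> z))\<^sup>2) * ennreal (min 1 ((norm z / R) powr \<gamma>)) \<partial>lebesgue) \<le>
    ennreal (d * R powr (- \<gamma>) * measure lebesgue S) +
    ennreal (4 * d\<^sup>2 * enn2real (Per \<eta> S)) * (\<Sum>j. ennreal (dyadic_term \<gamma> \<eta> R j))"
proof -
  let ?P = "enn2real (Per \<eta> S)"
  let ?a = "\<lambda>j::nat. min 1 ((2 ^ j / R) powr \<gamma>)"
  let ?g = "\<lambda>(i::'a) (j::nat) z. \<kappa> z * (1 - cis ((i /\<^sub>R 2 ^ j) \<bullet> z))"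
  note ind = indicator_L2[OF S(1)]
  have \<kappa>L: "\<kappa> \<in> L2" unfolding \<kappa>_def by (rule inv_Plancherel_le[OF ind(2,1)])
  have \<kappa>n: "nsq \<kappa> \<le> measure lebesgue S" unfolding \<kappa>_def using inv_Plancherel_le(2)[OF ind(2,1)] ind(3) by simp
  have \<kappa>m: "\<kappa> \<in> borel_measurable lebesgue" by (rule L2_measurable[OF \<kappa>L])
  have gL: "?g i j \<in> L2" for i j unfolding \<kappa>_def by (rule nsq_modulation_le(1)[OF S(1)])
  have gm: "(\<lambda>z. ennreal ((cmod (?g i j z))\<^sup>2)) \<in> borel_measurable lebesgue" for i j
    using L2_measurable[OF gL] by measurable
  have gn: "nsq (?g i j) \<le> ?P * (1 / 2 ^ j) powr \<eta>" if "i \<in> Basis" for i j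
  proof -
    have "nsq (?g i j) \<le> measure lebesgue (sym_diff S ((\<lambda>x. x - i /\<^sub>R 2 ^ j) ` S))"
      unfolding \<kappa>_def by (rule nsq_modulation_le(2)[OF S(1)])
    also have "\<dots> \<le> ?P * norm (i /\<^sub>R 2 ^ j) powr \<eta>" by (rule measure_sym_diff_le_Per[OF S])
    finally show ?thesis using that by (simp add: inverse_eq_divide)
  qed
  have "ennreal ((cmod (\<kappa> z))\<^sup>2) * ennreal (min 1 ((norm z / R) powr \<gamma>)) \<le>
     ennreal (d * R powr (- \<gamma>)) * ennreal ((cmod (\<kappa> z))\<^sup>2) +
     (\<Sum>j. ennreal (4 * d * ?a j) * (\<Sum>i\<in>Basis. ennreal ((cmod (?g i j z))\<^sup>2)))" for z
  proof -
    let ?k = "ennreal ((cmod (\<kappa> z))\<^sup>2)"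
    let ?s = "\<lambda>j::nat. \<Sum>i\<in>Basis. (cmod (1 - cis ((i /\<^sub>R 2 ^ j) \<bullet> z)))\<^sup>2"
    have "?k * ennreal (min 1 ((norm z / R) powr \<gamma>)) \<le> ?k * (ennreal (d * R powr (- \<gamma>)) + (\<Sum>j. ennreal (4 * d * ?a j * ?s j)))"
      unfolding d_def by (intro mult_left_mono weight_le_dyadic[OF \<gamma> R]) auto
    also have "\<dots> = ennreal (d * R powr (- \<gamma>)) * ?k + (\<Sum>j. ?k * ennreal (4 * d * ?a j * ?s j))"
      by (simp add: distrib_left mult.commute ennreal_suminf_cmult)
    also have "(\<lambda>j. ?k * ennreal (4 * d * ?a j * ?s j)) = (\<lambda>j. ennreal (4 * d * ?a j) * (\<Sum>i\<in>Basis. ennreal ((cmod (?g i j z))\<^sup>2)))"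
    proof
      fix j
      have "?k * ennreal (4 * d * ?a j * ?s j) = ennreal ((cmod (\<kappa> z))\<^sup>2 * (4 * d * ?a j * ?s j))"
        by (rule ennreal_mult[symmetric]) (auto simp: d_def sum_nonneg)
      also have "(cmod (\<kappa> z))\<^sup>2 * (4 * d * ?a j * ?s j) = 4 * d * ?a j * (\<Sum>i\<in>Basis. (cmod (?g i j z))\<^sup>2)"
        by (simp add: norm_mult power_mult_distrib sum_distrib_left[symmetric] mult_ac)
      also have "ennreal \<dots> = ennreal (4 * d * ?a j) * ennreal (\<Sum>i\<in>Basis. (cmod (?g i j z))\<^sup>2)"
        by (rule ennreal_mult) (auto simp: d_def sum_nonneg)
      also have "ennreal (\<Sum>i\<in>Basis. (cmod (?g i j z))\<^sup>2) = (\<Sum>i\<in>Basis. ennreal ((cmod (?g i j z))\<^sup>2))"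
        by (rule sum_ennreal[symmetric]) simp
      finally show "?k * ennreal (4 * d * ?a j * ?s j) = ennreal (4 * d * ?a j) * (\<Sum>i\<in>Basis. ennreal ((cmod (?g i j z))\<^sup>2))" .
    qed
    finally show ?thesis .
  qed
  then have "(\<integral>\<^sup>+z. ennreal ((cmod (\<kappa> z))\<^sup>2) * ennreal (min 1 ((norm z / R) powr \<gamma>)) \<partial>lebesgue) \<le>
     (\<integral>\<^sup>+z. ennreal (d * R powr (- \<gamma>)) * ennreal ((cmod (\<kappa> z))\<^sup>2) +
       (\<Sum>j. ennreal (4 * d * ?a j) * (\<Sum>i\<in>Basis. ennreal ((cmod (?g i j z))\<^sup>2))) \<partial>lebesgue)"
    by (rule nn_integral_mono)
  also have "\<dots> = (\<integral>\<^sup>+z. ennreal (d * R powr (- \<gamma>)) * ennreal ((cmod (\<kappa> z))\<^sup>2) \<partial>lebesgue) +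
       (\<integral>\<^sup>+z. (\<Sum>j. ennreal (4 * d * ?a j) * (\<Sum>i\<in>Basis. ennreal ((cmod (?g i j z))\<^sup>2))) \<partial>lebesgue)"
    by (rule nn_integral_add) (use \<kappa>m gm in measurable)
  also have "(\<integral>\<^sup>+z. ennreal (d * R powr (- \<gamma>)) * ennreal ((cmod (\<kappa> z))\<^sup>2) \<partial>lebesgue) = ennreal (d * R powr (- \<gamma>)) * ennreal (nsq \<kappa>)"
    by (subst nn_integral_cmult) (use \<kappa>m nn_integral_nsq[OF \<kappa>L] in auto)
  also have "\<dots> \<le> ennreal (d * R powr (- \<gamma>) * measure lebesgue S)"
    using \<kappa>n by (subst ennreal_mult[symmetric]) (auto simp: d_def intro!: ennreal_leI mult_left_mono)
  also have "(\<integral>\<^sup>+z. (\<Sum>j. ennreal (4 * d * ?a j) * (\<Sum>i\<in>Basis. ennreal ((cmod (?g i j z))\<^sup>2))) \<partial>lebesgue) =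
      (\<Sum>j. \<integral>\<^sup>+z. ennreal (4 * d * ?a j) * (\<Sum>i\<in>Basis. ennreal ((cmod (?g i j z))\<^sup>2)) \<partial>lebesgue)"
    by (rule nn_integral_suminf) (use gm in measurable)
  also have "\<dots> \<le> (\<Sum>j. ennreal (4 * d\<^sup>2 * ?P) * ennreal (dyadic_term \<gamma> \<eta> R j))"
  proof (rule suminf_le)
    fix j
    have "(\<integral>\<^sup>+z. ennreal (4 * d * ?a j) * (\<Sum>i\<in>Basis. ennreal ((cmod (?g i j z))\<^sup>2)) \<partial>lebesgue) =
       ennreal (4 * d * ?a j) * (\<Sum>i\<in>Basis. ennreal (nsq (?g i j)))"
    proof -
      have "(\<integral>\<^sup>+z. ennreal (4 * d * ?a j) * (\<Sum>i\<in>Basis. ennreal ((cmod (?g i j z))\<^sup>2)) \<partial>lebesgue) =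
        ennreal (4 * d * ?a j) * (\<integral>\<^sup>+z. (\<Sum>i\<in>Basis. ennreal ((cmod (?g i j z))\<^sup>2)) \<partial>lebesgue)"
        by (rule nn_integral_cmult, rule borel_measurable_sum, rule gm)
      also have "(\<integral>\<^sup>+z. (\<Sum>i\<in>Basis. ennreal ((cmod (?g i j z))\<^sup>2)) \<partial>lebesgue) = (\<Sum>i\<in>Basis. ennreal (nsq (?g i j)))"
        unfolding nn_integral_nsq[OF gL, symmetric] by (rule nn_integral_sum, rule gm)
      finally show ?thesis .
    qed
    also have "\<dots> \<le> ennreal (4 * d * ?a j) * (\<Sum>i\<in>(Basis :: 'a set). ennreal (?P * (1 / 2 ^ j) powr \<eta>))"
      by (intro mult_left_mono sum_mono ennreal_leI gn) auto
    also have "(\<Sum>i\<in>(Basis :: 'a set). ennreal (?P * (1 / 2 ^ j) powr \<eta>)) = ennreal (d * (?P * (1 / 2 ^ j) powr \<eta>))"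
      by (subst sum_ennreal) (auto simp: d_def)
    also have "ennreal (4 * d * ?a j) * \<dots> = ennreal (4 * d\<^sup>2 * ?P) * ennreal (dyadic_term \<gamma> \<eta> R j)"
      by (simp add: ennreal_mult[symmetric] d_def dyadic_term_def power2_eq_square mult_ac)
    finally show "(\<integral>\<^sup>+z. ennreal (4 * d * ?a j) * (\<Sum>i\<in>Basis. ennreal ((cmod (?g i j z))\<^sup>2)) \<partial>lebesgue)
       \<le> ennreal (4 * d\<^sup>2 * ?P) * ennreal (dyadic_term \<gamma> \<eta> R j)" .
  qed auto
  also have "\<dots> = ennreal (4 * d\<^sup>2 * ?P) * (\<Sum>j. ennreal (dyadic_term \<gamma> \<eta> R j))"
    by (rule ennreal_suminf_cmult)
  finally show ?thesis by (simp add: add_mono)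
qed


section \<open>The dyadic sum\<close>

text \<open>The sum is geometric on either side of the scale \<open>2\<^sup>j \<approx> R\<close>; only for \<open>\<gamma> = \<eta>\<close> do the
  \<open>log 2 R\<close> terms below that scale all have the same size.\<close>

definition rate :: "real \<Rightarrow> real \<Rightarrow> real \<Rightarrow> real" where
  "rate \<gamma> \<eta> R = (if \<gamma> = \<eta> then R powr (- \<gamma>) * log 2 R
     else if \<gamma> > \<eta> then R powr (- \<eta>) else R powr (- \<gamma>))"

definition dyadic_constant :: "real \<Rightarrow> real \<Rightarrow> real" where
  "dyadic_constant \<gamma> \<eta> = (if \<gamma> = \<eta> then 2 else 1 / (1 - 2 powr (- \<bar>\<gamma> - \<eta>\<bar>))) + 1 / (1 - 2 powr (- \<eta>))"

lemma powr_le_rate: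
  assumes "2 \<le> R"
  shows "R powr (- \<gamma>) \<le> rate \<gamma> \<eta> R" "R powr (- \<eta>) \<le> rate \<gamma> \<eta> R"
proof -
  have l: "1 \<le> log 2 R" using assms by (simp add: le_log_iff)
  then have "R powr (- \<gamma>) * 1 \<le> R powr (- \<gamma>) * log 2 R" by (intro mult_left_mono) auto
  then show "R powr (- \<gamma>) \<le> rate \<gamma> \<eta> R" "R powr (- \<eta>) \<le> rate \<gamma> \<eta> R"
    using assms by (auto simp: rate_def intro!: powr_mono)
qed

lemma sum_geometric_le:
  fixes q :: real
  assumes "0 \<le> q" "q < 1"
  shows "(\<Sum>i<n. q ^ i) \<le> 1 / (1 - q)"
proof -
  have "(\<Sum>i<n. q ^ i) \<le> (\<Sum>i. q ^ i)"
    using assms by (intro sum_le_suminf summable_geometric) auto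
  then show ?thesis using assms by (simp add: suminf_geometric)
qed

lemma dyadic_term_nonneg: "0 \<le> dyadic_term \<gamma> \<eta> R j"
  by (simp add: dyadic_term_def)

lemma inverse_power_powr: "(1 / 2 ^ j :: real) powr \<eta> = (2 powr (- \<eta>)) ^ j"
proof -
  have "(1 / 2 ^ j :: real) powr \<eta> = (2 powr (- real j)) powr \<eta>"
    by (simp add: powr_minus powr_realpow inverse_eq_divide)
  also have "\<dots> = (2 powr (- \<eta>)) powr real j" by (simp add: powr_powr mult.commute)
  also have "\<dots> = (2 powr (- \<eta>)) ^ j" by (rule powr_realpow) simp
  finally show ?thesis .
qed

lemma dyadic_term_le:
  assumes "0 < R"
  shows "dyadic_term \<gamma> \<eta> R j \<le> (2 powr (- \<eta>)) ^ j"
    and "dyadic_term \<gamma> \<eta> R j \<le> R powr (- \<gamma>) * (2 powr (\<gamma> - \<eta>)) ^ j"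
proof -
  have "dyadic_term \<gamma> \<eta> R j \<le> 1 * (1 / 2 ^ j) powr \<eta>"
    unfolding dyadic_term_def by (intro mult_right_mono) auto
  then show "dyadic_term \<gamma> \<eta> R j \<le> (2 powr (- \<eta>)) ^ j" by (simp add: inverse_power_powr)
  have "dyadic_term \<gamma> \<eta> R j \<le> (2 ^ j / R) powr \<gamma> * (1 / 2 ^ j) powr \<eta>"
    unfolding dyadic_term_def by (intro mult_right_mono) auto
  also have "(2 ^ j / R) powr \<gamma> = R powr (- \<gamma>) * (2 powr \<gamma>) ^ j"
  proof -
    have "(2 ^ j / R) powr \<gamma> = (2 powr real j) powr \<gamma> * R powr (- \<gamma>)"
      using assms by (simp add: powr_divide powr_minus powr_realpow field_simps)
    also have "(2 powr real j) powr \<gamma> = (2 powr \<gamma>) powr real j" by (simp add: powr_powr mult.commute)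
    also have "\<dots> = (2 powr \<gamma>) ^ j" by (rule powr_realpow) simp
    finally show ?thesis by simp
  qed
  also have "R powr (- \<gamma>) * (2 powr \<gamma>) ^ j * (1 / 2 ^ j) powr \<eta> = R powr (- \<gamma>) * (2 powr (\<gamma> - \<eta>)) ^ j"
  proof -
    have "(2 powr \<gamma>) ^ j * (2 powr (- \<eta>)) ^ j = (2 powr (\<gamma> - \<eta>)) ^ j"
      by (simp flip: power_mult_distrib powr_add)
    then show ?thesis unfolding inverse_power_powr by (simp only: mult.assoc)
  qed
  finally show "dyadic_term \<gamma> \<eta> R j \<le> R powr (- \<gamma>) * (2 powr (\<gamma> - \<eta>)) ^ j" .
qed

lemma dyadic_head_le:
  assumes R: "2 \<le> R" and \<gamma>\<eta>: "0 < \<gamma>" "0 < \<eta>" and J: "2 ^ J \<le> R"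
  shows "(\<Sum>j<Suc J. dyadic_term \<gamma> \<eta> R j) \<le>
    (if \<gamma> = \<eta> then 2 else 1 / (1 - 2 powr (- \<bar>\<gamma> - \<eta>\<bar>))) * rate \<gamma> \<eta> R"
proof -
  have R0: "0 < R" using R by simp
  have le: "(\<Sum>j<Suc J. dyadic_term \<gamma> \<eta> R j) \<le> R powr (- \<gamma>) * (\<Sum>j<Suc J. (2 powr (\<gamma> - \<eta>)) ^ j)"
    unfolding sum_distrib_left by (intro sum_mono dyadic_term_le(2)[OF R0])
  consider "\<gamma> = \<eta>" | "\<gamma> < \<eta>" | "\<eta> < \<gamma>" by linarith
  then show ?thesis
  proof cases
    case 1
    have "2 powr real J \<le> R" using J by (simp add: powr_realpow)
    then have "real J \<le> log 2 R" using R0 by (simp add: le_log_iff)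
    moreover have "1 \<le> log 2 R" using R by (simp add: le_log_iff)
    ultimately have "real (Suc J) \<le> 2 * log 2 R" by simp
    then have "R powr (- \<gamma>) * real (Suc J) \<le> R powr (- \<gamma>) * (2 * log 2 R)"
      by (intro mult_left_mono) auto
    then show ?thesis using le 1 by (simp add: rate_def)
  next
    case 2
    have "2 powr (\<gamma> - \<eta>) < 2 powr 0" using 2 by (intro powr_less_mono) auto
    then have "(\<Sum>j<Suc J. (2 powr (\<gamma> - \<eta>)) ^ j) \<le> 1 / (1 - 2 powr (\<gamma> - \<eta>))"
      by (intro sum_geometric_le) auto
    then have "R powr (- \<gamma>) * (\<Sum>j<Suc J. (2 powr (\<gamma> - \<eta>)) ^ j) \<le> R powr (- \<gamma>) * (1 / (1 - 2 powr (\<gamma> - \<eta>)))"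
      by (intro mult_left_mono) auto
    then show ?thesis using le 2 by (simp add: rate_def)
  next
    case 3
    \<comment> \<open>The last term dominates, so the sum is read backwards from \<open>j = J\<close>.\<close>
    let ?q = "2 powr (\<eta> - \<gamma>)"
    have q: "?q < 2 powr 0" using 3 by (intro powr_less_mono) auto
    have "(\<Sum>j<Suc J. (2 powr (\<gamma> - \<eta>)) ^ j) = (\<Sum>i<Suc J. (2 powr (\<gamma> - \<eta>)) ^ (J - i))"
      using sum.nat_diff_reindex[of "\<lambda>j. (2 powr (\<gamma> - \<eta>)) ^ j" "Suc J"] by simp
    also have "\<dots> = (\<Sum>i<Suc J. (2 powr (\<gamma> - \<eta>)) ^ J * ?q ^ i)"
    proof (rule sum.cong[OF refl])
      fix i assume "i \<in> {..<Suc J}"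
      then have "(2 powr (\<gamma> - \<eta>)) ^ J = (2 powr (\<gamma> - \<eta>)) ^ (J - i) * (2 powr (\<gamma> - \<eta>)) ^ i"
        by (simp flip: power_add)
      moreover have "(2 powr (\<gamma> - \<eta>)) ^ i * ?q ^ i = 1"
        by (simp flip: power_mult_distrib powr_add)
      ultimately show "(2 powr (\<gamma> - \<eta>)) ^ (J - i) = (2 powr (\<gamma> - \<eta>)) ^ J * ?q ^ i"
        by (simp add: mult.assoc)
    qed
    also have "\<dots> = (2 powr (\<gamma> - \<eta>)) ^ J * (\<Sum>i<Suc J. ?q ^ i)" by (rule sum_distrib_left[symmetric])
    also have "\<dots> \<le> R powr (\<gamma> - \<eta>) * (1 / (1 - ?q))"
    proof (rule mult_mono)
      have "(2 powr (\<gamma> - \<eta>)) ^ J = (2 powr (\<gamma> - \<eta>)) powr real J" by (rule powr_realpow[symmetric]) simp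
      also have "\<dots> = (2 powr real J) powr (\<gamma> - \<eta>)" by (simp add: powr_powr mult.commute)
      also have "2 powr real J = 2 ^ J" by (rule powr_realpow) simp
      also have "(2 ^ J) powr (\<gamma> - \<eta>) \<le> R powr (\<gamma> - \<eta>)" using J 3 by (intro powr_mono2) auto
      finally show "(2 powr (\<gamma> - \<eta>)) ^ J \<le> R powr (\<gamma> - \<eta>)" .
      show "(\<Sum>i<Suc J. ?q ^ i) \<le> 1 / (1 - ?q)" using q by (intro sum_geometric_le) auto
    qed (auto intro!: sum_nonneg add_nonneg_nonneg)
    finally have "R powr (- \<gamma>) * (\<Sum>j<Suc J. (2 powr (\<gamma> - \<eta>)) ^ j) \<le> R powr (- \<gamma>) * (R powr (\<gamma> - \<eta>) * (1 / (1 - ?q)))"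
      by (intro mult_left_mono) auto
    also have "\<dots> = 1 / (1 - ?q) * R powr (- \<eta>)"
      using R0 by (simp add: powr_diff powr_minus field_simps)
    finally show ?thesis using le 3 by (simp add: rate_def)
  qed
qed

lemma dyadic_sum_le:
  assumes R: "2 \<le> R" and \<gamma>\<eta>: "0 < \<gamma>" "0 < \<eta>"
  shows "(\<Sum>j. ennreal (dyadic_term \<gamma> \<eta> R j)) \<le> ennreal (dyadic_constant \<gamma> \<eta> * rate \<gamma> \<eta> R)"
proof -
  let ?r = "2 powr (- \<eta>)"
  have R0: "0 < R" using R by simp
  have "?r < 2 powr 0" using \<gamma>\<eta> by (intro powr_less_mono) auto
  then have r: "0 \<le> ?r" "?r < 1" by auto
  obtain J :: nat where J: "2 ^ J \<le> R" "R < 2 ^ Suc J" using ex_dyadic_scale[of R] R by force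
  have sm: "summable (dyadic_term \<gamma> \<eta> R)"
    by (rule summable_comparison_test'[OF summable_geometric[of ?r]])
       (use r dyadic_term_le(1)[OF R0] dyadic_term_nonneg in auto)
  have "(\<Sum>j. dyadic_term \<gamma> \<eta> R (j + Suc J)) \<le> (\<Sum>j. R powr (- \<eta>) * ?r ^ j)"
  proof (rule suminf_le)
    show "summable (\<lambda>j. dyadic_term \<gamma> \<eta> R (j + Suc J))" by (rule summable_ignore_initial_segment[OF sm])
    show "summable (\<lambda>j. R powr (- \<eta>) * ?r ^ j)" using r by (intro summable_mult summable_geometric) auto
    fix j
    have "dyadic_term \<gamma> \<eta> R (j + Suc J) \<le> ?r ^ (j + Suc J)" by (rule dyadic_term_le(1)[OF R0])
    also have "\<dots> = ?r ^ Suc J * ?r ^ j" by (simp only: power_add mult.commute)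
    also have "?r ^ Suc J = (1 / 2 ^ Suc J) powr \<eta>" by (rule inverse_power_powr[symmetric])
    also have "\<dots> \<le> (1 / R) powr \<eta>" using J R0 \<gamma>\<eta> by (intro powr_mono2) (auto simp: frac_le)
    also have "\<dots> = R powr (- \<eta>)" using R0 by (simp add: powr_divide powr_minus inverse_eq_divide)
    finally show "dyadic_term \<gamma> \<eta> R (j + Suc J) \<le> R powr (- \<eta>) * ?r ^ j" by (simp add: mult_right_mono)
  qed
  also have "\<dots> = R powr (- \<eta>) * (1 / (1 - ?r))"
    using r by (subst suminf_mult) (auto simp: suminf_geometric intro!: summable_geometric)
  also have "\<dots> \<le> rate \<gamma> \<eta> R * (1 / (1 - ?r))"
    using r by (intro mult_right_mono powr_le_rate R) auto
  finally have tail: "(\<Sum>j. dyadic_term \<gamma> \<eta> R (j + Suc J)) \<le> rate \<gamma> \<eta> R * (1 / (1 - ?r))" .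
  have "(\<Sum>j. ennreal (dyadic_term \<gamma> \<eta> R j)) = ennreal (\<Sum>j. dyadic_term \<gamma> \<eta> R j)"
    by (rule suminf_ennreal2[OF dyadic_term_nonneg sm])
  also have "(\<Sum>j. dyadic_term \<gamma> \<eta> R j) = (\<Sum>j. dyadic_term \<gamma> \<eta> R (j + Suc J)) + (\<Sum>j<Suc J. dyadic_term \<gamma> \<eta> R j)"
    by (rule suminf_split_initial_segment[OF sm])
  also have "ennreal \<dots> \<le> ennreal (dyadic_constant \<gamma> \<eta> * rate \<gamma> \<eta> R)"
    using add_mono[OF tail dyadic_head_le[OF R \<gamma>\<eta> J(1)]] unfolding dyadic_constant_def
    by (intro ennreal_leI) (simp only: distrib_left mult.commute add.commute)
  finally show ?thesis .
qed

section \<open>The eigenvalue count\<close>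

text \<open>By Plancherel's identity the left-hand side is the integral of \<open>c\<^sup>2 \<bar>E\<bar> \<bar>\<kappa>\<bar>\<^sup>2\<close>, and the squared Hilbert--Schmidt
  norm of \<open>T\<close> is the same integral with \<open>\<bar>E\<bar>\<close> replaced by the overlap of \<open>E\<close> with its translates. The
  difference is the trace of \<open>T - T\<^sup>2\<close>.\<close>

lemma trace_deficit_le:
  fixes F S :: "'a::euclidean_space set"
  assumes \<gamma>: "0 < \<gamma>" "\<gamma> \<le> 1" and \<eta>: "0 < \<eta>" and R: "2 \<le> R"
    and F: "F \<in> lmeasurable" "Per \<gamma> F < \<infinity>" and hS: "S \<in> lmeasurable" "Per \<eta> S < \<infinity>"
  defines "E \<equiv> (\<lambda>x. R *\<^sub>R x) ` F" and "d \<equiv> real DIM('a)"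
  defines "D \<equiv> (fourier_norm DIM('a))\<^sup>2 * (R ^ DIM('a) * (measure lebesgue F + enn2real (Per \<gamma> F))) *
     ((d * measure lebesgue S + 4 * d\<^sup>2 * enn2real (Per \<eta> S) * dyadic_constant \<gamma> \<eta>) * rate \<gamma> \<eta> R)"
  shows "ennreal ((fourier_norm DIM('a))\<^sup>2 * measure lebesgue E * measure lebesgue S) \<le>
     (\<integral>\<^sup>+x. ennreal (nsq (finite_measure_sets.K E S x)) \<partial>lebesgue) + ennreal D"
proof -
  have R0: "0 < R" using R by simp
  have E: "E \<in> lmeasurable" unfolding E_def by (rule lmeasurable_scaled[OF F(1) R0])
  interpret finite_measure_sets E S by unfold_locales (fact E, fact hS(1))
  let ?c2 = "(fourier_norm DIM('a))\<^sup>2"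
  let ?M = "R ^ DIM('a) * (measure lebesgue F + enn2real (Per \<gamma> F))"
  let ?w = "\<lambda>z::'a. min 1 ((norm z / R) powr \<gamma>)"
  let ?k = "\<lambda>z. ennreal ((cmod (\<kappa> z))\<^sup>2)"
  have M0: "0 \<le> ?M" using R0 by simp
  have \<kappa>m [measurable]: "\<kappa> \<in> borel_measurable borel" by (rule \<kappa>_measurable)
  have \<kappa>m' [measurable]: "\<kappa> \<in> borel_measurable lebesgue" by (rule lebesgue_measurable_borel[OF \<kappa>m])
  have ind: "(indicator S :: 'a \<Rightarrow> complex) \<in> L2" "integrable lebesgue (indicator S :: 'a \<Rightarrow> complex)"
    by (rule indicator_L2[OF hS(1)])+
  have \<kappa>L: "\<kappa> \<in> L2" unfolding \<kappa>_def by (rule inv_Plancherel_le[OF ind(2,1)])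
  have \<kappa>n: "nsq \<kappa> = measure lebesgue S"
    unfolding \<kappa>_def nsq_inv_fourier_integral[OF ind(2)]
  proof (rule Plancherel_indicator[OF hS(1) \<eta>])
    show "measure lebesgue S - measure lebesgue (overlap S h) \<le> enn2real (Per \<eta> S) * norm h powr \<eta>" for h
      by (rule overlap_deficit_le_Per[OF hS])
  qed
  have om: "(\<lambda>z. emeasure lebesgue (overlap E z)) \<in> borel_measurable lebesgue"
  proof -
    obtain E' where E': "E' \<in> sets borel" "AE x in lborel. x \<in> E \<longleftrightarrow> x \<in> E'"
      using ex_borel_set_representative[OF fmeasurableD[OF E]] by metis
    show ?thesis
      unfolding emeasure_overlap_representative[OF fmeasurableD[OF E] E']
      by (rule lebesgue_measurable_borel, rule emeasure_overlap_measurable, rule E')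
  qed
  have wm: "(\<lambda>z. ennreal (?w z)) \<in> borel_measurable lebesgue"
    by (rule lebesgue_measurable_borel) measurable
  have pt: "ennreal (measure lebesgue E) \<le> emeasure lebesgue (overlap E z) + ennreal ?M * ennreal (?w z)" for z
  proof -
    have "measure lebesgue E \<le> measure lebesgue (overlap E z) + ?M * ?w z"
      using overlap_deficit_scaled[OF F R0, of z] unfolding E_def by simp
    then have "ennreal (measure lebesgue E) \<le> ennreal (measure lebesgue (overlap E z) + ?M * ?w z)" by (rule ennreal_leI)
    also have "\<dots> = ennreal (measure lebesgue (overlap E z)) + ennreal (?M * ?w z)"
      using M0 by (intro ennreal_plus) auto
    also have "ennreal (?M * ?w z) = ennreal ?M * ennreal (?w z)" using M0 by (intro ennreal_mult) auto
    also have "ennreal (measure lebesgue (overlap E z)) = emeasure lebesgue (overlap E z)"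
      using overlap_lmeasurable[OF E, of z] by (simp add: emeasure_eq_measure2 fmeasurableD2)
    finally show ?thesis .
  qed
  have "ennreal (?c2 * measure lebesgue E * measure lebesgue S) =
      ennreal ?c2 * ennreal (measure lebesgue E) * ennreal (nsq \<kappa>)"
    by (simp add: \<kappa>n ennreal_mult)
  also have "\<dots> = (\<integral>\<^sup>+z. ennreal ?c2 * ennreal (measure lebesgue E) * ?k z \<partial>lebesgue)"
    unfolding nn_integral_nsq[OF \<kappa>L, symmetric] by (rule nn_integral_cmult[symmetric]) measurable
  also have "\<dots> \<le> (\<integral>\<^sup>+z. ennreal (?c2 * (cmod (\<kappa> z))\<^sup>2) * emeasure lebesgue (overlap E z) + ennreal ?c2 * ennreal ?M * (?k z * ennreal (?w z)) \<partial>lebesgue)"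
  proof (rule nn_integral_mono)
    fix z
    have "ennreal ?c2 * ennreal (measure lebesgue E) * ?k z = (ennreal ?c2 * ?k z) * ennreal (measure lebesgue E)"
      by (simp add: mult_ac)
    also have "\<dots> \<le> (ennreal ?c2 * ?k z) * (emeasure lebesgue (overlap E z) + ennreal ?M * ennreal (?w z))"
      by (intro mult_left_mono pt) auto
    also have "\<dots> = ennreal (?c2 * (cmod (\<kappa> z))\<^sup>2) * emeasure lebesgue (overlap E z) + ennreal ?c2 * ennreal ?M * (?k z * ennreal (?w z))"
      by (simp only: distrib_left ennreal_mult zero_le_power2 mult_ac)
    finally show "ennreal ?c2 * ennreal (measure lebesgue E) * ?k z \<le>
      ennreal (?c2 * (cmod (\<kappa> z))\<^sup>2) * emeasure lebesgue (overlap E z) + ennreal ?c2 * ennreal ?M * (?k z * ennreal (?w z))" .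
  qed
  also have "\<dots> = (\<integral>\<^sup>+z. ennreal (?c2 * (cmod (\<kappa> z))\<^sup>2) * emeasure lebesgue (overlap E z) \<partial>lebesgue) +
      (\<integral>\<^sup>+z. ennreal ?c2 * ennreal ?M * (?k z * ennreal (?w z)) \<partial>lebesgue)"
    by (rule nn_integral_add) (use om wm in measurable)
  also have "(\<integral>\<^sup>+z. ennreal (?c2 * (cmod (\<kappa> z))\<^sup>2) * emeasure lebesgue (overlap E z) \<partial>lebesgue) =
      (\<integral>\<^sup>+x. ennreal (nsq (K x)) \<partial>lebesgue)"
    by (rule nn_integral_nsq_K[symmetric])
  also have "(\<integral>\<^sup>+z. ennreal ?c2 * ennreal ?M * (?k z * ennreal (?w z)) \<partial>lebesgue) =
      ennreal ?c2 * ennreal ?M * (\<integral>\<^sup>+z. ?k z * ennreal (?w z) \<partial>lebesgue)"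
    by (rule nn_integral_cmult) (use wm in measurable)
  also have "\<dots> \<le> ennreal D"
  proof -
    let ?W = "d * measure lebesgue S + 4 * d\<^sup>2 * enn2real (Per \<eta> S) * dyadic_constant \<gamma> \<eta>"
    let ?q = "4 * d\<^sup>2 * enn2real (Per \<eta> S)"
    have d0: "0 \<le> d" by (simp add: d_def)
    have rate0: "0 \<le> rate \<gamma> \<eta> R" using powr_le_rate(1)[OF R] order_trans powr_ge_zero by blast
    have "(\<integral>\<^sup>+z. ?k z * ennreal (?w z) \<partial>lebesgue) \<le>
      ennreal (d * R powr (- \<gamma>) * measure lebesgue S) + ennreal ?q * (\<Sum>j. ennreal (dyadic_term \<gamma> \<eta> R j))"
      unfolding \<kappa>_def d_def by (rule weighted_nsq_le[OF \<gamma> \<eta> R0 hS])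
    also have "\<dots> \<le> ennreal (d * rate \<gamma> \<eta> R * measure lebesgue S) + ennreal ?q * ennreal (dyadic_constant \<gamma> \<eta> * rate \<gamma> \<eta> R)"
      by (intro add_mono mult_left_mono ennreal_leI mult_right_mono dyadic_sum_le powr_le_rate R \<gamma> \<eta> d0) auto
    also have "\<dots> = ennreal (?W * rate \<gamma> \<eta> R)"
    proof -
      have c0: "0 \<le> dyadic_constant \<gamma> \<eta>"
      proof -
        have "2 powr (- \<eta>) \<le> 2 powr (0::real)" "2 powr (- \<bar>\<gamma> - \<eta>\<bar>) \<le> 2 powr (0::real)" using \<eta> by (intro powr_mono; simp)+
        then show ?thesis by (simp add: dyadic_constant_def)
      qed
      have "ennreal ?q * ennreal (dyadic_constant \<gamma> \<eta> * rate \<gamma> \<eta> R) = ennreal (?q * (dyadic_constant \<gamma> \<eta> * rate \<gamma> \<eta> R))"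
        using rate0 c0 by (intro ennreal_mult[symmetric]) auto
      then have "ennreal (d * rate \<gamma> \<eta> R * measure lebesgue S) + ennreal ?q * ennreal (dyadic_constant \<gamma> \<eta> * rate \<gamma> \<eta> R) =
         ennreal (d * rate \<gamma> \<eta> R * measure lebesgue S + ?q * (dyadic_constant \<gamma> \<eta> * rate \<gamma> \<eta> R))"
        using rate0 c0 d0 by (simp add: ennreal_plus)
      then show ?thesis by (simp add: algebra_simps)
    qed
    finally have "ennreal ?c2 * ennreal ?M * (\<integral>\<^sup>+z. ?k z * ennreal (?w z) \<partial>lebesgue) \<le> ennreal ?c2 * ennreal ?M * ennreal (?W * rate \<gamma> \<eta> R)"
      by (rule mult_left_mono) simp
    also have "\<dots> = ennreal (?c2 * ?M) * ennreal (?W * rate \<gamma> \<eta> R)" using M0 by (simp add: ennreal_mult)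
    also have "\<dots> = ennreal D" unfolding D_def by (rule ennreal_mult'[symmetric]) (use M0 in simp)
    finally show ?thesis .
  qed
  finally show ?thesis by (simp add: add_left_mono)
qed


lemma le_from_ennreal_le_add:
  assumes "ennreal H \<le> X + ennreal D" "0 \<le> D"
  shows "ennreal (max 0 (H - D)) \<le> X"
proof (cases X)
  case (real x)
  then have "ennreal H \<le> ennreal (x + D)" using assms by (simp add: ennreal_plus)
  then have "H \<le> x + D" using real assms(2) by (subst (asm) ennreal_le_iff) auto
  then show ?thesis using real by (auto intro!: ennreal_leI)
qed simp

theorem corollary1p6:
  "\<exists>C :: real \<Rightarrow> real \<Rightarrow> real \<Rightarrow> real \<Rightarrow> real \<Rightarrow> real \<Rightarrow> real.
     \<forall>(\<gamma>::real) (\<eta>::real) (F :: (real ^ 'n) set) (S :: (real ^ 'n) set).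
       0 < \<gamma> \<and> \<gamma> \<le> 1 \<and> 0 < \<eta> \<and> \<eta> \<le> 1 \<and>
       F \<in> lmeasurable \<and> 0 < measure lebesgue F \<and>
       S \<in> lmeasurable \<and> 0 < measure lebesgue S \<and>
       Per \<gamma> F < \<infinity> \<and> Per \<eta> S < \<infinity> \<longrightarrow>
       (\<forall>R \<epsilon>. 2 \<le> R \<and> 0 < \<epsilon> \<and> \<epsilon> < 1 \<longrightarrow>
         \<bar>real (eigenvalue_count F S \<epsilon> R) -
            (2 * pi) powr (- real CARD('n)) * measure lebesgue F * measure lebesgue S *
              R powr real CARD('n)\<bar>
         \<le> C \<gamma> \<eta> (measure lebesgue F) (measure lebesgue S)
               (enn2real (Per \<gamma> F)) (enn2real (Per \<eta> S)) / (\<epsilon> * (1 - \<epsilon>)) *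
            (if \<gamma> = \<eta> then R powr (real CARD('n) - \<gamma>) * log 2 R
             else if \<gamma> > \<eta> then R powr (real CARD('n) - \<eta>)
             else R powr (real CARD('n) - \<gamma>)))"
proof -
  let ?n = "real CARD('n)"
  let ?C = "\<lambda>\<gamma> \<eta> f s p q. 2 * ((2 * pi) powr (- ?n) * (f + p) * (?n * s + 4 * ?n\<^sup>2 * q * dyadic_constant \<gamma> \<eta>))"
  show ?thesis
  proof (rule exI[of _ ?C], intro allI impI, elim conjE)
    fix \<gamma> \<eta> R \<epsilon> :: real and F S :: "(real ^ 'n) set"
    assume \<gamma>: "0 < \<gamma>" "\<gamma> \<le> 1" and \<eta>: "0 < \<eta>" "\<eta> \<le> 1"
      and F: "F \<in> lmeasurable" "Per \<gamma> F < \<infinity>" and S: "S \<in> lmeasurable" "Per \<eta> S < \<infinity>"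
      and R: "2 \<le> R" and \<epsilon>: "0 < \<epsilon>" "\<epsilon> < 1"
    let ?f = "measure lebesgue F" and ?s = "measure lebesgue S"
    let ?p = "enn2real (Per \<gamma> F)" and ?q = "enn2real (Per \<eta> S)"
    define E where "E = (\<lambda>x. R *\<^sub>R x) ` F"
    have R0: "0 < R" using R by simp
    have E: "E \<in> lmeasurable" "measure lebesgue E = R ^ CARD('n) * ?f"
      unfolding E_def using lmeasurable_scaled[OF F(1) R0] by auto
    have fm: "finite_measure_sets E S" by unfold_locales (fact E(1), fact S(1))
    define H where "H = (fourier_norm CARD('n))\<^sup>2 * measure lebesgue E * ?s"
    define W where "W = ?n * ?s + 4 * ?n\<^sup>2 * ?q * dyadic_constant \<gamma> \<eta>"
    define D where "D = (fourier_norm CARD('n))\<^sup>2 * (R ^ CARD('n) * (?f + ?p)) * (W * rate \<gamma> \<eta> R)"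
    have "ennreal H \<le> (\<integral>\<^sup>+x. ennreal (nsq (finite_measure_sets.K E S x)) \<partial>lebesgue) + ennreal D"
      using trace_deficit_le[OF \<gamma> \<eta>(1) R F S] by (simp add: H_def D_def W_def E_def)
    moreover have D0: "0 \<le> D"
    proof -
      have "2 powr (- \<eta>) \<le> 2 powr (0::real)" "2 powr (- \<bar>\<gamma> - \<eta>\<bar>) \<le> 2 powr (0::real)"
        using \<eta> by (intro powr_mono; simp)+
      then have "0 \<le> dyadic_constant \<gamma> \<eta>" by (simp add: dyadic_constant_def)
      moreover have "0 \<le> rate \<gamma> \<eta> R" by (rule order_trans[OF powr_ge_zero powr_le_rate(1)[OF R]])
      ultimately show ?thesis using R0 by (simp add: D_def W_def)
    qed
    ultimately have Q: "ennreal (max 0 (H - D)) \<le> (\<integral>\<^sup>+x. ennreal (nsq (finite_measure_sets.K E S x)) \<partial>lebesgue)"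
      by (rule le_from_ennreal_le_add)
    have e: "0 < \<epsilon> * (1 - \<epsilon>)" using \<epsilon> by simp
    have "\<bar>real (eigenvalue_count F S \<epsilon> R) - H\<bar> \<le> 2 * (H - max 0 (H - D)) / (\<epsilon> * (1 - \<epsilon>))"
      using eigenvalue_count_bound[of R F S "max 0 (H - D)" \<epsilon>] fm Q \<epsilon> by (simp add: H_def E_def)
    also have "\<dots> \<le> 2 * D / (\<epsilon> * (1 - \<epsilon>))"
      using e by (intro divide_right_mono mult_left_mono) auto
    also have "H = (2 * pi) powr (- ?n) * ?f * ?s * R powr ?n"
      using R0 by (simp add: H_def E(2) fourier_norm_sq powr_realpow mult_ac)
    also have "2 * D = ?C \<gamma> \<eta> ?f ?s ?p ?q * (R powr ?n * rate \<gamma> \<eta> R)"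
      using R0 by (simp add: D_def W_def fourier_norm_sq powr_realpow mult_ac)
    also have "R powr ?n * rate \<gamma> \<eta> R = (if \<gamma> = \<eta> then R powr (?n - \<gamma>) * log 2 R
             else if \<gamma> > \<eta> then R powr (?n - \<eta>) else R powr (?n - \<gamma>))"
      by (simp add: rate_def powr_add[symmetric] mult.assoc[symmetric])
    finally show "\<bar>real (eigenvalue_count F S \<epsilon> R) - (2 * pi) powr (- ?n) * ?f * ?s * R powr ?n\<bar>
         \<le> ?C \<gamma> \<eta> ?f ?s ?p ?q / (\<epsilon> * (1 - \<epsilon>)) *
            (if \<gamma> = \<eta> then R powr (?n - \<gamma>) * log 2 R
             else if \<gamma> > \<eta> then R powr (?n - \<eta>) else R powr (?n - \<gamma>))"
      by simp
  qed
qed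

end
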